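(* For every $\zeta>0$ there exists a positive integer $k$ with the following property. Let $G=\mathbb{F}_p^n$ and let $f:G\times G\to\mathbb{C}$ be any function with $\|f\|_\infty\leq 1$. Then there is a bi-affine map $\beta:G^2\to\mathbb{F}_p^k$ such that, writing $F$ for the mixed convolution of $f$ and $P_\beta$ for the averaging projection on to the level sets of $\beta$, we have $\|F-P_\beta F\|_2\leq\zeta$. Moreover, $k$ can be taken to be $4m^32^m/\zeta^2$, where $m=\exp(2^{69}(\log(\zeta^{-1})+\log p)^6)$.
   Context: $p$ is a prime. A map $\beta:G^2\to\mathbb{F}_p^k$ is bi-affine if it is affine in each variable when the other is fixed. For $f:G^2\to\mathbb{C}$, the mixed convolution of $f$ is the function $F:G^2\to\mathbb{C}$ given by \[F(w,h)=\mathbb{E}_{x,y,y'\in G}f(x,y)\overline{f(x,y-h)}\,\overline{f(x-w,y')}f(x-w,y'-h).\] (Equivalently, it is $(f\,\circ_v f)\circ_h(f\circ_v f)$, where $(f\circ_v g)(x,h)=\mathbb{E}_yf(x,y)\overline{g(x,y-h)}$ and $(f\circ_h g)(w,y)=\mathbb{E}_xf(x,y)\overline{g(x-w,y)}$.) The averaging projection $P_\beta$ sends a function $F$ to the function whose value at $(x,y)$ is the average of $F$ over the level set $\{(x',y'):\beta(x',y')=\beta(x,y)\}$. Norms are with respect to the uniform probability measure: $\|F\|_2=(\mathbb{E}_{x,y}|F(x,y)|^2)^{1/2}$. *)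

theory Defs
  imports Complex_Main "Jordan_Normal_Form.Matrix" "Berlekamp_Zassenhaus.Finite_Field"
begin

(* For 'p :: prime_card, the type 'p mod_ring is the field of integers modulo the prime
   CARD('p), and carrier_vec n over it is the space F_p^n. Functions on G^2 are curried;
   only their values at points of G^2, with G = carrier_vec n, are ever used. *)

definition expect :: "'a set \<Rightarrow> ('a \<Rightarrow> 'b::field) \<Rightarrow> 'b" where
  "expect A f = (\<Sum>x\<in>A. f x) / of_nat (card A)"

definition affine_map :: "nat \<Rightarrow> nat \<Rightarrow> ('a::field vec \<Rightarrow> 'a vec) \<Rightarrow> bool" where
  "affine_map n k \<phi> \<longleftrightarrow>
     (\<exists>A \<in> carrier_mat k n. \<exists>b \<in> carrier_vec k. \<forall>x \<in> carrier_vec n. \<phi> x = A *\<^sub>v x + b)"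

definition biaffine_map :: "nat \<Rightarrow> nat \<Rightarrow> ('a::field vec \<Rightarrow> 'a vec \<Rightarrow> 'a vec) \<Rightarrow> bool" where
  "biaffine_map n k \<beta> \<longleftrightarrow>
     (\<forall>y \<in> carrier_vec n. affine_map n k (\<lambda>x. \<beta> x y)) \<and>
     (\<forall>x \<in> carrier_vec n. affine_map n k (\<lambda>y. \<beta> x y))"

definition mixed_convolution ::
  "nat \<Rightarrow> ('a::{field,finite} vec \<Rightarrow> 'a vec \<Rightarrow> complex) \<Rightarrow> 'a vec \<Rightarrow> 'a vec \<Rightarrow> complex" where
  "mixed_convolution n f w h =
     expect (carrier_vec n \<times> carrier_vec n \<times> carrier_vec n)
       (\<lambda>(x, y, y'). f x y * cnj (f x (y - h)) * cnj (f (x - w) y') * f (x - w) (y' - h))"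

definition averaging_projection ::
  "nat \<Rightarrow> ('a::{field,finite} vec \<Rightarrow> 'a vec \<Rightarrow> 'a vec) \<Rightarrow>
     ('a vec \<Rightarrow> 'a vec \<Rightarrow> complex) \<Rightarrow> 'a vec \<Rightarrow> 'a vec \<Rightarrow> complex" where
  "averaging_projection n \<beta> F x y =
     expect {(x', y') \<in> carrier_vec n \<times> carrier_vec n. \<beta> x' y' = \<beta> x y} (\<lambda>(x', y'). F x' y')"

definition norm_L2 ::
  "nat \<Rightarrow> ('a::{field,finite} vec \<Rightarrow> 'a vec \<Rightarrow> complex) \<Rightarrow> real" where
  "norm_L2 n F =
     sqrt (expect (carrier_vec n \<times> carrier_vec n) (\<lambda>(x, y). (cmod (F x y))\<^sup>2))"

end

theory Submission
  imports Defs "HOL-Library.Function_Algebras" "HOL-Library.Set_Algebras" "HOL-Library.Product_Plus"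
begin

text \<open>
  Put \<open>Q h r = E\<^bsub>x,y\<^esub> f(x, y) cnj(f(x, y - h)) e(- r x)\<close>. Then \<open>F(w, h)\<close> is the sum over \<open>r\<close> of
  \<open>\<bar>Q h r\<bar>\<^sup>2 e(r w)\<close>, so only the pairs \<open>(h, r)\<close> at which \<open>Q\<close> is large matter. Since \<open>Q\<close> is
  positive definite, every set of such pairs has many differences at which \<open>Q\<close> is again large.
  By the Balog-Szemeredi-Gowers theorem and a Freiman-type covering argument, a graph of large
  values over a positive proportion of the \<open>h\<close> agrees with an affine map on a positive proportion;
  iterating, boundedly many affine maps \<open>T\<^sub>i\<close> account for all large values except over few \<open>h\<close>.

  As a function of \<open>h\<close>, \<open>Q h (T\<^sub>i h)\<close> is an average of autocorrelations, so it has an absolutely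
  summable Fourier expansion and is approximated in \<open>L\<^sup>2\<close> by few characters \<open>s \<bullet> h\<close>. The coincidences
  \<open>T\<^sub>i h = T\<^sub>j h\<close> are detected, outside a small set of \<open>h\<close>, by the values of few functionals
  \<open>u \<bullet> T\<^sub>i h\<close>. Hence \<open>F\<close> is close in \<open>L\<^sup>2\<close> to a function of the bi-affine forms \<open>T\<^sub>i h \<bullet> w\<close>, \<open>u \<bullet> T\<^sub>i h\<close>
  and \<open>s \<bullet> h\<close>, and \<open>P\<^sub>\<beta>\<close> is the best approximation of this kind. The bound on \<open>k\<close> is doubly
  exponential, which leaves room for exponential losses in the Freiman step.
\<close>

section \<open>Popular differences and the Balog-Szemeredi-Gowers theorem\<close>

text \<open>All losses are measured by \<open>P = p / \<zeta>\<close>. The doubling constant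
  produced by Balog-Szemeredi-Gowers is polynomial in \<open>P\<close>, and the Freiman step costs
  \<open>p\<close> to a power polynomial in that constant, because \<open>t\<close> vectors over the
  prime field span at most \<open>p ^ t\<close> points. The number of affine maps is then at most
  \<open>P ^ 552 * P powr (P ^ 1061)\<close>. Its fifth power, times 42, stays below
  \<open>2 powr (P ^ 1068)\<close>, and \<open>1068 * ln P \<le> 2 ^ 69 * (ln P) ^ 6\<close> makes
  this smaller than the allowed \<open>2 powr m\<close>. The obstacle at the end is that several
  \<open>T\<^sub>i\<close> may agree at \<open>h\<close>: summing over all \<open>i\<close> would
  count one frequency repeatedly, and agreement is not visible from the values
  \<open>T\<^sub>i h \<bullet> w\<close> at a single \<open>w\<close>. Each frequency is therefore
  credited to the first index that carries it, and the bi-affine map must reveal which index this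
  is. Random functionals decide it except on few \<open>h\<close>, where trivial bounds
  suffice.\<close>

lemma card_mult_le_if_fibres_ge:
  fixes M :: real
  assumes "finite X" "finite P" and fib: "\<And>z. z \<in> P \<Longrightarrow> M \<le> card {x\<in>X. \<phi> x = z}"
  shows "M * card P \<le> card X"
proof -
  have "M * card P = (\<Sum>z\<in>P. M)" by simp
  also have "\<dots> \<le> (\<Sum>z\<in>P. real (card {x\<in>X. \<phi> x = z}))"
    by (intro sum_mono fib)
  also have "\<dots> = card (\<Union>z\<in>P. {x\<in>X. \<phi> x = z})"
    by (subst card_UN_disjoint) (use assms in auto)
  also have "\<dots> \<le> card X"
    using assms by (intro of_nat_mono card_mono) auto
  finally show ?thesis .
qed

text \<open>A representation \<open>d = b - c\<close> rewrites \<open>u + d + v\<close> as \<open>(u - c) + (b + v)\<close>. This controls iterated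
  sumsets of popular differences without Pluennecke's inequality.\<close>

lemma card_sumset_popular:
  fixes A D U V :: "'a::ab_group_add set" and M :: real
  assumes fin: "finite A" "finite D" "finite U" "finite V"
    and pop: "\<And>d. d \<in> D \<Longrightarrow> M \<le> card {(b, c). b \<in> A \<and> c \<in> A \<and> b - c = d}"
  shows "M * card (U + D + V) \<le> card (U + uminus ` A) * card (A + V)"
proof -
  have "M * card (U + D + V) \<le> card ((U + uminus ` A) \<times> (A + V))"
  proof (rule card_mult_le_if_fibres_ge[where \<phi> = "\<lambda>(x, y). x + y"])
    fix z assume "z \<in> U + D + V"
    then obtain u d v where z: "u \<in> U" "d \<in> D" "v \<in> V" "z = u + d + v"
      by (auto elim!: set_plus_elim)
    let ?g = "\<lambda>(b, c). (u + - c, b + v)"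
    have "card {(b, c). b \<in> A \<and> c \<in> A \<and> b - c = d}
        \<le> card {x \<in> (U + uminus ` A) \<times> (A + V). (case x of (x, y) \<Rightarrow> x + y) = z}"
    proof (rule card_inj_on_le[where f = ?g])
      show "inj_on ?g {(b, c). b \<in> A \<and> c \<in> A \<and> b - c = d}"
        by (auto simp: inj_on_def)
      show "?g ` {(b, c). b \<in> A \<and> c \<in> A \<and> b - c = d}
          \<subseteq> {x \<in> (U + uminus ` A) \<times> (A + V). (case x of (x, y) \<Rightarrow> x + y) = z}"
        using z by (auto intro!: set_plus_intro simp del: add_uminus_conv_diff)
    qed (simp add: fin finite_set_plus)
    with pop[OF z(2)] show "M \<le> card {x \<in> (U + uminus ` A) \<times> (A + V). (case x of (x, y) \<Rightarrow> x + y) = z}"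
      by linarith
  qed (use fin in \<open>auto intro!: finite_set_plus\<close>)
  then show ?thesis by (simp add: card_cartesian_product)
qed

lemma card_le_card_set_plus:
  fixes A B :: "'a::ab_group_add set"
  assumes "finite A" "finite B" "B \<noteq> {}"
  shows "card A \<le> card (A + B)"
proof -
  from assms(3) obtain b where "b \<in> B" by auto
  then show ?thesis
    by (intro card_inj_on_le[where f = "\<lambda>a. a + b"]) (auto intro: set_plus_intro finite_set_plus
        assms simp: inj_on_def)
qed

section \<open>Iterated sumsets and covering by translates\<close>

fun iterated_sumset :: "nat \<Rightarrow> 'a::ab_group_add set \<Rightarrow> 'a set" where
  "iterated_sumset 0 D = {0}"
| "iterated_sumset (Suc k) D = iterated_sumset k D + D"

lemma finite_iterated_sumset: "finite D \<Longrightarrow> finite (iterated_sumset k D)"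
  by (induction k) (auto intro: finite_set_plus)

text \<open>The induction runs on \<open>kD - A\<close> instead of \<open>kD\<close>: with
  \<open>V = - A\<close> the previous inequality bounds \<open>kD + D - A\<close> by
  \<open>kD - A\<close> at the price of one factor \<open>card (A - A) / M\<close>, so it reproduces
  itself.\<close>

lemma card_iterated_sumset_popular:
  fixes A D :: "'a::ab_group_add set" and M :: real
  assumes fin: "finite A" "finite D" and M: "M > 0" and "A \<noteq> {}"
    and pop: "\<And>d. d \<in> D \<Longrightarrow> M \<le> card {(b, c). b \<in> A \<and> c \<in> A \<and> b - c = d}"
  shows "card (iterated_sumset k D) \<le> card A * (card (A + uminus ` A) / M) ^ k"
proof -
  have "card (iterated_sumset k D + uminus ` A) \<le> card A * (card (A + uminus ` A) / M) ^ k"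
  proof (induction k)
    case 0
    have "{0} + uminus ` A = uminus ` A" by (auto simp: set_plus_def)
    then show ?case using card_image_le[OF fin(1), of uminus] by simp
  next
    case (Suc k)
    have "M * card (iterated_sumset k D + D + uminus ` A)
        \<le> card (iterated_sumset k D + uminus ` A) * card (A + uminus ` A)"
      by (rule card_sumset_popular[OF fin(1,2) finite_iterated_sumset _ pop]) (use fin in auto)
    also have "\<dots> \<le> (card A * (card (A + uminus ` A) / M) ^ k) * card (A + uminus ` A)"
      using Suc by (simp add: mult_right_mono)
    finally show ?case using M by (simp add: field_simps)
  qed
  moreover have "card (iterated_sumset k D) \<le> card (iterated_sumset k D + uminus ` A)"
    by (rule card_le_card_set_plus) (use assms in \<open>auto intro: finite_iterated_sumset\<close>)
  ultimately show ?thesis by linarith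
qed

text \<open>Ruzsa's covering argument. Take \<open>T\<close> maximal in \<open>X\<close> with the
  translates \<open>t + D\<close> pairwise disjoint; disjointness bounds \<open>card T\<close>, and
  maximality forces \<open>x + D\<close> to meet some \<open>t + D\<close>. Symmetry of
  \<open>D\<close> turns the resulting \<open>D - D\<close> into \<open>D + D\<close>.\<close>

lemma ex_translate_covering:
  fixes D X :: "'a::ab_group_add set"
  assumes fin: "finite X" "finite D" and "D \<noteq> {}" and sym: "uminus ` D = D"
  shows "\<exists>T\<subseteq>X. card T * card D \<le> card (X + D) \<and> X \<subseteq> T + (D + D)"
proof -
  define ok where "ok T \<longleftrightarrow> T \<subseteq> X \<and> (\<forall>t\<in>T. \<forall>t'\<in>T. \<forall>d\<in>D. \<forall>d'\<in>D. t + d = t' + d' \<longrightarrow> t = t')" for T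
  have "finite {T. ok T}" by (rule finite_subset[of _ "Pow X"]) (use fin in \<open>auto simp: ok_def\<close>)
  moreover have "ok {}" by (auto simp: ok_def)
  then have "{T. ok T} \<noteq> {}" by auto
  ultimately have "\<exists>T\<in>{T. ok T}. \<forall>T'\<in>{T. ok T}. T \<subseteq> T' \<longrightarrow> T = T'"
    by (rule finite_has_maximal)
  then obtain T where ok: "ok T" and max: "\<And>T'. ok T' \<Longrightarrow> T \<subseteq> T' \<Longrightarrow> T = T'"
    by auto
  note T = ok[unfolded ok_def]
  have T_disj: "t = t' \<and> d = d'"
    if "t \<in> T" "t' \<in> T" "d \<in> D" "d' \<in> D" "t + d = t' + d'" for t t' d d'
    using T that by (metis add_left_cancel)
  have "card T * card D = card (T \<times> D)" by (simp add: card_cartesian_product)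
  also have "\<dots> \<le> card (X + D)"
  proof (rule card_inj_on_le[where f = "\<lambda>(t, d). t + d"])
    show "inj_on (\<lambda>(t, d). t + d) (T \<times> D)"
      using T_disj by (fastforce simp: inj_on_def)
    show "(\<lambda>(t, d). t + d) ` (T \<times> D) \<subseteq> X + D"
      using T by (auto intro: set_plus_intro)
  qed (use fin in \<open>auto intro: finite_set_plus\<close>)
  finally have 1: "card T * card D \<le> card (X + D)" .
  have 2: "X \<subseteq> T + (D + D)"
  proof
    fix x assume x: "x \<in> X"
    have diffs: "a - b \<in> D + D" if "a \<in> D" "b \<in> D" for a b
      using that sym by (metis add_uminus_conv_diff imageI set_plus_intro)
    show "x \<in> T + (D + D)"
    proof (cases "x \<in> T")
      case True
      from \<open>D \<noteq> {}\<close> obtain d where "d \<in> D" by auto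
      with True have "x + (d - d) \<in> T + (D + D)" by (intro set_plus_intro diffs)
      then show ?thesis by simp
    next
      case False
      then have "\<not> ok (insert x T)" using max[of "insert x T"] by blast
      with T x have "\<exists>t\<in>T. \<exists>d\<in>D. \<exists>d'\<in>D. x + d = t + d'"
        unfolding ok_def by (metis insertE insert_subset)
      then obtain t d d' where "t \<in> T" "d \<in> D" "d' \<in> D" "x + d = t + d'" by blast
      then have "x = t + (d' - d)" by (simp add: algebra_simps)
      then show ?thesis using \<open>t \<in> T\<close> diffs[OF \<open>d' \<in> D\<close> \<open>d \<in> D\<close>] by (auto intro: set_plus_intro)
    qed
  qed
  from 1 2 T show ?thesis by blast
qed

text \<open>Popular differences replace \<open>A - A\<close>: their iterated sumsets remain
  comparable in size with \<open>A\<close>, yet half of \<open>A\<close> lies in one translate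
  \<open>a + D\<close>. The last inclusion is the purpose. It lets any number of further summands
  from \<open>D\<close> be absorbed into the group generated by the bounded set
  \<open>T\<close>.\<close>

lemma ex_popular_differences:
  fixes A :: "'a::ab_group_add set" and K :: real
  assumes fin: "finite A" and ne: "A \<noteq> {}" and K: "K \<ge> 1"
    and doubling: "card (A + uminus ` A) \<le> K * card A"
  obtains D a T where "finite D" "finite T" "T \<subseteq> iterated_sumset 3 D"
    "0 \<in> D" "uminus ` D = D" "card A \<le> 2 * card {x\<in>A. x - a \<in> D}"
    "card (D + D) \<le> 4 * K ^ 4 * card A" "card T \<le> 32 * K ^ 8"
    "D + (D + D) \<subseteq> T + (D + D)"
proof -
  let ?rep = "\<lambda>d. {(b, c). b \<in> A \<and> c \<in> A \<and> b - c = d}"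
  \<comment> \<open>There are at most \<open>K * card A\<close> differences, so those below this
    threshold represent at most half of all pairs in \<open>A \<times> A\<close>.\<close>
  define M where "M = card A / (2 * K)"
  define D where "D = {d \<in> A + uminus ` A. M \<le> card (?rep d)}"
  have cA: "card A > 0" using fin ne by auto
  have M: "M > 0" using cA K by (simp add: M_def)
  have fD: "finite D" unfolding D_def using fin by (auto intro!: finite_set_plus finite_Collect_conjI)
  have ratio: "card (A + uminus ` A) / M \<le> 2 * K\<^sup>2"
    using doubling K cA by (simp add: M_def field_simps power2_eq_square)
  have growth: "card (iterated_sumset k D) \<le> card A * (2 * K\<^sup>2) ^ k" for k
  proof -
    have "card (iterated_sumset k D) \<le> card A * (card (A + uminus ` A) / M) ^ k"
      by (rule card_iterated_sumset_popular) (use fin fD M ne in \<open>auto simp: D_def\<close>)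
    also have "\<dots> \<le> card A * (2 * K\<^sup>2) ^ k"
      using ratio M by (intro mult_left_mono power_mono) auto
    finally show ?thesis .
  qed
  have fin_rep: "finite (?rep d)" for d
    by (rule finite_subset[of _ "A \<times> A"]) (use fin in auto)
  have diff_in: "b - c \<in> A + uminus ` A" if "b \<in> A" "c \<in> A" for b c
    using that by (metis add_uminus_conv_diff imageI set_plus_intro)
  have pairs: "card A ^ 2 \<le> 2 * (\<Sum>a\<in>A. card {x\<in>A. x - a \<in> D})"
  proof -
    have "(\<Sum>d\<in>A + uminus ` A. real (card (?rep d))) = card (A \<times> A)"
    proof -
      have "A \<times> A = (\<Union>d\<in>A + uminus ` A. ?rep d)"
        using diff_in by auto
      moreover have "card (\<Union>d\<in>A + uminus ` A. ?rep d) = (\<Sum>d\<in>A + uminus ` A. card (?rep d))"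
      proof (rule card_UN_disjoint)
        show "finite (A + uminus ` A)" using fin by (simp add: finite_set_plus)
        show "\<forall>d\<in>A + uminus ` A. finite (?rep d)" using fin_rep by blast
        show "\<forall>d\<in>A + uminus ` A. \<forall>d'\<in>A + uminus ` A. d \<noteq> d' \<longrightarrow> ?rep d \<inter> ?rep d' = {}"
          by blast
      qed
      ultimately show ?thesis by (simp only: of_nat_sum)
    qed
    moreover have "(\<Sum>d\<in>A + uminus ` A. real (card (?rep d)))
        \<le> (\<Sum>d\<in>A + uminus ` A. (if d \<in> D then real (card (?rep d)) else 0) + M)"
      using M by (intro sum_mono) (auto simp: D_def)
    moreover have "\<dots> = (\<Sum>d\<in>D. real (card (?rep d))) + card (A + uminus ` A) * M"
    proof -
      have "(A + uminus ` A) \<inter> D = D" by (auto simp: D_def)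
      then show ?thesis
        using fin by (simp add: sum.distrib sum.If_cases finite_set_plus flip: sum.inter_restrict)
    qed
    moreover have "card (A + uminus ` A) * M \<le> card A ^ 2 / 2"
      using doubling K cA by (simp add: M_def field_simps power2_eq_square)
    moreover have "(\<Sum>d\<in>D. card (?rep d)) = (\<Sum>a\<in>A. card {x\<in>A. x - a \<in> D})"
    proof -
      have "(\<Sum>d\<in>D. card (?rep d)) = card (\<Union>d\<in>D. ?rep d)"
      proof (rule card_UN_disjoint[symmetric])
        show "finite D" by (rule fD)
        show "\<forall>d\<in>D. finite (?rep d)" using fin_rep by blast
        show "\<forall>d\<in>D. \<forall>d'\<in>D. d \<noteq> d' \<longrightarrow> ?rep d \<inter> ?rep d' = {}" by blast
      qed
      also have "\<dots> = card ((\<lambda>(a, x). (x, a)) ` (SIGMA a:A. {x\<in>A. x - a \<in> D}))"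
        by (rule arg_cong[where f = card]) (auto simp: image_iff)
      also have "\<dots> = card (SIGMA a:A. {x\<in>A. x - a \<in> D})"
        by (rule card_image) (auto simp: inj_on_def)
      also have "\<dots> = (\<Sum>a\<in>A. card {x\<in>A. x - a \<in> D})"
        using fin by simp
      finally show ?thesis .
    qed
    ultimately have "real (card A ^ 2) \<le> real (2 * (\<Sum>a\<in>A. card {x\<in>A. x - a \<in> D}))"
      by (simp add: card_cartesian_product power2_eq_square flip: of_nat_sum)
    then show ?thesis by linarith
  qed
  have "\<exists>a\<in>A. card A \<le> 2 * card {x\<in>A. x - a \<in> D}"
  proof (rule ccontr)
    assume "\<not> ?thesis"
    then have "(\<Sum>a\<in>A. 2 * card {x\<in>A. x - a \<in> D}) < (\<Sum>a\<in>A. card A)"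
      by (intro sum_strict_mono) (use fin ne in auto)
    with pairs show False by (simp add: power2_eq_square sum_distrib_left)
  qed
  then obtain a where a: "a \<in> A" "card A \<le> 2 * card {x\<in>A. x - a \<in> D}" by blast
  have "card {x\<in>A. x - a \<in> D} \<le> card D"
    by (rule card_inj_on_le[where f = "\<lambda>x. x - a"]) (use fD in \<open>auto simp: inj_on_def\<close>)
  with a have cD: "card A \<le> 2 * card D" by linarith
  have sym: "- d \<in> D" if "d \<in> D" for d
  proof -
    from that obtain b c where "d = b + - c" "b \<in> A" "c \<in> A" 
      by (auto simp: D_def elim!: set_plus_elim)
    then have "- d = c + - b" by simp
    with \<open>b \<in> A\<close> \<open>c \<in> A\<close> have "- d \<in> A + uminus ` A" by (metis imageI set_plus_intro)
    moreover have "card (?rep d) \<le> card (?rep (- d))"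
      by (rule card_inj_on_le[where f = "\<lambda>(b, c). (c, b)"])
        (use fin_rep in \<open>auto simp: inj_on_def\<close>)
    ultimately show ?thesis using that by (auto simp: D_def)
  qed
  have symD: "uminus ` D = D"
    using sym by (auto simp: image_iff) (metis minus_minus)
  have zero: "0 \<in> D"
  proof -
    have "card A \<le> card (?rep 0)"
      by (rule card_inj_on_le[where f = "\<lambda>x. (x, x)"])
        (use fin_rep[of 0] in \<open>auto simp: inj_on_def\<close>)
    moreover have "M \<le> card A" using K cA by (simp add: M_def field_simps)
    moreover have "a + - a \<in> A + uminus ` A" using a by (intro set_plus_intro) auto
    ultimately show ?thesis by (simp add: D_def)
  qed
  have D2: "iterated_sumset 2 D = D + D" and D3: "iterated_sumset 3 D = D + (D + D)"
    and D4: "iterated_sumset 4 D = iterated_sumset 3 D + D"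
    by (simp_all add: eval_nat_numeral set_zero[symmetric] add.assoc del: set_zero)
  \<comment> \<open>Covering \<open>3D\<close> by translates of \<open>D\<close> takes at most
    \<open>card (4D) / card D\<close> of them. Here \<open>4D\<close> has at most
    \<open>16 * K ^ 8 * card A\<close> elements and \<open>D\<close> at least
    \<open>card A / 2\<close>, hence the bound \<open>32 * K ^ 8\<close>.\<close>
  have "finite (iterated_sumset 3 D)" using fD by (rule finite_iterated_sumset)
  from ex_translate_covering[OF this fD _ symD] zero obtain T where
    T: "T \<subseteq> iterated_sumset 3 D" "card T * card D \<le> card (iterated_sumset 4 D)"
      "iterated_sumset 3 D \<subseteq> T + (D + D)"
    unfolding D4 by auto
  have fT: "finite T" using T \<open>finite (iterated_sumset 3 D)\<close> finite_subset by blast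
  have "real (card T) * card A \<le> real (card T) * (2 * card D)"
    using cD by (intro mult_left_mono) linarith+
  also have "\<dots> \<le> 2 * real (card (iterated_sumset 4 D))"
    using T(2) by (simp flip: of_nat_mult)
  also have "\<dots> \<le> 2 * (card A * (2 * K\<^sup>2) ^ 4)" using growth[of 4] by simp
  finally have "card T \<le> 32 * K ^ 8" using cA by (simp add: field_simps)
  moreover have "card (D + D) \<le> 4 * K ^ 4 * card A"
    using growth[of 2] by (simp add: D2 field_simps flip: power_mult)
  ultimately show ?thesis using that[OF fD fT T(1) zero symD a(2)] T(3) D3 by simp
qed

text \<open>In a random neighbourhood most pairs have many common neighbours, so after discarding a few
  points any two of them are joined by many paths of length four.\<close>

lemma balog_szemeredi_gowers:
  fixes S C :: "'a::ab_group_add set" and c :: real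
  assumes fin: "finite S" "finite C" and S: "S \<noteq> {}" and c: "c > 0"
    and dense: "c * card S ^ 2 \<le> (\<Sum>b\<in>S. card {a\<in>S. a - b \<in> C})"
  obtains A where "A \<subseteq> S" "c * card S \<le> 4 * card A"
    "c ^ 5 * card S ^ 3 * card (A + uminus ` A) \<le> 4096 * card C ^ 4"
proof -
  define s where "s = real (card S)"
  have s: "s > 0" using fin S by (auto simp: s_def)
  \<comment> \<open>In the graph joining \<open>a\<close> to \<open>b\<close> when
    \<open>a - b \<in> C\<close>, a point \<open>x\<close> lies in \<open>co a a'\<close> iff
    \<open>a\<close> and \<open>a'\<close> both lie in \<open>nb x\<close>. Hence the bad pairs
    counted over all neighbourhoods become a sum of \<open>card (co a a')\<close> over bad
    pairs.\<close>
  define nb where "nb b = {a\<in>S. a - b \<in> C}" for b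
  define co where "co a a' = {x\<in>S. a - x \<in> C \<and> a' - x \<in> C}" for a a'
  define bad where "bad a a' \<longleftrightarrow> card (co a a') < c\<^sup>2 / 32 * s" for a a'
  define badp where "badp b = {(a, a'). a \<in> nb b \<and> a' \<in> nb b \<and> bad a a'}" for b
  have fnb: "finite (nb b)" "nb b \<subseteq> S" for b using fin by (auto simp: nb_def)
  have fco: "finite (co a a')" for a a' using fin by (auto simp: co_def)
  \<comment> \<open>Cauchy-Schwarz in tangent form, taken at the guaranteed mean degree
    \<open>c * s\<close>.\<close>
  have sq: "2 * c * s * card (nb b) - c\<^sup>2 * s\<^sup>2 \<le> real (card (nb b)) ^ 2" for b
    using zero_le_power2[of "real (card (nb b)) - c * s"] by (simp add: power2_eq_square algebra_simps)
  have "c\<^sup>2 * s ^ 3 = 2 * c * s * (c * s\<^sup>2) - s * (c\<^sup>2 * s\<^sup>2)"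
    by (simp add: power2_eq_square power3_eq_cube)
  also have "\<dots> \<le> 2 * c * s * (\<Sum>b\<in>S. real (card (nb b))) - s * (c\<^sup>2 * s\<^sup>2)"
    using dense c s by (intro diff_right_mono mult_left_mono) (auto simp: s_def nb_def)
  also have "\<dots> = (\<Sum>b\<in>S. 2 * c * s * card (nb b) - c\<^sup>2 * s\<^sup>2)"
    by (simp add: sum_subtractf sum_distrib_left s_def)
  also have "\<dots> \<le> (\<Sum>b\<in>S. real (card (nb b)) ^ 2)" by (intro sum_mono sq)
  finally have nb2: "c\<^sup>2 * s ^ 3 \<le> (\<Sum>b\<in>S. real (card (nb b)) ^ 2)" .
  let ?B = "{(a, a'). a \<in> S \<and> a' \<in> S \<and> bad a a'}"
  have fB: "finite ?B" by (rule finite_subset[of _ "S \<times> S"]) (use fin in auto)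
  have fbad: "finite (badp b)" for b
    by (rule finite_subset[OF _ fB]) (auto simp: badp_def nb_def)
  have cB: "card ?B \<le> s\<^sup>2"
  proof -
    have "card ?B \<le> card (S \<times> S)" by (rule card_mono) (use fin in auto)
    then have "real (card ?B) \<le> real (card S * card S)"
      by (simp only: card_cartesian_product of_nat_le_iff)
    then show ?thesis by (simp add: s_def power2_eq_square)
  qed
  have "(\<Sum>b\<in>S. card (badp b)) = card (SIGMA b:S. badp b)"
    using fin fbad by (intro card_SigmaI[symmetric]) auto
  also have "\<dots> = card ((\<lambda>(b, q). (q, b)) ` (SIGMA b:S. badp b))"
    by (rule card_image[symmetric]) (auto simp: inj_on_def)
  also have "(\<lambda>(b, q). (q, b)) ` (SIGMA b:S. badp b) = (SIGMA q:?B. co (fst q) (snd q))"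
    by (force simp: badp_def nb_def co_def)
  also have "card \<dots> = (\<Sum>q\<in>?B. card (co (fst q) (snd q)))"
    using fB fco by (intro card_SigmaI) auto
  finally have "real (\<Sum>b\<in>S. card (badp b)) = real (\<Sum>q\<in>?B. card (co (fst q) (snd q)))"
    by (rule arg_cong)
  then have "(\<Sum>b\<in>S. real (card (badp b))) = (\<Sum>q\<in>?B. real (card (co (fst q) (snd q))))"
    by (simp only: of_nat_sum)
  also have "\<dots> \<le> (\<Sum>q\<in>?B. c\<^sup>2 / 32 * s)"
    by (intro sum_mono) (auto simp: bad_def)
  also have "\<dots> \<le> s\<^sup>2 * (c\<^sup>2 / 32 * s)"
    using cB c s by (simp add: mult_right_mono)
  finally have bads: "(\<Sum>b\<in>S. real (card (badp b))) \<le> c\<^sup>2 * s ^ 3 / 32"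
    by (simp add: power2_eq_square power3_eq_cube mult_ac)
  \<comment> \<open>On average over \<open>b\<close> the squared degree is at least
    \<open>c\<^sup>2 * s\<^sup>2\<close> and the number of bad pairs at most a 32nd of this. The
    weight 16 thus removes no more than half, and it leaves a neighbourhood in which at most one
    pair in 16 is bad.\<close>
  have "\<exists>b\<in>S. c\<^sup>2 * s\<^sup>2 / 2 \<le> real (card (nb b)) ^ 2 - 16 * card (badp b)"
  proof (rule ccontr)
    assume "\<not> ?thesis"
    then have "(\<Sum>b\<in>S. real (card (nb b)) ^ 2 - 16 * card (badp b)) < (\<Sum>b\<in>S. c\<^sup>2 * s\<^sup>2 / 2)"
      using fin S by (intro sum_strict_mono) auto
    also have "\<dots> = c\<^sup>2 * s ^ 3 / 2" by (simp add: s_def power2_eq_square power3_eq_cube)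
    finally show False using nb2 bads by (simp add: sum_subtractf flip: sum_distrib_left)
  qed
  then obtain b where b: "b \<in> S" "c\<^sup>2 * s\<^sup>2 / 2 \<le> real (card (nb b)) ^ 2 - 16 * card (badp b)" by blast
  define N where "N = nb b"
  define n where "n = real (card N)"
  have fN: "finite N" "N \<subseteq> S" using fnb by (auto simp: N_def)
  have bp: "16 * card (badp b) \<le> n\<^sup>2" and n2: "c\<^sup>2 * s\<^sup>2 / 2 \<le> n\<^sup>2"
    using b(2) zero_le_power2[of "c * s"] unfolding n_def N_def power_mult_distrib by linarith+
  have n: "c * s / 2 \<le> n"
  proof (rule power2_le_imp_le)
    have "(c * s / 2)\<^sup>2 = c\<^sup>2 * s\<^sup>2 / 4" by (simp add: power_mult_distrib power_divide)
    then show "(c * s / 2)\<^sup>2 \<le> n\<^sup>2" using n2 zero_le_power2[of n] by linarith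
  qed (simp add: n_def)
  then have n0: "n > 0" using c s by (smt (verit) divide_pos_pos mult_pos_pos)
  \<comment> \<open>With at most \<open>n\<^sup>2 / 16\<close> bad pairs, at most
    \<open>n / 4\<close> points are discarded here. Any two remaining points rule out at most
    \<open>n / 2\<close> midpoints between them.\<close>
  define A where "A = {a\<in>N. 4 * card {a'\<in>N. bad a a'} \<le> n}"
  have A: "A \<subseteq> N" by (auto simp: A_def)
  have "finite A" using A fN finite_subset by blast
  have nA: "n / 2 \<le> card A"
  proof -
    have "real (card (N - A)) * (n / 4) = (\<Sum>a\<in>N - A. n / 4)" by simp
    also have "\<dots> \<le> (\<Sum>a\<in>N - A. real (card {a'\<in>N. bad a a'}))"
      by (intro sum_mono) (auto simp: A_def)
    also have "\<dots> \<le> (\<Sum>a\<in>N. real (card {a'\<in>N. bad a a'}))"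
      using fN by (intro sum_mono2) auto
    also have "\<dots> = card (SIGMA a:N. {a'\<in>N. bad a a'})" using fN by simp
    also have "(SIGMA a:N. {a'\<in>N. bad a a'}) = badp b" by (auto simp: badp_def N_def)
    finally have "real (card (N - A)) * (n / 4) \<le> n\<^sup>2 / 16" using bp by linarith
    then have "card (N - A) \<le> n / 4" using n0 by (simp add: power2_eq_square field_simps)
    moreover have "real (card (N - A)) = n - card A"
      using A fN by (simp add: card_Diff_subset \<open>finite A\<close> card_mono n_def of_nat_diff)
    ultimately show ?thesis using n0 by simp
  qed
  \<comment> \<open>The paths are \<open>a - a' = (a - x) - (m - x) + (m - y) - (a' - y)\<close>
    with \<open>x \<in> co a m\<close> and \<open>y \<in> co a' m\<close>. All four brackets lie in
    \<open>C\<close>, and they determine \<open>m\<close>, \<open>x\<close> and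
    \<open>y\<close>.\<close>
  let ?\<phi> = "\<lambda>(c1, c2, c3, c4). c1 - c2 + c3 - c4"
  define M where "M = n / 2 * (c\<^sup>2 / 32 * s) ^ 2"
  have paths: "M * card (A + uminus ` A) \<le> card (C \<times> C \<times> C \<times> C)"
  proof (rule card_mult_le_if_fibres_ge[where \<phi> = ?\<phi>])
    fix z assume "z \<in> A + uminus ` A"
    then obtain a a' where a: "a \<in> A" "a' \<in> A" "z = a - a'" by (auto elim!: set_plus_elim)
    define mid where "mid = {m\<in>N. \<not> bad a m \<and> \<not> bad a' m}"
    have "n / 2 \<le> card mid"
    proof -
      have "mid = N - ({m\<in>N. bad a m} \<union> {m\<in>N. bad a' m})" by (auto simp: mid_def)
      then have "card mid \<ge> card N - card ({m\<in>N. bad a m} \<union> {m\<in>N. bad a' m})"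
        using diff_card_le_card_Diff[of "{m\<in>N. bad a m} \<union> {m\<in>N. bad a' m}" N] fN by auto
      moreover have "card ({m\<in>N. bad a m} \<union> {m\<in>N. bad a' m}) \<le> card {m\<in>N. bad a m} + card {m\<in>N. bad a' m}"
        by (rule card_Un_le)
      moreover have "4 * card {m\<in>N. bad a m} \<le> n" "4 * card {m\<in>N. bad a' m} \<le> n"
        using a by (auto simp: A_def)
      ultimately show ?thesis unfolding n_def by linarith
    qed
    have "M \<le> (\<Sum>m\<in>mid. (c\<^sup>2 / 32 * s) ^ 2)"
      unfolding M_def sum_constant using \<open>n / 2 \<le> card mid\<close> by (intro mult_right_mono) auto
    also have "\<dots> \<le> (\<Sum>m\<in>mid. real (card (co a m \<times> co a' m)))"
      unfolding card_cartesian_product of_nat_mult power2_eq_square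
      using c s by (intro sum_mono mult_mono) (auto simp: mid_def bad_def power2_eq_square)
    also have "\<dots> = card (SIGMA m:mid. co a m \<times> co a' m)"
      using fN fco by (simp add: mid_def)
    also have "\<dots> \<le> card {x \<in> C \<times> C \<times> C \<times> C. ?\<phi> x = z}"
    proof (intro of_nat_mono card_inj_on_le)
      let ?g = "\<lambda>(m, x, y). (a - x, m - x, m - y, a' - y)"
      show "inj_on ?g (SIGMA m:mid. co a m \<times> co a' m)" by (auto simp: inj_on_def)
      show "?g ` (SIGMA m:mid. co a m \<times> co a' m) \<subseteq> {x \<in> C \<times> C \<times> C \<times> C. ?\<phi> x = z}"
        using a by (auto simp: co_def)
    qed (use fin in auto)
    finally show "M \<le> card {x \<in> C \<times> C \<times> C \<times> C. ?\<phi> x = z}" .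
  qed (use fin \<open>finite A\<close> in \<open>auto simp: finite_set_plus\<close>)
  show ?thesis
  proof (rule that[of A])
    show "A \<subseteq> S" using A fN by auto
    show "c * card S \<le> 4 * card A" using n nA by (simp add: s_def)
    have "c ^ 5 * s ^ 3 / 4096 = (c * s / 2) / 2 * (c\<^sup>2 / 32 * s) ^ 2"
      by (simp add: power2_eq_square eval_nat_numeral)
    also have "\<dots> \<le> M" unfolding M_def using n by (intro mult_right_mono divide_right_mono) auto
    finally have "c ^ 5 * s ^ 3 / 4096 * card (A + uminus ` A) \<le> M * card (A + uminus ` A)"
      by (intro mult_right_mono) auto
    with paths have "c ^ 5 * s ^ 3 / 4096 * card (A + uminus ` A) \<le> real (card C) ^ 4"
      by (simp add: card_cartesian_product eval_nat_numeral)
    then show "c ^ 5 * card S ^ 3 * card (A + uminus ` A) \<le> 4096 * card C ^ 4" by (simp add: s_def)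
  qed
qed

section \<open>Fourier analysis of the mixed convolution\<close>

lemma power2_sum_le_card:
  fixes b :: "'i \<Rightarrow> real"
  shows "(\<Sum>i\<in>I. b i)\<^sup>2 \<le> card I * (\<Sum>i\<in>I. (b i)\<^sup>2)"
proof -
  have "(\<Sum>i\<in>I. b i)\<^sup>2 = (\<Sum>i\<in>I. \<Sum>j\<in>I. b i * b j)"
    by (simp add: power2_eq_square sum_product)
  also have "\<dots> \<le> (\<Sum>i\<in>I. \<Sum>j\<in>I. (b i)\<^sup>2 / 2 + (b j)\<^sup>2 / 2)"
  proof (intro sum_mono)
    fix i j show "b i * b j \<le> (b i)\<^sup>2 / 2 + (b j)\<^sup>2 / 2"
      using sum_squares_bound[of "b i" "b j"] by simp
  qed
  also have "\<dots> = card I * (\<Sum>i\<in>I. (b i)\<^sup>2)"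
    by (simp add: sum.distrib sum_distrib_left field_simps flip: sum_divide_distrib)
  finally show ?thesis .
qed

lemma norm_square_diff_le:
  fixes a b :: complex
  assumes "cmod a \<le> 1" "cmod b \<le> 1"
  shows "((cmod a)\<^sup>2 - (cmod b)\<^sup>2)\<^sup>2 \<le> 4 * (cmod (a - b))\<^sup>2"
proof -
  have "\<bar>(cmod a)\<^sup>2 - (cmod b)\<^sup>2\<bar> = \<bar>cmod a - cmod b\<bar> * (cmod a + cmod b)"
    by (simp add: power2_eq_square square_diff_square_factored abs_mult mult.commute)
  also have "\<dots> \<le> cmod (a - b) * 2"
    using assms norm_triangle_ineq3[of a b] by (intro mult_mono) auto
  finally have "\<bar>(cmod a)\<^sup>2 - (cmod b)\<^sup>2\<bar>\<^sup>2 \<le> (cmod (a - b) * 2)\<^sup>2" by (rule power_mono) simp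
  then show ?thesis by (simp add: power_mult_distrib)
qed

section \<open>Fourier analysis on a finite self-dual group\<close>

text \<open>The group is identified with its own dual through \<open>e\<close>, so points and
  frequencies share the set \<open>G\<close> and a map of \<open>G\<close> into itself can select
  one frequency for each \<open>h\<close>. The bicharacter laws are asked of the whole type while
  orthogonality is stated on \<open>G\<close>; this fits a function space whose pairing reads
  finitely many coordinates.\<close>

locale dual_pairing =
  fixes G :: "'a::ab_group_add set" and e :: "'a \<Rightarrow> 'a \<Rightarrow> complex"
  assumes finite_G: "finite G" and zero_G: "0 \<in> G"
    and diff_G: "x \<in> G \<Longrightarrow> y \<in> G \<Longrightarrow> x - y \<in> G"
    and e_add: "e (x + y) z = e x z * e y z"
    and e_sym: "e x y = e y x"
    and e_norm: "cmod (e x y) = 1"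
    and orthogonality: "r \<in> G \<Longrightarrow> r \<noteq> 0 \<Longrightarrow> (\<Sum>x\<in>G. e r x) = 0"
begin

lemma minus_G: "x \<in> G \<Longrightarrow> - x \<in> G"
  using diff_G[OF zero_G] by simp

lemma add_G: "x \<in> G \<Longrightarrow> y \<in> G \<Longrightarrow> x + y \<in> G"
  using diff_G[of x "- y"] minus_G by simp

abbreviation N :: nat where "N \<equiv> card G"

lemma N_pos: "N > 0"
  using finite_G zero_G by (auto simp: card_gt_0_iff)

lemma e_zero: "e 0 z = 1"
proof -
  have "e 0 z * e 0 z = e 0 z" using e_add[of 0 0 z] by simp
  moreover have "e 0 z \<noteq> 0" using e_norm[of 0 z] by auto
  ultimately show ?thesis by simp
qed

lemma e_cnj: "e x y * cnj (e x y) = 1"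
  using complex_norm_square[of "e x y"] by (simp add: e_norm)

lemma e_minus: "e (- x) z = cnj (e x z)"
proof -
  have "e (- x) z * e x z = 1" using e_add[of "- x" x z] by (simp add: e_zero)
  then have "e (- x) z * (e x z * cnj (e x z)) = cnj (e x z)" by (metis mult.assoc mult_1)
  then show ?thesis by (simp add: e_cnj)
qed

lemma e_diff: "e (x - y) z = e x z * cnj (e y z)"
  using e_add[of x "- y" z] by (simp add: e_minus)

lemma e_diff_right: "e z (x - y) = e z x * cnj (e z y)"
  using e_diff[of x y z] by (simp add: e_sym)

lemma sum_e:
  assumes "x \<in> G" "y \<in> G"
  shows "(\<Sum>r\<in>G. e x r * cnj (e y r)) = (if x = y then of_nat N else 0)"
  using orthogonality[OF diff_G[OF assms]] by (auto simp: e_cnj e_diff)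

lemma sum_e_left:
  assumes "x \<in> G" "y \<in> G"
  shows "(\<Sum>r\<in>G. e r x * cnj (e r y)) = (if x = y then of_nat N else 0)"
  using sum_e[OF assms] by (simp add: e_sym[of x] e_sym[of y])

lemma sum_translate:
  assumes "w \<in> G"
  shows "(\<Sum>x\<in>G. \<phi> (x - w)) = (\<Sum>x\<in>G. \<phi> x)"
  by (rule sum.reindex_bij_witness[of _ "\<lambda>x. x + w" "\<lambda>x. x - w"]) (auto intro: assms diff_G add_G)

definition fourier :: "('a \<Rightarrow> complex) \<Rightarrow> 'a \<Rightarrow> complex" where
  "fourier u r = (\<Sum>x\<in>G. u x * cnj (e r x)) / of_nat N"

lemma fourier_inversion:
  assumes "x \<in> G"
  shows "u x = (\<Sum>r\<in>G. fourier u r * e r x)"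
proof -
  have "(\<Sum>r\<in>G. fourier u r * e r x) = (\<Sum>r\<in>G. \<Sum>y\<in>G. u y * (e r x * cnj (e r y)) / of_nat N)"
    by (simp add: fourier_def sum_distrib_left sum_distrib_right sum_divide_distrib mult_ac)
  also have "\<dots> = (\<Sum>y\<in>G. u y * (\<Sum>r\<in>G. e r x * cnj (e r y)) / of_nat N)"
    by (subst sum.swap) (simp add: sum_distrib_left sum_divide_distrib)
  also have "\<dots> = (\<Sum>y\<in>G. if x = y then u y else 0)"
    using assms N_pos by (intro sum.cong) (auto simp: sum_e_left)
  also have "\<dots> = u x" using assms finite_G N_pos by simp
  finally show ?thesis by simp
qed

lemma norm2_trig_sum:
  assumes "R \<subseteq> G"
  shows "(\<Sum>x\<in>G. (cmod (\<Sum>r\<in>R. c r * e r x))\<^sup>2) = N * (\<Sum>r\<in>R. (cmod (c r))\<^sup>2)"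
proof -
  have fR: "finite R" using assms finite_G finite_subset by blast
  have "complex_of_real (\<Sum>x\<in>G. (cmod (\<Sum>r\<in>R. c r * e r x))\<^sup>2)
      = (\<Sum>x\<in>G. \<Sum>r\<in>R. \<Sum>r'\<in>R. c r * cnj (c r') * (e r x * cnj (e r' x)))"
    by (simp add: complex_norm_square sum_product mult_ac del: of_real_power)
  also have "\<dots> = (\<Sum>r\<in>R. \<Sum>r'\<in>R. c r * cnj (c r') * (\<Sum>x\<in>G. e r x * cnj (e r' x)))"
    by (subst sum.swap, rule sum.cong[OF refl], subst sum.swap) (simp add: sum_distrib_left)
  also have "\<dots> = (\<Sum>r\<in>R. \<Sum>r'\<in>R. if r = r' then c r * cnj (c r') * of_nat N else 0)"
    by (intro sum.cong refl, subst sum_e) (use assms in auto)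
  also have "\<dots> = (\<Sum>r\<in>R. c r * cnj (c r) * of_nat N)" using fR by simp
  also have "\<dots> = complex_of_real (N * (\<Sum>r\<in>R. (cmod (c r))\<^sup>2))"
    by (simp add: complex_norm_square sum_distrib_left mult_ac del: of_real_power)
  finally show ?thesis by (simp only: of_real_eq_iff)
qed

lemma parseval: "N * (\<Sum>r\<in>G. (cmod (fourier u r))\<^sup>2) = (\<Sum>x\<in>G. (cmod (u x))\<^sup>2)"
proof -
  have "(\<Sum>x\<in>G. (cmod (u x))\<^sup>2) = (\<Sum>x\<in>G. (cmod (\<Sum>r\<in>G. fourier u r * e r x))\<^sup>2)"
    by (rule sum.cong) (simp_all flip: fourier_inversion)
  then show ?thesis using norm2_trig_sum[of G "fourier u"] by simp
qed

lemma parseval_le: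
  assumes "\<And>x. x \<in> G \<Longrightarrow> cmod (u x) \<le> 1"
  shows "(\<Sum>r\<in>G. (cmod (fourier u r))\<^sup>2) \<le> 1"
proof -
  have "(\<Sum>x\<in>G. (cmod (u x))\<^sup>2) \<le> (\<Sum>x\<in>G. 1)"
    using assms by (intro sum_mono) (simp add: power_le_one)
  with parseval[of u] have "N * (\<Sum>r\<in>G. (cmod (fourier u r))\<^sup>2) \<le> real N * 1" by simp
  then show ?thesis using N_pos by simp
qed

text \<open>The one-variable building block: an autocorrelation in the second variable followed by
  one in the first gives the mixed convolution.\<close>

definition autocorr :: "('a \<Rightarrow> complex) \<Rightarrow> 'a \<Rightarrow> complex" where
  "autocorr u h = (\<Sum>x\<in>G. u x * cnj (u (x - h))) / of_nat N"

text \<open>The coefficients are squared moduli, hence nonnegative, and Parseval bounds their sum by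
  1 when \<open>u\<close> is bounded by 1. This absolute summability is what makes truncation to few
  characters possible.\<close>

lemma autocorr_fourier:
  assumes "h \<in> G"
  shows "autocorr u h = (\<Sum>s\<in>G. of_real ((cmod (fourier u s))\<^sup>2) * e s h)"
proof -
  have "autocorr u h = (\<Sum>x\<in>G. u x * cnj (\<Sum>s\<in>G. fourier u s * e s (x - h))) / of_nat N"
    unfolding autocorr_def
    by (intro arg_cong2[where f = "(/)"] sum.cong) (simp_all add: assms diff_G flip: fourier_inversion)
  also have "\<dots> = (\<Sum>x\<in>G. \<Sum>s\<in>G. cnj (fourier u s) * e s h * (u x * cnj (e s x))) / of_nat N"
    by (simp add: e_diff_right sum_distrib_left mult_ac)
  also have "\<dots> = (\<Sum>s\<in>G. cnj (fourier u s) * e s h * fourier u s)"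
    by (subst sum.swap) (simp add: fourier_def sum_distrib_left sum_divide_distrib)
  also have "\<dots> = (\<Sum>s\<in>G. of_real ((cmod (fourier u s))\<^sup>2) * e s h)"
    by (simp add: complex_norm_square mult_ac del: of_real_power)
  finally show ?thesis .
qed

lemma norm_autocorr_le:
  assumes "h \<in> G" "\<And>x. x \<in> G \<Longrightarrow> cmod (u x) \<le> 1"
  shows "cmod (autocorr u h) \<le> 1"
proof -
  have "cmod (\<Sum>x\<in>G. u x * cnj (u (x - h))) \<le> (\<Sum>x\<in>G. 1)"
    by (rule sum_norm_le) (use assms in \<open>auto simp: norm_mult intro!: mult_le_one diff_G\<close>)
  then show ?thesis using N_pos by (simp add: autocorr_def norm_divide)
qed

text \<open>The quantity \<open>Q h r\<close> of the overview.\<close>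

definition coeff2 :: "('a \<Rightarrow> 'a \<Rightarrow> complex) \<Rightarrow> 'a \<Rightarrow> 'a \<Rightarrow> complex" where
  "coeff2 f h r = fourier (\<lambda>x. autocorr (f x) h) r"

text \<open>Translating the kernel of a nontrivial character by a point outside it gives a disjoint
  copy.\<close>

lemma card_kernel_le:
  assumes "w \<in> G" "w \<noteq> 0"
  shows "2 * card {u\<in>G. e u w = 1} \<le> N"
proof -
  let ?K = "{u\<in>G. e u w = 1}"
  have "\<exists>u0\<in>G. e u0 w \<noteq> 1"
  proof (rule ccontr)
    assume "\<not> ?thesis"
    then have "(\<Sum>x\<in>G. e w x) = of_nat N" by (simp add: e_sym[of w])
    then show False using orthogonality[OF assms] N_pos by simp
  qed
  then obtain u0 where u0: "u0 \<in> G" "e u0 w \<noteq> 1" by blast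
  have "card ?K + card ((\<lambda>u. u + u0) ` ?K) = card (?K \<union> (\<lambda>u. u + u0) ` ?K)"
    by (rule card_Un_disjoint[symmetric]) (use finite_G u0 in \<open>auto simp: e_add\<close>)
  also have "\<dots> \<le> N" using u0 finite_G by (intro card_mono) (auto intro: add_G)
  finally show ?thesis by (simp add: card_image)
qed

text \<open>Each nonzero vector satisfies \<open>e u v = 1\<close> for at most half of all
  \<open>u\<close>, so by averaging some \<open>u\<close> at least halves the set of undetected
  \<open>x\<close>. Doing this \<open>r\<close> times gives the factor \<open>2 ^ r\<close>.\<close>

lemma ex_separating_set:
  assumes "finite X" and v: "\<And>x. x \<in> X \<Longrightarrow> v x \<in> G" "\<And>x. x \<in> X \<Longrightarrow> v x \<noteq> 0"
  shows "\<exists>U\<subseteq>G. card U \<le> r \<and> 2 ^ r * card {x\<in>X. \<forall>u\<in>U. e u (v x) = 1} \<le> card X"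
proof (induction r)
  case 0
  show ?case by (rule exI[of _ "{}"]) simp
next
  case (Suc r)
  then obtain U where U: "U \<subseteq> G" "card U \<le> r" "2 ^ r * card {x\<in>X. \<forall>u\<in>U. e u (v x) = 1} \<le> card X"
    by blast
  define Y where "Y = {x\<in>X. \<forall>u\<in>U. e u (v x) = 1}"
  have Y: "finite Y" "Y \<subseteq> X" using assms by (auto simp: Y_def)
  have "(\<Sum>u\<in>G. 2 * card {x\<in>Y. e u (v x) = 1}) = 2 * card (SIGMA u:G. {x\<in>Y. e u (v x) = 1})"
    using finite_G Y by (simp add: sum_distrib_left)
  also have "card (SIGMA u:G. {x\<in>Y. e u (v x) = 1})
      = card ((\<lambda>(u, x). (x, u)) ` (SIGMA u:G. {x\<in>Y. e u (v x) = 1}))"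
    by (rule card_image[symmetric]) (auto simp: inj_on_def)
  also have "(\<lambda>(u, x). (x, u)) ` (SIGMA u:G. {x\<in>Y. e u (v x) = 1}) = (SIGMA x:Y. {u\<in>G. e u (v x) = 1})"
    by (auto simp: image_iff)
  also have "2 * card \<dots> = (\<Sum>x\<in>Y. 2 * card {u\<in>G. e u (v x) = 1})"
    using finite_G Y by (simp add: sum_distrib_left)
  also have "\<dots> \<le> (\<Sum>x\<in>Y. N)"
    using v Y by (intro sum_mono card_kernel_le) auto
  finally have avg: "(\<Sum>u\<in>G. 2 * card {x\<in>Y. e u (v x) = 1}) \<le> N * card Y"
    by (simp add: mult.commute)
  have "\<exists>u\<in>G. 2 * card {x\<in>Y. e u (v x) = 1} \<le> card Y"
  proof (rule ccontr)
    assume "\<not> ?thesis"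
    then have "(\<Sum>u\<in>G. card Y) < (\<Sum>u\<in>G. 2 * card {x\<in>Y. e u (v x) = 1})"
      by (intro sum_strict_mono) (use finite_G zero_G in auto)
    with avg show False by simp
  qed
  then obtain u where u: "u \<in> G" "2 * card {x\<in>Y. e u (v x) = 1} \<le> card Y" by blast
  have eq: "{x\<in>X. \<forall>u\<in>insert u U. e u (v x) = 1} = {x\<in>Y. e u (v x) = 1}" by (auto simp: Y_def)
  have "2 ^ Suc r * card {x\<in>Y. e u (v x) = 1} = 2 ^ r * (2 * card {x\<in>Y. e u (v x) = 1})" by simp
  also have "\<dots> \<le> 2 ^ r * card Y" by (rule mult_le_mono2[OF u(2)])
  also have "\<dots> \<le> card X" using U(3) by (simp add: Y_def)
  finally have "2 ^ Suc r * card {x\<in>Y. e u (v x) = 1} \<le> card X" .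
  moreover have "card (insert u U) \<le> Suc r"
    using U(2) by (intro card_insert_le_m1) auto
  moreover have "insert u U \<subseteq> G" using U u by simp
  ultimately show ?case unfolding eq[symmetric] by blast
qed

section \<open>The large spectrum of a bounded function\<close>

context
  fixes f :: "'a \<Rightarrow> 'a \<Rightarrow> complex"
  assumes f_le: "\<And>x y. x \<in> G \<Longrightarrow> y \<in> G \<Longrightarrow> cmod (f x y) \<le> 1"
begin

lemma sum_coeff2_le: "h \<in> G \<Longrightarrow> (\<Sum>r\<in>G. (cmod (coeff2 f h r))\<^sup>2) \<le> 1"
  unfolding coeff2_def by (rule parseval_le) (auto intro: norm_autocorr_le f_le)

lemma norm_coeff2_le:
  assumes "h \<in> G" "r \<in> G"
  shows "cmod (coeff2 f h r) \<le> 1"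
proof -
  have "(cmod (coeff2 f h r))\<^sup>2 \<le> (\<Sum>r\<in>G. (cmod (coeff2 f h r))\<^sup>2)"
    using finite_G assms by (intro member_le_sum) auto
  also have "\<dots> \<le> 1" by (rule sum_coeff2_le) (rule assms)
  finally show ?thesis by (simp add: power2_le_iff_abs_le power_le_one_iff abs_square_le_1)
qed

lemma coeff2_conv_sum:
  "coeff2 f h r = (\<Sum>(x, y)\<in>G \<times> G. f x y * cnj (f x (y - h) * e r x)) / of_nat N ^ 2"
  by (simp add: coeff2_def fourier_def autocorr_def sum_distrib_right sum_divide_distrib
      power2_eq_square sum.cartesian_product case_prod_unfold mult.assoc flip: sum_divide_distrib)

text \<open>\<open>coeff2 f h r = \<langle>f, \<pi> f\<rangle>\<close> for the commuting operators \<open>\<pi>\<close> that translate the second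
  variable by \<open>h\<close> and modulate the first one by \<open>r\<close>, so it is a positive definite function.\<close>

lemma coeff2_differences:
  assumes S: "S \<subseteq> G \<times> G" and large: "\<And>z. z \<in> S \<Longrightarrow> \<delta> \<le> cmod (coeff2 f (fst z) (snd z))" and "\<delta> \<ge> 0"
  shows "(\<delta> * card S)\<^sup>2 \<le> (\<Sum>z\<in>S. \<Sum>z'\<in>S. cmod (coeff2 f (fst (z' - z)) (snd (z' - z))))"
proof -
  define Q where "Q z = coeff2 f (fst z) (snd z)" for z
  have fS: "finite S" using S finite_G by (meson finite_SigmaI finite_subset)
  \<comment> \<open>Phases that turn coefficients into their moduli; the value 1 at a vanishing
    coefficient keeps every \<open>c z\<close> unimodular.\<close>
  define c where "c z = (if Q z = 0 then 1 else cnj (Q z) / of_real (cmod (Q z)))" for z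
  have c1: "cmod (c z) = 1" for z by (simp add: c_def norm_divide)
  have cQ: "c z * Q z = of_real (cmod (Q z))" for z
    using complex_norm_square[of "Q z"] by (simp add: c_def field_simps power2_eq_square)
  define m where "m z x y = f x (y - fst z) * e (snd z) x" for z :: "'a \<times> 'a" and x y
  \<comment> \<open>The correlation of \<open>f\<close> with \<open>\<Psi>\<close> is the sum of the
    moduli, while the squared norm of \<open>\<Psi>\<close> expands into coefficients at the
    differences \<open>z' - z\<close>. Cauchy-Schwarz compares the two.\<close>
  define \<Psi> where "\<Psi> x y = (\<Sum>z\<in>S. cnj (c z) * m z x y)" for x y
  have Q_sum: "Q z * of_nat N ^ 2 = (\<Sum>(x, y)\<in>G \<times> G. f x y * cnj (m z x y))" for z
    using N_pos by (simp add: Q_def coeff2_conv_sum m_def)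
  have corr: "(\<Sum>(x, y)\<in>G \<times> G. m z x y * cnj (m z' x y)) = Q (z' - z) * of_nat N ^ 2"
    if "z \<in> S" for z z'
  proof -
    have h: "fst z \<in> G" using that S by auto
    have "(\<Sum>(x, y)\<in>G \<times> G. m z x y * cnj (m z' x y))
        = (\<Sum>x\<in>G. \<Sum>y\<in>G. m z x y * cnj (m z' x y))"
      by (simp add: sum.cartesian_product)
    also have "\<dots> = (\<Sum>x\<in>G. \<Sum>y\<in>G. f x y * cnj (f x (y - fst (z' - z)) * e (snd (z' - z)) x))"
    proof (rule sum.cong[OF refl])
      fix x
      have "(\<Sum>y\<in>G. m z x y * cnj (m z' x y))
          = (\<Sum>y\<in>G. f x (y - fst z) * cnj (f x ((y - fst z) - fst (z' - z)) * e (snd (z' - z)) x))"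
        by (intro sum.cong) (simp_all add: m_def e_diff algebra_simps)
      then show "(\<Sum>y\<in>G. m z x y * cnj (m z' x y))
          = (\<Sum>y\<in>G. f x y * cnj (f x (y - fst (z' - z)) * e (snd (z' - z)) x))"
        using sum_translate[OF h, of "\<lambda>y. f x y * cnj (f x (y - fst (z' - z)) * e (snd (z' - z)) x)"]
        by simp
    qed
    also have "\<dots> = Q (z' - z) * of_nat N ^ 2"
      unfolding Q_sum m_def by (simp add: sum.cartesian_product)
    finally show ?thesis .
  qed
  have "(\<Sum>z\<in>S. of_real (cmod (Q z))) * of_nat N ^ 2 = (\<Sum>z\<in>S. c z * (Q z * of_nat N ^ 2))"
    by (simp add: sum_distrib_right cQ flip: mult.assoc)
  also have "\<dots> = (\<Sum>z\<in>S. \<Sum>(x, y)\<in>G \<times> G. f x y * cnj (cnj (c z) * m z x y))"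
    by (simp add: Q_sum sum_distrib_left case_prod_unfold mult_ac)
  also have "\<dots> = (\<Sum>(x, y)\<in>G \<times> G. f x y * cnj (\<Psi> x y))"
    by (subst sum.swap) (simp add: \<Psi>_def sum_distrib_left case_prod_unfold)
  finally have *: "(\<Sum>z\<in>S. of_real (cmod (Q z))) * of_nat N ^ 2 = (\<Sum>(x, y)\<in>G \<times> G. f x y * cnj (\<Psi> x y))" .
  have "\<delta> * card S * N ^ 2 \<le> (\<Sum>z\<in>S. cmod (Q z)) * N ^ 2"
  proof (rule mult_right_mono)
    have "(\<Sum>z\<in>S. \<delta>) \<le> (\<Sum>z\<in>S. cmod (Q z))" by (intro sum_mono) (simp add: Q_def large)
    then show "\<delta> * card S \<le> (\<Sum>z\<in>S. cmod (Q z))" by (simp add: mult.commute)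
  qed simp
  also have "\<dots> = cmod ((\<Sum>z\<in>S. of_real (cmod (Q z))) * of_nat N ^ 2)"
    by (simp add: norm_mult norm_power sum_nonneg flip: of_real_sum)
  also have "\<dots> \<le> (\<Sum>q\<in>G \<times> G. cmod (\<Psi> (fst q) (snd q)))"
    unfolding * case_prod_unfold
    by (rule sum_norm_le) (auto simp: norm_mult intro!: mult_left_le_one_le f_le)
  finally have "(\<delta> * card S * N ^ 2)\<^sup>2 \<le> (\<Sum>q\<in>G \<times> G. cmod (\<Psi> (fst q) (snd q)))\<^sup>2"
    using \<open>\<delta> \<ge> 0\<close> by (intro power_mono) auto
  also have "\<dots> \<le> card (G \<times> G) * (\<Sum>q\<in>G \<times> G. (cmod (\<Psi> (fst q) (snd q)))\<^sup>2)"
    by (rule power2_sum_le_card)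
  also have "\<dots> = N ^ 2 * cmod (of_real (\<Sum>q\<in>G \<times> G. (cmod (\<Psi> (fst q) (snd q)))\<^sup>2))"
    by (simp add: card_cartesian_product power2_eq_square sum_nonneg del: of_real_sum)
  also have "of_real (\<Sum>q\<in>G \<times> G. (cmod (\<Psi> (fst q) (snd q)))\<^sup>2)
      = (\<Sum>q\<in>G \<times> G. \<Sum>z\<in>S. \<Sum>z'\<in>S. cnj (c z) * c z' * (m z (fst q) (snd q) * cnj (m z' (fst q) (snd q))))"
    unfolding of_real_sum complex_norm_square \<Psi>_def cnj_sum sum_product
    by (intro sum.cong refl) (simp add: mult_ac)
  also have "\<dots> = (\<Sum>z\<in>S. \<Sum>z'\<in>S. cnj (c z) * c z' * (\<Sum>(x, y)\<in>G \<times> G. m z x y * cnj (m z' x y)))"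
    by (subst sum.swap, rule sum.cong[OF refl], subst sum.swap) (simp add: sum_distrib_left
        case_prod_unfold)
  also have "\<dots> = (\<Sum>z\<in>S. \<Sum>z'\<in>S. cnj (c z) * c z' * (Q (z' - z) * of_nat N ^ 2))"
    by (intro sum.cong refl) (simp add: corr)
  also have "cmod \<dots> \<le> (\<Sum>z\<in>S. \<Sum>z'\<in>S. cmod (Q (z' - z)) * N ^ 2)"
    by (intro sum_norm_le) (auto simp: norm_mult norm_power c1)
  finally have "(\<delta> * card S * N ^ 2)\<^sup>2 \<le> N ^ 2 * (\<Sum>z\<in>S. \<Sum>z'\<in>S. cmod (Q (z' - z)) * N ^ 2)"
    by (simp add: mult_left_mono)
  also have "\<dots> = (\<Sum>z\<in>S. \<Sum>z'\<in>S. cmod (Q (z' - z))) * (real N ^ 2) ^ 2"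
    by (simp add: sum_distrib_right sum_distrib_left power2_eq_square mult_ac)
  finally have "(\<delta> * card S)\<^sup>2 * (real N ^ 2) ^ 2 \<le> (\<Sum>z\<in>S. \<Sum>z'\<in>S. cmod (Q (z' - z))) * (real N ^ 2) ^ 2"
    by (simp add: power_mult_distrib)
  then show ?thesis using N_pos by (simp add: Q_def)
qed

definition large_spectrum :: "real \<Rightarrow> ('a \<times> 'a) set" where
  "large_spectrum \<delta> = {z \<in> G \<times> G. \<delta> \<le> cmod (coeff2 f (fst z) (snd z))}"

lemma finite_large_spectrum: "finite (large_spectrum \<delta>)"
  unfolding large_spectrum_def using finite_G by simp

lemma card_large_spectrum_le:
  assumes "\<delta> \<ge> 0"
  shows "\<delta>\<^sup>2 * card (large_spectrum \<delta>) \<le> N"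
proof -
  have "\<delta>\<^sup>2 * card (large_spectrum \<delta>) = (\<Sum>z\<in>large_spectrum \<delta>. \<delta>\<^sup>2)" by simp
  also have "\<dots> \<le> (\<Sum>z\<in>large_spectrum \<delta>. (cmod (coeff2 f (fst z) (snd z)))\<^sup>2)"
    using assms by (intro sum_mono power_mono) (auto simp: large_spectrum_def)
  also have "\<dots> \<le> (\<Sum>z\<in>G \<times> G. (cmod (coeff2 f (fst z) (snd z)))\<^sup>2)"
    using finite_G by (intro sum_mono2) (auto simp: large_spectrum_def)
  also have "\<dots> = (\<Sum>h\<in>G. \<Sum>r\<in>G. (cmod (coeff2 f h r))\<^sup>2)"
    by (simp add: sum.cartesian_product case_prod_unfold)
  also have "\<dots> \<le> (\<Sum>h\<in>G. 1)" by (intro sum_mono sum_coeff2_le)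
  finally show ?thesis by simp
qed

text \<open>Supplies the density hypothesis of Balog-Szemeredi-Gowers: the differences with
  coefficient below \<open>\<delta>\<^sup>2 / 2\<close> account for at most half of the lower bound,
  and every other pair contributes at most 1.\<close>

lemma large_spectrum_dense_differences:
  assumes "S \<subseteq> large_spectrum \<delta>" and "\<delta> \<ge> 0"
  shows "\<delta>\<^sup>2 / 2 * card S ^ 2 \<le> (\<Sum>b\<in>S. card {a\<in>S. a - b \<in> large_spectrum (\<delta>\<^sup>2 / 2)})"
proof -
  have S: "S \<subseteq> G \<times> G" using assms by (auto simp: large_spectrum_def)
  have fS: "finite S" using S finite_G by (meson finite_SigmaI finite_subset)
  have "(\<delta> * card S)\<^sup>2 \<le> (\<Sum>b\<in>S. \<Sum>a\<in>S. cmod (coeff2 f (fst (a - b)) (snd (a - b))))"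
    using assms S by (intro coeff2_differences) (auto simp: large_spectrum_def)
  also have "\<dots> \<le> (\<Sum>b\<in>S. \<Sum>a\<in>S. (if a - b \<in> large_spectrum (\<delta>\<^sup>2 / 2) then 1 else 0) + \<delta>\<^sup>2 / 2)"
  proof (intro sum_mono)
    fix a b assume "b \<in> S" "a \<in> S"
    then have "a - b \<in> G \<times> G" using S by (cases a; cases b) (auto intro: diff_G)
    moreover from this have "cmod (coeff2 f (fst (a - b)) (snd (a - b))) \<le> 1"
      by (intro norm_coeff2_le) (auto simp: mem_Times_iff)
    ultimately show "cmod (coeff2 f (fst (a - b)) (snd (a - b)))
        \<le> (if a - b \<in> large_spectrum (\<delta>\<^sup>2 / 2) then 1 else 0) + \<delta>\<^sup>2 / 2"
      by (auto simp: large_spectrum_def intro: add_increasing2)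
  qed
  also have "\<dots> = (\<Sum>b\<in>S. card {a\<in>S. a - b \<in> large_spectrum (\<delta>\<^sup>2 / 2)}) + \<delta>\<^sup>2 / 2 * card S ^ 2"
    using fS by (simp add: sum.distrib sum.If_cases Int_def power2_eq_square conj_commute)
  finally show ?thesis by (simp add: power_mult_distrib)
qed

text \<open>Additivity gives \<open>\<phi> y - \<phi> (y - h) = \<phi> h\<close>, so the modulation
  whose frequency moves with \<open>h\<close> is absorbed into the function
  \<open>f x y * cnj (e (\<phi> y) x)\<close> of \<open>y\<close>, which does not depend on
  \<open>h\<close>. Along an affine graph the coefficient becomes an average of autocorrelations of
  fixed functions.\<close>

lemma coeff2_affine:
  assumes "h \<in> G" and add: "\<And>x y. x \<in> G \<Longrightarrow> y \<in> G \<Longrightarrow> \<phi> (x - y) = \<phi> x - \<phi> y"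
  shows "coeff2 f h (\<phi> h + t)
    = (\<Sum>x\<in>G. cnj (e t x) * autocorr (\<lambda>y. f x y * cnj (e (\<phi> y) x)) h) / of_nat N"
proof -
  have "autocorr (\<lambda>y. f x y * cnj (e (\<phi> y) x)) h = autocorr (f x) h * cnj (e (\<phi> h) x)" for x
  proof -
    have "cnj (e (\<phi> y) x) * e (\<phi> (y - h)) x = cnj (e (\<phi> h) x)" if "y \<in> G" for y
      using add[OF that \<open>h \<in> G\<close>] e_cnj[of "\<phi> y" x] by (simp add: e_diff mult.assoc[symmetric] mult.commute)
    then have *: "f x y * cnj (e (\<phi> y) x) * cnj (f x (y - h) * cnj (e (\<phi> (y - h)) x))
        = f x y * cnj (f x (y - h)) * cnj (e (\<phi> h) x)" if "y \<in> G" for y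
      using that by (simp add: mult_ac flip: mult.assoc[of "cnj (e (\<phi> y) x)"])
    have "(\<Sum>y\<in>G. f x y * cnj (e (\<phi> y) x) * cnj (f x (y - h) * cnj (e (\<phi> (y - h)) x)))
        = (\<Sum>y\<in>G. f x y * cnj (f x (y - h)) * cnj (e (\<phi> h) x))"
      by (rule sum.cong[OF refl *])
    then show ?thesis
      unfolding autocorr_def by (simp only: sum_distrib_right[symmetric] times_divide_eq_left)
  qed
  then show ?thesis by (simp add: coeff2_def fourier_def e_add mult_ac)
qed

section \<open>Approximation by few characters\<close>

text \<open>The coefficients \<open>q s\<close> have absolute sum at most 1. Hence at most
  \<open>1 / \<epsilon>\<close> of them reach \<open>\<epsilon>\<close>, and the squares of the
  others sum to at most \<open>\<epsilon>\<close> times their absolute sum.\<close>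

lemma ex_trig_approx:
  fixes \<epsilon> :: real
  assumes c: "\<And>x. x \<in> G \<Longrightarrow> cmod (c x) \<le> 1"
    and u: "\<And>x y. x \<in> G \<Longrightarrow> y \<in> G \<Longrightarrow> cmod (u x y) \<le> 1" and "\<epsilon> > 0"
  obtains \<Lambda> q where "\<Lambda> \<subseteq> G" "card \<Lambda> * \<epsilon> \<le> 1"
    "\<And>h. cmod (\<Sum>s\<in>\<Lambda>. q s * e s h) \<le> 1"
    "(\<Sum>h\<in>G. (cmod ((\<Sum>x\<in>G. c x * autocorr (u x) h) / of_nat N - (\<Sum>s\<in>\<Lambda>. q s * e s h)))\<^sup>2) \<le> N * \<epsilon>"
proof -
  define q where "q s = (\<Sum>x\<in>G. c x * of_real ((cmod (fourier (u x) s))\<^sup>2)) / of_nat N" for s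
  define \<Lambda> where "\<Lambda> = {s\<in>G. \<epsilon> \<le> cmod (q s)}"
  have \<Lambda>: "\<Lambda> \<subseteq> G" "finite \<Lambda>" using finite_G by (auto simp: \<Lambda>_def)
  have "(\<Sum>s\<in>G. cmod (q s)) \<le> (\<Sum>s\<in>G. (\<Sum>x\<in>G. (cmod (fourier (u x) s))\<^sup>2) / N)"
  proof (rule sum_mono)
    fix s
    have "cmod (\<Sum>x\<in>G. c x * of_real ((cmod (fourier (u x) s))\<^sup>2)) \<le> (\<Sum>x\<in>G. (cmod (fourier (u x) s))\<^sup>2)"
      by (rule sum_norm_le) (use c in \<open>auto simp: norm_mult norm_power intro!: mult_left_le_one_le\<close>)
    then show "cmod (q s) \<le> (\<Sum>x\<in>G. (cmod (fourier (u x) s))\<^sup>2) / N"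
      by (simp add: q_def norm_divide divide_right_mono)
  qed
  also have "\<dots> = (\<Sum>x\<in>G. \<Sum>s\<in>G. (cmod (fourier (u x) s))\<^sup>2) / N"
    by (subst sum.swap) (simp add: sum_divide_distrib)
  also have "\<dots> \<le> (\<Sum>x\<in>G. 1) / N"
    using u by (intro divide_right_mono sum_mono parseval_le) auto
  also have "\<dots> = 1" using N_pos by simp
  finally have q1: "(\<Sum>s\<in>G. cmod (q s)) \<le> 1" .
  have sub: "(\<Sum>s\<in>R. cmod (q s)) \<le> 1" if "R \<subseteq> G" for R
    using sum_mono2[OF finite_G that, of "\<lambda>s. cmod (q s)"] q1 by auto
  show ?thesis
  proof (rule that[OF \<Lambda>(1)])
    have "card \<Lambda> * \<epsilon> = (\<Sum>s\<in>\<Lambda>. \<epsilon>)" by simp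
    also have "\<dots> \<le> (\<Sum>s\<in>\<Lambda>. cmod (q s))" by (intro sum_mono) (auto simp: \<Lambda>_def)
    finally show "card \<Lambda> * \<epsilon> \<le> 1" using sub[OF \<Lambda>(1)] by linarith
    show "cmod (\<Sum>s\<in>\<Lambda>. q s * e s h) \<le> 1" for h
    proof -
      have "cmod (\<Sum>s\<in>\<Lambda>. q s * e s h) \<le> (\<Sum>s\<in>\<Lambda>. cmod (q s))"
        by (rule sum_norm_le) (simp add: norm_mult e_norm)
      then show ?thesis using sub[OF \<Lambda>(1)] by linarith
    qed
    have eq: "(\<Sum>x\<in>G. c x * autocorr (u x) h) / of_nat N = (\<Sum>s\<in>G. q s * e s h)" if "h \<in> G" for h
    proof -
      have "(\<Sum>x\<in>G. c x * autocorr (u x) h) / of_nat N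
          = (\<Sum>x\<in>G. \<Sum>s\<in>G. c x * of_real ((cmod (fourier (u x) s))\<^sup>2) * e s h) / of_nat N"
        using that by (simp add: autocorr_fourier sum_distrib_left mult_ac)
      also have "\<dots> = (\<Sum>s\<in>G. q s * e s h)"
        by (subst sum.swap) (simp add: q_def sum_distrib_right sum_divide_distrib)
      finally show ?thesis .
    qed
    have "(\<Sum>h\<in>G. (cmod ((\<Sum>x\<in>G. c x * autocorr (u x) h) / of_nat N - (\<Sum>s\<in>\<Lambda>. q s * e s h)))\<^sup>2)
        = (\<Sum>h\<in>G. (cmod (\<Sum>s\<in>G - \<Lambda>. q s * e s h))\<^sup>2)"
      by (rule sum.cong) (simp_all add: eq sum_diff[OF finite_G \<Lambda>(1)])
    also have "\<dots> = N * (\<Sum>s\<in>G - \<Lambda>. (cmod (q s))\<^sup>2)" by (rule norm2_trig_sum) auto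
    also have "\<dots> \<le> N * \<epsilon>"
    proof (rule mult_left_mono)
      have "(\<Sum>s\<in>G - \<Lambda>. (cmod (q s))\<^sup>2) \<le> (\<Sum>s\<in>G - \<Lambda>. \<epsilon> * cmod (q s))"
        unfolding power2_eq_square by (intro sum_mono mult_right_mono) (auto simp: \<Lambda>_def)
      also have "\<dots> \<le> \<epsilon> * 1"
        unfolding sum_distrib_left[symmetric] using sub[of "G - \<Lambda>"] \<open>\<epsilon> > 0\<close> by (intro mult_left_mono) auto
      finally show "(\<Sum>s\<in>G - \<Lambda>. (cmod (q s))\<^sup>2) \<le> \<epsilon>" by simp
    qed simp
    finally show "(\<Sum>h\<in>G. (cmod ((\<Sum>x\<in>G. c x * autocorr (u x) h) / of_nat N - (\<Sum>s\<in>\<Lambda>. q s * e s h)))\<^sup>2)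
        \<le> N * \<epsilon>" .
  qed
qed

text \<open>The squared modulus of the trigonometric approximation still depends on \<open>h\<close>
  only through the characters in \<open>\<Lambda>\<close>. The factor 4 arises because the squared
  modulus is 2-Lipschitz on the unit disc.\<close>

lemma coeff2_affine_approx:
  fixes \<epsilon> :: real
  assumes \<phi>: "\<And>x y. x \<in> G \<Longrightarrow> y \<in> G \<Longrightarrow> \<phi> (x - y) = \<phi> x - \<phi> y" "\<And>x. x \<in> G \<Longrightarrow> \<phi> x \<in> G"
    and "t \<in> G" "\<epsilon> > 0"
  shows "\<exists>\<Lambda> \<psi>. \<Lambda> \<subseteq> G \<and> card \<Lambda> * \<epsilon> \<le> 1 \<and> (\<forall>h. \<bar>\<psi> h :: real\<bar> \<le> 1) \<and>
    (\<forall>h h'. (\<forall>s\<in>\<Lambda>. e s h = e s h') \<longrightarrow> \<psi> h = \<psi> h') \<and>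
    (\<Sum>h\<in>G. ((cmod (coeff2 f h (\<phi> h + t)))\<^sup>2 - \<psi> h)\<^sup>2) \<le> 4 * N * \<epsilon>"
proof -
  obtain \<Lambda> q where \<Lambda>: "\<Lambda> \<subseteq> G" "card \<Lambda> * \<epsilon> \<le> 1"
    and q1: "\<And>h. cmod (\<Sum>s\<in>\<Lambda>. q s * e s h) \<le> 1"
    and q2: "(\<Sum>h\<in>G. (cmod ((\<Sum>x\<in>G. cnj (e t x) * autocorr (\<lambda>y. f x y * cnj (e (\<phi> y) x)) h) / of_nat N
      - (\<Sum>s\<in>\<Lambda>. q s * e s h)))\<^sup>2) \<le> N * \<epsilon>"
    by (rule ex_trig_approx[of "\<lambda>x. cnj (e t x)" "\<lambda>x y. f x y * cnj (e (\<phi> y) x)" \<epsilon>])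
      (auto simp: norm_mult e_norm f_le \<open>\<epsilon> > 0\<close>)
  let ?\<psi> = "\<lambda>h. (cmod (\<Sum>s\<in>\<Lambda>. q s * e s h))\<^sup>2"
  show ?thesis
  proof (intro exI[of _ \<Lambda>] exI[of _ ?\<psi>] conjI allI impI \<Lambda>)
    show "\<bar>?\<psi> h\<bar> \<le> 1" for h using q1[of h] by (simp add: power_le_one)
    show "?\<psi> h = ?\<psi> h'" if "\<forall>s\<in>\<Lambda>. e s h = e s h'" for h h'
      using that by simp
    have "(\<Sum>h\<in>G. ((cmod (coeff2 f h (\<phi> h + t)))\<^sup>2 - ?\<psi> h)\<^sup>2)
        \<le> (\<Sum>h\<in>G. 4 * (cmod (coeff2 f h (\<phi> h + t) - (\<Sum>s\<in>\<Lambda>. q s * e s h)))\<^sup>2)"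
      by (intro sum_mono norm_square_diff_le q1 norm_coeff2_le add_G \<phi> \<open>t \<in> G\<close>)
    also have "\<dots> \<le> 4 * (N * \<epsilon>)"
      unfolding sum_distrib_left[symmetric] using q2 by (simp add: coeff2_affine \<phi>(1))
    finally show "(\<Sum>h\<in>G. ((cmod (coeff2 f h (\<phi> h + t)))\<^sup>2 - ?\<psi> h)\<^sup>2) \<le> 4 * N * \<epsilon>" by simp
  qed
qed

lemma autocorr_autocorr:
  assumes "w \<in> G" "h \<in> G"
  shows "autocorr (\<lambda>x. autocorr (f x) h) w = (\<Sum>r\<in>G. of_real ((cmod (coeff2 f h r))\<^sup>2) * e r w)"
  using assms by (simp add: autocorr_fourier[OF \<open>w \<in> G\<close>] coeff2_def)

text \<open>The three error terms have separate sources: frequencies missed by the maps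
  (\<open>\<delta>\<close> for small coefficients, \<open>\<eta>\<close> for uncovered
  \<open>h\<close>), truncation to the characters in \<open>\<Lambda> i\<close>, and those
  \<open>h\<close> at which the functionals in \<open>U\<close> fail to separate two distinct values
  \<open>T i h\<close> and \<open>T j h\<close>. The factor 2 in each comes from passing through the
  intermediate function \<open>F\<close>.\<close>

lemma ex_structured_approx:
  fixes \<phi> :: "nat \<Rightarrow> 'a \<Rightarrow> 'a" and t :: "nat \<Rightarrow> 'a" and \<epsilon> \<delta> \<eta> :: real
  assumes \<phi>: "\<And>i x y. i < m \<Longrightarrow> x \<in> G \<Longrightarrow> y \<in> G \<Longrightarrow> \<phi> i (x - y) = \<phi> i x - \<phi> i y"
      "\<And>i x. i < m \<Longrightarrow> x \<in> G \<Longrightarrow> \<phi> i x \<in> G"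
    and t: "\<And>i. i < m \<Longrightarrow> t i \<in> G"
    and uncovered: "card {h\<in>G. \<exists>r\<in>G. \<delta> \<le> cmod (coeff2 f h r) \<and> (\<forall>i<m. r \<noteq> \<phi> i h + t i)} \<le> \<eta> * N"
    and pos: "\<epsilon> > 0" "\<delta> > 0"
  obtains U :: "'a set" and \<Lambda> :: "nat \<Rightarrow> 'a set" and \<Gamma> :: "'a \<Rightarrow> 'a \<Rightarrow> complex"
  where "U \<subseteq> G" "card U \<le> r" "\<And>i. i < m \<Longrightarrow> \<Lambda> i \<subseteq> G" "\<And>i. i < m \<Longrightarrow> card (\<Lambda> i) * \<epsilon> \<le> 1"
    "\<forall>w h w' h'. (\<forall>i<m. e (\<phi> i h + t i) w = e (\<phi> i h' + t i) w') \<and>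
      (\<forall>i<m. \<forall>u\<in>U. e u (\<phi> i h + t i) = e u (\<phi> i h' + t i)) \<and>
      (\<forall>i<m. \<forall>s\<in>\<Lambda> i. e s h = e s h') \<longrightarrow> \<Gamma> w h = \<Gamma> w' h'"
    "(\<Sum>h\<in>G. \<Sum>w\<in>G. (cmod (autocorr (\<lambda>x. autocorr (f x) h) w - \<Gamma> w h))\<^sup>2)
      \<le> real N ^ 2 * (2 * (\<delta>\<^sup>2 + \<eta>) + 8 * real m ^ 2 * \<epsilon> + 2 * (1 + real m)\<^sup>2 * real m ^ 2 / 2 ^ r)"
proof -
  define T where "T i h = \<phi> i h + t i" for i h
  have T: "T i h \<in> G" if "i < m" "h \<in> G" for i h
    using that by (simp add: T_def add_G \<phi> t)
  define c where "c h r = (cmod (coeff2 f h r))\<^sup>2" for h r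
  have c0: "c h r \<ge> 0" for h r by (simp add: c_def)
  have c_sum: "(\<Sum>r\<in>R. c h r) \<le> 1" if "h \<in> G" "R \<subseteq> G" for h R
    using sum_mono2[OF finite_G that(2), of "c h"] sum_coeff2_le[OF that(1)] by (simp add: c_def)
  define P where "P i \<Lambda> \<psi> \<longleftrightarrow> \<Lambda> \<subseteq> G \<and> card \<Lambda> * \<epsilon> \<le> 1 \<and> (\<forall>h. \<bar>\<psi> h\<bar> \<le> 1) \<and>
      (\<forall>h h'. (\<forall>s\<in>\<Lambda>. e s h = e s h') \<longrightarrow> \<psi> h = \<psi> h') \<and>
      (\<Sum>h\<in>G. (c h (T i h) - \<psi> h)\<^sup>2) \<le> 4 * N * \<epsilon>" for i \<Lambda> \<psi>
  have "\<exists>\<Lambda> \<psi>. P i \<Lambda> \<psi>" if "i < m" for i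
    unfolding P_def c_def T_def
    by (rule coeff2_affine_approx) (rule \<phi>[OF that] t[OF that] pos(1); assumption)+
  then obtain \<Lambda> \<psi> where P: "\<And>i. i < m \<Longrightarrow> P i (\<Lambda> i) (\<psi> i)" by metis
  have \<Lambda>: "\<And>i. i < m \<Longrightarrow> \<Lambda> i \<subseteq> G" "\<And>i. i < m \<Longrightarrow> card (\<Lambda> i) * \<epsilon> \<le> 1"
    and \<psi>1: "\<And>i h. i < m \<Longrightarrow> \<bar>\<psi> i h\<bar> \<le> 1"
    and \<psi>_cong: "\<And>i h h'. i < m \<Longrightarrow> (\<forall>s\<in>\<Lambda> i. e s h = e s h') \<Longrightarrow> \<psi> i h = \<psi> i h'"
    and \<psi>2: "\<And>i. i < m \<Longrightarrow> (\<Sum>h\<in>G. (c h (T i h) - \<psi> i h)\<^sup>2) \<le> 4 * N * \<epsilon>"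
    using P[unfolded P_def] by blast+
  \<comment> \<open>The triples at which a test has something to detect: the vectors
    \<open>T i h - T j h\<close> are nonzero exactly here.\<close>
  define X where "X = {(i, j, h). i < m \<and> j < m \<and> h \<in> G \<and> T i h \<noteq> T j h}"
  have X: "X \<subseteq> {..<m} \<times> {..<m} \<times> G" by (auto simp: X_def)
  then have fX: "finite X" using finite_G by (auto intro: finite_subset)
  have cX: "card X \<le> m ^ 2 * N"
    using card_mono[OF _ X] finite_G by (simp add: card_cartesian_product power2_eq_square mult.assoc)
  have "\<exists>U\<subseteq>G. card U \<le> r \<and>
      2 ^ r * card {x\<in>X. \<forall>u\<in>U. e u (case x of (i, j, h) \<Rightarrow> T i h - T j h) = 1} \<le> card X"
    by (rule ex_separating_set[OF fX]) (auto simp: X_def intro!: diff_G T)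
  then obtain U where U: "U \<subseteq> G" "card U \<le> r"
      "2 ^ r * card {x\<in>X. \<forall>u\<in>U. e u (case x of (i, j, h) \<Rightarrow> T i h - T j h) = 1} \<le> card X"
    by blast
  define test where "test i j h \<longleftrightarrow> (\<forall>u\<in>U. e u (T i h) = e u (T j h))" for i j h
  have test_iff: "e u (T i h - T j h) = 1 \<longleftrightarrow> e u (T i h) = e u (T j h)" for u i j h
  proof
    assume "e u (T i h - T j h) = 1"
    then have "e u (T i h) * cnj (e u (T j h)) * e u (T j h) = e u (T j h)" by (simp add: e_diff_right)
    then show "e u (T i h) = e u (T j h)"
      by (metis e_cnj mult.assoc mult.commute mult.right_neutral)
  qed (simp add: e_diff_right e_cnj)
  define E where "E = {h\<in>G. \<exists>i<m. \<exists>j<m. T i h \<noteq> T j h \<and> test i j h}"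
  have cE: "2 ^ r * real (card E) \<le> real m ^ 2 * N"
  proof -
    let ?Y = "{x\<in>X. \<forall>u\<in>U. e u (case x of (i, j, h) \<Rightarrow> T i h - T j h) = 1}"
    have "E \<subseteq> (\<lambda>(i, j, h). h) ` ?Y"
      by (force simp: E_def X_def test_def test_iff image_iff)
    then have "card E \<le> card ?Y"
      by (rule surj_card_le[rotated]) (simp add: fX)
    then have "2 ^ r * card E \<le> m ^ 2 * N" using U(3) cX by (meson le_trans mult_le_mono2)
    then have "real (2 ^ r * card E) \<le> real (m ^ 2 * N)" by (rule of_nat_mono)
    then show ?thesis by simp
  qed
  \<comment> \<open>Only the first index in each class of indices indistinguishable by the tests
    contributes. The selection consults the tests rather than the true coincidences, so that
    \<open>\<Gamma>\<close> is determined by the listed values even where the tests err.\<close>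
  define \<Gamma> where "\<Gamma> w h = (\<Sum>i | i < m \<and> (\<forall>j<i. \<not> test i j h). of_real (\<psi> i h) * e (T i h) w)" for w h
  define F where "F w h = (\<Sum>r\<in>(\<lambda>i. T i h) ` {..<m}. of_real (c h r) * e r w)" for w h
  have TG: "(\<lambda>i. T i h) ` {..<m} \<subseteq> G" if "h \<in> G" for h using T that by auto
  define B where "B = {h\<in>G. \<exists>r\<in>G. \<delta> \<le> cmod (coeff2 f h r) \<and> (\<forall>i<m. r \<noteq> T i h)}"
  have near: "(\<Sum>w\<in>G. (cmod (autocorr (\<lambda>x. autocorr (f x) h) w - F w h))\<^sup>2) \<le> N * (\<delta>\<^sup>2
      + (if h \<in> B then 1 else 0))"
    if h: "h \<in> G" for h
  proof -
    let ?R = "G - (\<lambda>i. T i h) ` {..<m}"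
    have "(\<Sum>w\<in>G. (cmod (autocorr (\<lambda>x. autocorr (f x) h) w - F w h))\<^sup>2)
        = (\<Sum>w\<in>G. (cmod (\<Sum>r\<in>?R. of_real (c h r) * e r w))\<^sup>2)"
      by (rule sum.cong) (simp_all add: F_def autocorr_autocorr h c_def sum_diff[OF finite_G TG[OF h]])
    also have "\<dots> = N * (\<Sum>r\<in>?R. (c h r)\<^sup>2)"
      by (subst norm2_trig_sum) auto
    also have "\<dots> \<le> N * (\<delta>\<^sup>2 + (if h \<in> B then 1 else 0))"
    proof (rule mult_left_mono)
      \<comment> \<open>Since \<open>c h\<close> sums to at most 1, the sum of its squares over the
        missed frequencies is bounded by the largest value there.\<close>
      have *: "c h r \<le> \<delta>\<^sup>2 + (if h \<in> B then 1 else 0)" if r: "r \<in> ?R" for r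
      proof (cases "\<delta> \<le> cmod (coeff2 f h r)")
        case True
        with r h have "h \<in> B" by (auto simp: B_def)
        moreover have "c h r \<le> 1" using norm_coeff2_le[OF h] r by (simp add: c_def power_le_one)
        ultimately show ?thesis by (simp add: add_increasing)
      next
        case False
        then have "c h r \<le> \<delta>\<^sup>2" unfolding c_def by (intro power_mono) auto
        then show ?thesis by simp
      qed
      have "(\<Sum>r\<in>?R. (c h r)\<^sup>2) \<le> (\<Sum>r\<in>?R. (\<delta>\<^sup>2 + (if h \<in> B then 1 else 0)) * c h r)"
        unfolding power2_eq_square[of "c h _"] by (intro sum_mono mult_right_mono * c0)
      also have "\<dots> \<le> (\<delta>\<^sup>2 + (if h \<in> B then 1 else 0)) * 1"
        unfolding sum_distrib_left[symmetric] by (intro mult_left_mono c_sum h) auto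
      finally show "(\<Sum>r\<in>?R. (c h r)\<^sup>2) \<le> \<delta>\<^sup>2 + (if h \<in> B then 1 else 0)" by simp
    qed simp
    finally show ?thesis .
  qed
  \<comment> \<open>Outside \<open>E\<close> the tests decide equality correctly, so
    \<open>F\<close> and \<open>\<Gamma>\<close> use the same frequencies and differ only in their
    weights. On \<open>E\<close> the bounds 1 for \<open>F\<close> and \<open>m\<close> for
    \<open>\<Gamma>\<close> are enough.\<close>
  have close: "(cmod (F w h - \<Gamma> w h))\<^sup>2 \<le> m * (\<Sum>i<m. (c h (T i h) - \<psi> i h)\<^sup>2) + (if h \<in> E then (1
      + real m)\<^sup>2 else 0)"
    if h: "h \<in> G" for w h
  proof (cases "h \<in> E")
    case True
    have "cmod (F w h) \<le> (\<Sum>r\<in>(\<lambda>i. T i h) ` {..<m}. c h r)"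
      unfolding F_def by (rule sum_norm_le) (simp add: norm_mult e_norm c0)
    then have "cmod (F w h) \<le> 1" using c_sum[OF h TG[OF h]] by linarith
    moreover have "cmod (\<Gamma> w h) \<le> (\<Sum>i | i < m \<and> (\<forall>j<i. \<not> test i j h). 1)"
      unfolding \<Gamma>_def using \<psi>1 by (intro sum_norm_le) (auto simp: norm_mult e_norm)
    moreover have "card {i. i < m \<and> (\<forall>j<i. \<not> test i j h)} \<le> card {..<m}"
      by (rule card_mono) auto
    ultimately have "cmod (F w h - \<Gamma> w h) \<le> 1 + real m"
      using norm_triangle_ineq4[of "F w h" "\<Gamma> w h"] by simp
    then have "(cmod (F w h - \<Gamma> w h))\<^sup>2 \<le> (1 + real m)\<^sup>2" by (rule power_mono) simp
    then show ?thesis using True by (simp add: add_increasing sum_nonneg)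
  next
    case False
    define I where "I = {i. i < m \<and> (\<forall>j<i. \<not> test i j h)}"
    have test_eq: "test i j h \<longleftrightarrow> T i h = T j h" if "i < m" "j < m" for i j
      using False that h by (auto simp: E_def test_def)
    have inj: "inj_on (\<lambda>i. T i h) I"
    proof (rule linorder_inj_onI')
      fix i j assume "i \<in> I" "j \<in> I" "i < j"
      then show "T i h \<noteq> T j h" using test_eq[of j i] by (auto simp: I_def)
    qed
    have img: "(\<lambda>i. T i h) ` {..<m} = (\<lambda>i. T i h) ` I"
    proof
      show "(\<lambda>i. T i h) ` {..<m} \<subseteq> (\<lambda>i. T i h) ` I"
      proof
        fix r assume "r \<in> (\<lambda>i. T i h) ` {..<m}"
        then obtain i where i: "i < m" "r = T i h" by auto
        have "\<exists>i0. (i0 < m \<and> r = T i0 h) \<and> (\<forall>j<i0. \<not> (j < m \<and> r = T j h))"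
          by (subst exists_least_iff[symmetric]) (use i in blast)
        then obtain i0 where i0: "i0 < m" "r = T i0 h" and least: "\<And>j. j < i0 \<Longrightarrow> j < m \<Longrightarrow> r \<noteq> T j h"
          by blast
        have "\<not> test i0 j h" if "j < i0" for j
          using least[OF that] test_eq[of i0 j] i0 that by simp
        with i0 show "r \<in> (\<lambda>i. T i h) ` I" by (auto simp: I_def)
      qed
    qed (auto simp: I_def)
    have "F w h - \<Gamma> w h = (\<Sum>i\<in>I. of_real (c h (T i h) - \<psi> i h) * e (T i h) w)"
      unfolding F_def \<Gamma>_def img I_def[symmetric] using inj
      by (simp add: sum.reindex sum_subtractf algebra_simps)
    then have "cmod (F w h - \<Gamma> w h) \<le> (\<Sum>i\<in>I. \<bar>c h (T i h) - \<psi> i h\<bar>)"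
      by (simp add: sum_norm_le norm_mult e_norm del: of_real_diff)
    also have "\<dots> \<le> (\<Sum>i<m. \<bar>c h (T i h) - \<psi> i h\<bar>)" by (rule sum_mono2) (auto simp: I_def)
    finally have "(cmod (F w h - \<Gamma> w h))\<^sup>2 \<le> (\<Sum>i<m. \<bar>c h (T i h) - \<psi> i h\<bar>)\<^sup>2" by (rule power_mono) simp
    also have "\<dots> \<le> card {..<m} * (\<Sum>i<m. \<bar>c h (T i h) - \<psi> i h\<bar>\<^sup>2)" by (rule power2_sum_le_card)
    finally show ?thesis using False by simp
  qed
  show ?thesis
  proof (rule that[OF U(1,2) \<Lambda>])
    show "\<forall>w h w' h'. (\<forall>i<m. e (\<phi> i h + t i) w = e (\<phi> i h' + t i) w') \<and>
      (\<forall>i<m. \<forall>u\<in>U. e u (\<phi> i h + t i) = e u (\<phi> i h' + t i)) \<and>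
      (\<forall>i<m. \<forall>s\<in>\<Lambda> i. e s h = e s h') \<longrightarrow> \<Gamma> w h = \<Gamma> w' h'"
    proof (intro allI impI, elim conjE)
      fix w h w' h'
      assume eq: "\<forall>i<m. e (\<phi> i h + t i) w = e (\<phi> i h' + t i) w'"
        "\<forall>i<m. \<forall>u\<in>U. e u (\<phi> i h + t i) = e u (\<phi> i h' + t i)"
        "\<forall>i<m. \<forall>s\<in>\<Lambda> i. e s h = e s h'"
      have "test i j h = test i j h'" if "i < m" "j < i" for i j
        using that eq(2) by (simp add: test_def T_def)
      then have "{i. i < m \<and> (\<forall>j<i. \<not> test i j h)} = {i. i < m \<and> (\<forall>j<i. \<not> test i j h')}" by blast
      moreover have "of_real (\<psi> i h) * e (T i h) w = of_real (\<psi> i h') * e (T i h') w'" if "i < m" for i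
        using \<psi>_cong[of i h h'] eq that by (simp add: T_def)
      ultimately show "\<Gamma> w h = \<Gamma> w' h'" unfolding \<Gamma>_def by (intro sum.cong) auto
    qed
  next
    have tri: "(cmod (a - b))\<^sup>2 \<le> 2 * (cmod (a - d))\<^sup>2 + 2 * (cmod (d - b))\<^sup>2" for a b d :: complex
    proof -
      have "(cmod (a - b))\<^sup>2 \<le> (cmod (a - d) + cmod (d - b))\<^sup>2"
        using norm_triangle_ineq[of "a - d" "d - b"] by (intro power_mono) auto
      also have "\<dots> \<le> 2 * (cmod (a - d))\<^sup>2 + 2 * (cmod (d - b))\<^sup>2"
        using sum_squares_bound[of "cmod (a - d)" "cmod (d - b)"] by (simp add: power2_sum)
      finally show ?thesis .
    qed
    have "(\<Sum>h\<in>G. \<Sum>w\<in>G. (cmod (autocorr (\<lambda>x. autocorr (f x) h) w - \<Gamma> w h))\<^sup>2)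
      \<le> (\<Sum>h\<in>G. \<Sum>w\<in>G. 2 * (cmod (autocorr (\<lambda>x. autocorr (f x) h) w - F w h))\<^sup>2
          + 2 * (m * (\<Sum>i<m. (c h (T i h) - \<psi> i h)\<^sup>2) + (if h \<in> E then (1 + real m)\<^sup>2 else 0)))"
    proof (intro sum_mono)
      fix h w assume h: "h \<in> G"
      show "(cmod (autocorr (\<lambda>x. autocorr (f x) h) w - \<Gamma> w h))\<^sup>2
        \<le> 2 * (cmod (autocorr (\<lambda>x. autocorr (f x) h) w - F w h))\<^sup>2
          + 2 * (m * (\<Sum>i<m. (c h (T i h) - \<psi> i h)\<^sup>2) + (if h \<in> E then (1 + real m)\<^sup>2 else 0))"
        by (rule order_trans[OF tri[of _ _ "F w h"] add_left_mono[OF mult_left_mono[OF close[OF h]]]]) simp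
    qed
    also have "\<dots> \<le> (\<Sum>h\<in>G. 2 * (N * (\<delta>\<^sup>2 + (if h \<in> B then 1 else 0)))
          + N * (2 * (m * (\<Sum>i<m. (c h (T i h) - \<psi> i h)\<^sup>2) + (if h \<in> E then (1 + real m)\<^sup>2 else 0))))"
    proof (rule sum_mono)
      fix h assume "h \<in> G"
      from near[OF this] show "(\<Sum>w\<in>G. 2 * (cmod (autocorr (\<lambda>x. autocorr (f x) h) w - F w h))\<^sup>2
          + 2 * (m * (\<Sum>i<m. (c h (T i h) - \<psi> i h)\<^sup>2) + (if h \<in> E then (1 + real m)\<^sup>2 else 0)))
        \<le> 2 * (N * (\<delta>\<^sup>2 + (if h \<in> B then 1 else 0)))
          + N * (2 * (m * (\<Sum>i<m. (c h (T i h) - \<psi> i h)\<^sup>2) + (if h \<in> E then (1 + real m)\<^sup>2 else 0)))"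
        unfolding sum.distrib sum_constant sum_distrib_left[symmetric]
            by (intro add_mono mult_left_mono) auto
    qed
    also have "\<dots> = 2 * N * (N * \<delta>\<^sup>2 + card B) + 2 * N * (m * (\<Sum>i<m. \<Sum>h\<in>G. (c h (T i h) - \<psi> i h)\<^sup>2)
        + card E * (1 + real m)\<^sup>2)"
    proof -
      have "G \<inter> B = B" "G \<inter> E = E" by (auto simp: B_def E_def)
      then have "(\<Sum>h\<in>G. if h \<in> B then 1 else 0) = real (card B)"
        "(\<Sum>h\<in>G. if h \<in> E then (1 + real m)\<^sup>2 else 0) = card E * (1 + real m)\<^sup>2"
        using finite_G by (simp_all add: sum.If_cases)
      moreover have "(\<Sum>h\<in>G. 2 * (N * (d + b h)) + N * (2 * (k * x h + y h)))
          = 2 * N * (N * d + sum b G) + 2 * N * (k * sum x G + sum y G)"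
              for b x y :: "'a \<Rightarrow> real" and d k :: real
      proof -
        have "(\<Sum>h\<in>G. 2 * (N * (d + b h)) + N * (2 * (k * x h + y h)))
            = (\<Sum>h\<in>G. 2 * N * d + (2 * N) * b h + (2 * N * k) * x h + (2 * N) * y h)"
          by (rule sum.cong) (auto simp: algebra_simps)
        also have "\<dots> = N * (2 * N * d) + (2 * N) * sum b G + (2 * N * k) * sum x G + (2 * N) * sum y G"
          by (simp only: sum.distrib sum_constant sum_distrib_left[symmetric])
        also have "\<dots> = 2 * N * (N * d + sum b G) + 2 * N * (k * sum x G + sum y G)"
          by (simp add: algebra_simps)
        finally show ?thesis .
      qed
      moreover have "(\<Sum>i<m. \<Sum>h\<in>G. (c h (T i h) - \<psi> i h)\<^sup>2) = (\<Sum>h\<in>G. \<Sum>i<m. (c h (T i h) - \<psi> i h)\<^sup>2)"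
        by (rule sum.swap)
      ultimately show ?thesis by (simp only:)
    qed
    also have "\<dots> \<le> 2 * N * (N * \<delta>\<^sup>2 + \<eta> * N) + 2 * N * (m * (\<Sum>i<m. 4 * N * \<epsilon>)
        + (real m ^ 2 * N / 2 ^ r) * (1 + real m)\<^sup>2)"
    proof (intro add_mono mult_left_mono mult_right_mono order_refl sum_mono)
      show "real (card B) \<le> \<eta> * N" using uncovered by (simp add: B_def T_def)
      show "(\<Sum>h\<in>G. (c h (T i h) - \<psi> i h)\<^sup>2) \<le> 4 * N * \<epsilon>" if "i \<in> {..<m}" for i using \<psi>2 that by simp
      show "real (card E) \<le> real m ^ 2 * N / 2 ^ r" using cE by (simp add: field_simps)
    qed auto
    also have "\<dots> = real N ^ 2 * (2 * (\<delta>\<^sup>2 + \<eta>) + 8 * real m ^ 2 * \<epsilon> + 2 * (1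
        + real m)\<^sup>2 * real m ^ 2 / 2 ^ r)"
      by (simp add: power2_eq_square[of "real N"] power2_eq_square[of "real m"] divide_inverse
          algebra_simps)
    finally show "(\<Sum>h\<in>G. \<Sum>w\<in>G. (cmod (autocorr (\<lambda>x. autocorr (f x) h) w - \<Gamma> w h))\<^sup>2)
      \<le> real N ^ 2 * (2 * (\<delta>\<^sup>2 + \<eta>) + 8 * real m ^ 2 * \<epsilon> + 2 * (1 + real m)\<^sup>2 * real m ^ 2 / 2 ^ r)" .
  qed
qed

section \<open>Greedy cover of the large spectrum by graphs\<close>

text \<open>As long as too many \<open>h\<close> are uncovered, \<open>step\<close> yields a map
  capturing \<open>\<alpha> * N\<close> new points. The large spectrum has at most
  \<open>N / \<delta>\<^sup>2\<close> points, so the process stops with \<open>m\<close> at most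
  \<open>1 / (\<alpha> * \<delta>\<^sup>2)\<close>.\<close>

lemma ex_cover_large_spectrum:
  fixes \<alpha> \<delta> \<eta> :: real and \<T> :: "('a \<Rightarrow> 'a) set"
  assumes pos: "\<alpha> > 0" "\<delta> > 0"
    and step: "\<And>S. S \<subseteq> large_spectrum \<delta> \<Longrightarrow> inj_on fst S \<Longrightarrow> \<eta> * N \<le> card S \<Longrightarrow>
      \<exists>T\<in>\<T>. \<alpha> * N \<le> card {z\<in>S. snd z = T (fst z)}"
  obtains m :: nat and T :: "nat \<Rightarrow> 'a \<Rightarrow> 'a" where "\<And>i. i < m \<Longrightarrow> T i \<in> \<T>" "m * \<alpha> * \<delta>\<^sup>2 \<le> 1"
    "card {h\<in>G. \<exists>r\<in>G. \<delta> \<le> cmod (coeff2 f h r) \<and> (\<forall>i<m. r \<noteq> T i h)} \<le> \<eta> * N"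
proof -
  define covered where "covered m T = {z\<in>large_spectrum \<delta>. \<exists>i<m. snd z = T i (fst z)}"
      for m and T :: "nat \<Rightarrow> 'a \<Rightarrow> 'a"
  define good where "good m T \<longleftrightarrow> (\<forall>i<m. T i \<in> \<T>) \<and> m * \<alpha> * N \<le> card (covered m T)" for m T
  define uncovered where "uncovered m T = {h\<in>G. \<exists>r\<in>G. \<delta> \<le> cmod (coeff2 f h r) \<and> (\<forall>i<m. r \<noteq> T i h)}"
      for m and T :: "nat \<Rightarrow> 'a \<Rightarrow> 'a"
  have bound: "m * \<alpha> * \<delta>\<^sup>2 \<le> 1" if "good m T" for m T
  proof -
    have "card (covered m T) \<le> card (large_spectrum \<delta>)"
      by (rule card_mono[OF finite_large_spectrum]) (auto simp: covered_def)
    then have "m * \<alpha> * N \<le> card (large_spectrum \<delta>)" using that by (simp add: good_def)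
    then have "\<delta>\<^sup>2 * (m * \<alpha> * N) \<le> \<delta>\<^sup>2 * card (large_spectrum \<delta>)" by (intro mult_left_mono) auto
    also have "\<dots> \<le> N" using pos by (intro card_large_spectrum_le) auto
    finally show ?thesis using N_pos by (simp add: field_simps)
  qed
  have "\<exists>m T. good m T \<and> card (uncovered m T) \<le> \<eta> * N"
  proof (rule ccontr)
    assume contra: "\<not> ?thesis"
    have "\<exists>T. good m T" for m
    proof (induction m)
      case 0
      show ?case by (simp add: good_def)
    next
      case (Suc m)
      then obtain T where T: "good m T" by blast
      with contra have big: "\<eta> * N < card (uncovered m T)" by (meson not_le)
      \<comment> \<open>One uncovered large frequency for each \<open>h\<close>: this makes
        \<open>S\<close> a graph, and everything captured from it is disjoint from what was covered
        before.\<close>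
      define r where "r h = (SOME r. r \<in> G \<and> \<delta> \<le> cmod (coeff2 f h r) \<and> (\<forall>i<m. r \<noteq> T i h))" for h
      have r: "r h \<in> G \<and> \<delta> \<le> cmod (coeff2 f h (r h)) \<and> (\<forall>i<m. r h \<noteq> T i h)" if "h \<in> uncovered m T" for h
        unfolding r_def by (rule someI_ex) (use that in \<open>auto simp: uncovered_def\<close>)
      have uG: "uncovered m T \<subseteq> G" by (auto simp: uncovered_def)
      define S where "S = (\<lambda>h. (h, r h)) ` uncovered m T"
      have "card S = card (uncovered m T)" unfolding S_def by (rule card_image) (auto simp: inj_on_def)
      moreover have S: "S \<subseteq> large_spectrum \<delta>" "inj_on fst S"
        using r uG by (auto simp: S_def large_spectrum_def inj_on_def)
      ultimately obtain T' where T': "T' \<in> \<T>" "\<alpha> * N \<le> card {z\<in>S. snd z = T' (fst z)}"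
        using step[OF S] big by auto
      define T2 where "T2 = T(m := T')"
      have "card (covered m T) + card {z\<in>S. snd z = T' (fst z)} = card (covered m T \<union> {z\<in>S. snd z
          = T' (fst z)})"
      proof (rule card_Un_disjoint[symmetric])
        show "finite (covered m T)" by (simp add: covered_def finite_large_spectrum)
        show "finite {z\<in>S. snd z = T' (fst z)}" using finite_subset[OF S(1) finite_large_spectrum] by simp
        show "covered m T \<inter> {z\<in>S. snd z = T' (fst z)} = {}"
          using r by (auto simp: covered_def S_def)
      qed
      also have "\<dots> \<le> card (covered (Suc m) T2)"
      proof (rule card_mono)
        show "finite (covered (Suc m) T2)" by (simp add: covered_def finite_large_spectrum)
        show "covered m T \<union> {z\<in>S. snd z = T' (fst z)} \<subseteq> covered (Suc m) T2"
          using S(1) by (auto simp: covered_def T2_def less_Suc_eq)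
      qed
      finally have "good (Suc m) T2"
        using T T' by (auto simp: good_def T2_def less_Suc_eq algebra_simps)
      then show ?case by blast
    qed
    then have "real m * (\<alpha> * \<delta>\<^sup>2) \<le> 1" for m using bound by (metis mult.assoc)
    moreover obtain m :: nat where "1 < real m * (\<alpha> * \<delta>\<^sup>2)"
      using reals_Archimedean3[of "\<alpha> * \<delta>\<^sup>2"] pos by auto
    ultimately show False by (meson not_le)
  qed
  then obtain m T where "good m T" "card (uncovered m T) \<le> \<eta> * N" by blast
  with bound[OF this(1)] show ?thesis
    using that[of m T] by (simp add: good_def uncovered_def)
qed

end

end

section \<open>Vector spaces over a prime field\<close>

text \<open>Encoding vectors as functions that vanish from index \<open>n\<close> on places them in
  a type that is an abelian group as a whole, as the sumset lemmas and \<open>dual_pairing\<close>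
  demand.\<close>

definition coord_space :: "nat \<Rightarrow> (nat \<Rightarrow> 'a::zero) set" where
  "coord_space n = {v. \<forall>i\<ge>n. v i = 0}"

definition dotp :: "nat \<Rightarrow> (nat \<Rightarrow> 'a) \<Rightarrow> (nat \<Rightarrow> 'a) \<Rightarrow> 'a::comm_ring_1" where
  "dotp n u v = (\<Sum>i<n. u i * v i)"

definition add_char :: "'p::prime_card mod_ring \<Rightarrow> complex" where
  "add_char a = cis (2 * pi * real_of_int (to_int_mod_ring a) / real CARD('p))"

lemma two_le_card: "CARD('p::prime_card) \<ge> 2"
  using prime_card[where 'a = 'p] by (rule prime_ge_2_nat)

lemma add_char_add: "add_char (a + b) = add_char a * add_char (b :: 'p::prime_card mod_ring)"
proof -
  let ?p = "CARD('p)" and ?s = "to_int_mod_ring a + to_int_mod_ring b"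
  have p: "real ?p \<noteq> 0" using two_le_card[where 'p = 'p] by linarith
  have mod: "real_of_int (?s mod ?p) = real_of_int ?s - real ?p * real_of_int (?s div ?p)"
    by (simp add: minus_mult_div_eq_mod[symmetric])
  have "2 * pi * real_of_int (?s mod ?p) / ?p
      = (2 * pi * real_of_int (to_int_mod_ring a) / ?p + 2 * pi * real_of_int (to_int_mod_ring b) / ?p)
        - 2 * pi * real_of_int (?s div ?p)"
    unfolding mod using p by (simp add: field_simps)
  moreover have "cis (x - 2 * pi * real_of_int k) = cis x" for x k
    by (simp add: cis_multiple_2pi flip: cis_divide)
  ultimately show ?thesis
    by (simp add: add_char_def to_int_mod_ring_add cis_mult)
qed

lemma norm_add_char: "cmod (add_char a) = 1"
  by (simp add: add_char_def)

lemma add_char_1: "add_char (1 :: 'p::prime_card mod_ring) \<noteq> 1"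
proof -
  let ?t = "2 * pi / real CARD('p)"
  have p: "real CARD('p) \<ge> 2" using two_le_card[where 'p = 'p] by linarith
  then have "0 < ?t" "?t \<le> pi" by (auto simp: field_simps)
  then have "cos ?t < cos 0" by (intro cos_monotone_0_pi) auto
  then have "cis ?t \<noteq> 1" by (auto simp: complex_eq_iff)
  then show ?thesis by (simp add: add_char_def)
qed

lemma dotp_add: "dotp n (u + v) w = dotp n u w + dotp n v w"
  by (simp add: dotp_def algebra_simps sum.distrib)

lemma dotp_commute: "dotp n u v = dotp n v u"
  by (simp add: dotp_def mult.commute)

lemma finite_coord_space: "finite (coord_space n :: (nat \<Rightarrow> 'a::{finite,zero}) set)"
proof -
  have "coord_space n \<subseteq> (\<lambda>x i. if i < n then x $ i else 0) ` (carrier_vec n :: 'a vec set)"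
  proof
    fix v :: "nat \<Rightarrow> 'a" assume "v \<in> coord_space n"
    then have "v = (\<lambda>i. if i < n then vec n v $ i else 0)" by (auto simp: coord_space_def fun_eq_iff)
    then show "v \<in> (\<lambda>x i. if i < n then x $ i else 0) ` (carrier_vec n :: 'a vec set)"
      by (rule image_eqI) simp
  qed
  moreover have "finite (carrier_vec n :: 'a vec set)"
  proof -
    have "carrier_vec n \<subseteq> vec_of_list ` {xs :: 'a list. set xs \<subseteq> UNIV \<and> length xs = n}"
    proof
      fix x :: "'a vec" assume "x \<in> carrier_vec n"
      then show "x \<in> vec_of_list ` {xs. set xs \<subseteq> UNIV \<and> length xs = n}"
        by (intro image_eqI[of _ _ "list_of_vec x"]) (simp_all add: vec_list)
    qed
    then show ?thesis by (rule finite_subset) (intro finite_imageI finite_lists_length_eq finite)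
  qed
  ultimately show ?thesis by (rule finite_subset[OF _ finite_imageI])
qed

lemma dual_pairing_coord_space:
  "dual_pairing (coord_space n) (\<lambda>u v. add_char (dotp n u v :: 'p::prime_card mod_ring))"
proof
  let ?G = "coord_space n :: (nat \<Rightarrow> 'p mod_ring) set"
  show "finite ?G" by (rule finite_coord_space)
  show "(0 :: nat \<Rightarrow> 'p mod_ring) \<in> ?G" by (simp add: coord_space_def)
  show diff: "x - y \<in> ?G" if "x \<in> ?G" "y \<in> ?G" for x y
    using that by (simp add: coord_space_def)
  show add: "add_char (dotp n (x + y) z) = add_char (dotp n x z) * add_char (dotp n y z)"
      for x y z :: "nat \<Rightarrow> 'p mod_ring"
    by (simp add: dotp_add add_char_add)
  show "add_char (dotp n x y) = add_char (dotp n y x)" for x y :: "nat \<Rightarrow> 'p mod_ring"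
    by (simp add: dotp_commute)
  show "cmod (add_char (dotp n x y)) = 1" for x y :: "nat \<Rightarrow> 'p mod_ring"
    by (rule norm_add_char)
  show "(\<Sum>x\<in>?G. add_char (dotp n r x)) = 0" if r: "r \<in> ?G" "r \<noteq> 0" for r
  proof -
    from r obtain i where i: "i < n" "r i \<noteq> 0"
      by (auto simp: coord_space_def fun_eq_iff) (metis not_le)
    \<comment> \<open>Chosen with \<open>dotp n r x0 = 1\<close>: translation by \<open>x0\<close>
      preserves the sum but multiplies it by \<open>add_char 1\<close>, which is not 1.\<close>
    define x0 where "x0 = (\<lambda>j. if j = i then inverse (r i) else 0)"
    have x0: "x0 \<in> ?G" using i by (auto simp: x0_def coord_space_def)
    have "dotp n r x0 = (\<Sum>j<n. if j = i then 1 else 0)"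
      unfolding dotp_def x0_def using i by (intro sum.cong) auto
    then have "dotp n r x0 = 1" using i by simp
    then have ne: "add_char (dotp n r x0) \<noteq> 1" using add_char_1 by simp
    have "(\<Sum>x\<in>?G. add_char (dotp n r x)) = (\<Sum>x\<in>?G. add_char (dotp n r (x + x0)))"
      by (rule sum.reindex_bij_witness[of _ "\<lambda>x. x + x0" "\<lambda>x. x - x0"])
        (use x0 in \<open>auto simp: coord_space_def\<close>)
    also have "\<dots> = add_char (dotp n r x0) * (\<Sum>x\<in>?G. add_char (dotp n r x))"
      by (simp add: dotp_commute[of n r] dotp_add add_char_add sum_distrib_left mult.commute)
    finally show ?thesis using ne by simp
  qed
qed

section \<open>Spans over the prime field\<close>

definition scale_fun :: "'a::field \<Rightarrow> (nat \<Rightarrow> 'a) \<Rightarrow> nat \<Rightarrow> 'a" where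
  "scale_fun c v = (\<lambda>i. c * v i)"

definition scale_pair :: "'a::field \<Rightarrow> (nat \<Rightarrow> 'a) \<times> (nat \<Rightarrow> 'a) \<Rightarrow> (nat \<Rightarrow> 'a) \<times> (nat \<Rightarrow> 'a)" where
  "scale_pair c z = (scale_fun c (fst z), scale_fun c (snd z))"

interpretation fun_space: vector_space scale_fun
  by unfold_locales (auto simp: scale_fun_def fun_eq_iff algebra_simps)

interpretation pair_space: vector_space scale_pair
  by unfold_locales (auto simp: scale_pair_def scale_fun_def fun_eq_iff algebra_simps prod_eq_iff)

interpretation pair_fun: vector_space_pair scale_pair scale_fun ..

lemma card_span_le:
  fixes T :: "((nat \<Rightarrow> 'p::prime_card mod_ring) \<times> (nat \<Rightarrow> 'p mod_ring)) set"
  assumes "finite T"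
  shows "finite (pair_space.span T) \<and> card (pair_space.span T) \<le> CARD('p) ^ card T"
  using assms
proof (induction T rule: finite_induct)
  case (insert a T)
  let ?g = "\<lambda>(k :: 'p mod_ring, y). scale_pair k a + y"
  have sub: "pair_space.span (insert a T) \<subseteq> ?g ` (UNIV \<times> pair_space.span T)"
  proof
    fix x assume "x \<in> pair_space.span (insert a T)"
    then obtain k where "x - scale_pair k a \<in> pair_space.span T"
      by (auto simp: pair_space.span_insert)
    then show "x \<in> ?g ` (UNIV \<times> pair_space.span T)"
      by (intro image_eqI[of _ _ "(k, x - scale_pair k a)"]) auto
  qed
  have fin: "finite ((UNIV :: 'p mod_ring set) \<times> pair_space.span T)" using insert by simp
  have "card (pair_space.span (insert a T)) \<le> card ((UNIV :: 'p mod_ring set) \<times> pair_space.span T)"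
    by (rule surj_card_le[OF fin sub])
  also have "\<dots> \<le> CARD('p) ^ card (insert a T)"
    using insert by (simp add: card_cartesian_product CARD_mod_ring)
  finally show ?case using finite_surj[OF fin sub] by blast
qed simp

text \<open>Every scalar of a prime field is a multiple of 1, so scaling is repeated addition and
  the span coincides with what addition alone generates.\<close>

lemma span_subset_of_add_closed:
  fixes D :: "((nat \<Rightarrow> 'p::prime_card mod_ring) \<times> (nat \<Rightarrow> 'p mod_ring)) set"
  assumes "0 \<in> H" and closed: "\<And>d x. d \<in> D \<Longrightarrow> x \<in> H \<Longrightarrow> d + x \<in> H"
  shows "pair_space.span D \<subseteq> H"
proof
  fix x assume "x \<in> pair_space.span D"
  then show "x \<in> H"
  proof (induction rule: pair_space.span_induct_alt)
    case base
    show ?case by (rule assms)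
  next
    case (step c d y)
    obtain k where k: "c = of_nat k" using surj_of_nat_mod_ring[of c] by blast
    have "scale_pair (of_nat k) d + y \<in> H" for k
    proof (induction k)
      case 0
      show ?case using step by simp
    next
      case (Suc k)
      from closed[OF step(1) this] show ?case by (simp add: pair_space.scale_left_distrib add_ac)
    qed
    then show ?case by (simp add: k)
  qed
qed

section \<open>Affine maps in the large spectrum\<close>

definition affine_self_maps :: "nat \<Rightarrow> ((nat \<Rightarrow> 'a::field) \<Rightarrow> nat \<Rightarrow> 'a) set" where
  "affine_self_maps n = {\<lambda>h. \<phi> h + t | \<phi> t. Vector_Spaces.linear scale_fun scale_fun \<phi>
      \<and> range \<phi> \<subseteq> coord_space n \<and> t \<in> coord_space n}"

lemma ex_fibre_ge:
  fixes A :: "'a set"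
  assumes "finite A" "finite B" "A \<noteq> {}" "\<And>x. x \<in> A \<Longrightarrow> g x \<in> B"
  shows "\<exists>b\<in>B. card A \<le> card B * card {x\<in>A. g x = b}"
proof (rule ccontr)
  assume *: "\<not> ?thesis"
  have "B \<noteq> {}" using assms by auto
  have "card A = card (\<Union>b\<in>B. {x\<in>A. g x = b})"
    using assms by (intro arg_cong[where f = card]) auto
  also have "\<dots> = (\<Sum>b\<in>B. card {x\<in>A. g x = b})"
    by (rule card_UN_disjoint) (use assms in auto)
  finally have "card B * card A = (\<Sum>b\<in>B. card B * card {x\<in>A. g x = b})"
    by (simp add: sum_distrib_left)
  also have "\<dots> < (\<Sum>b\<in>B. card A)"
    using * \<open>B \<noteq> {}\<close> assms by (intro sum_strict_mono) auto
  finally show False by simp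
qed

text \<open>A Freiman-type statement. The span \<open>H\<close> of the popular differences is only
  exponentially larger than \<open>A\<close>, since it is covered by translates of
  \<open>D + D\<close> along the span of the bounded set \<open>T\<close>. Half of \<open>A\<close>
  lies in the coset \<open>a + H\<close>; a linear section of the first projection of
  \<open>H\<close> describes it up to a vertical shift, and the most frequent shift gives the affine
  map.\<close>

lemma ex_affine_of_small_doubling:
  fixes A :: "((nat \<Rightarrow> 'p::prime_card mod_ring) \<times> (nat \<Rightarrow> 'p mod_ring)) set" and K :: real
  assumes fin: "finite A" and ne: "A \<noteq> {}" and graph: "inj_on fst A"
    and A: "A \<subseteq> coord_space n \<times> coord_space n" and K: "K \<ge> 1"
    and doubling: "card (A + uminus ` A) \<le> K * card A"
  shows "\<exists>T\<in>affine_self_maps n.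
    card A \<le> 16 * K ^ 4 * real CARD('p) powr (32 * K ^ 8) * card {z\<in>A. snd z = T (fst z)}"
proof -
  let ?p = "real CARD('p)"
  obtain D a T where D: "finite D" "finite T" "T \<subseteq> iterated_sumset 3 D"
    "0 \<in> D" "uminus ` D = D" "card A \<le> 2 * card {x\<in>A. x - a \<in> D}"
    "card (D + D) \<le> 4 * K ^ 4 * card A" "card T \<le> 32 * K ^ 8"
    "D + (D + D) \<subseteq> T + (D + D)"
    by (rule ex_popular_differences[OF fin ne K doubling])
  define H where "H = pair_space.span D"
  have span_T: "finite (pair_space.span T)" "card (pair_space.span T) \<le> CARD('p) ^ card T"
    using card_span_le[OF D(2)] by auto
  \<comment> \<open>The right-hand side contains 0 and absorbs each \<open>d \<in> D\<close>: for
    \<open>y \<in> D + D\<close> the sum \<open>d + y\<close> falls back into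
    \<open>T + (D + D)\<close>.\<close>
  have "H \<subseteq> pair_space.span T + (D + D)"
    unfolding H_def
  proof (rule span_subset_of_add_closed)
    have "0 + (0 + 0) \<in> pair_space.span T + (D + D)"
      using D(4) by (intro set_plus_intro pair_space.span_zero)
    then show "0 \<in> pair_space.span T + (D + D)" by simp
    fix d x assume "d \<in> D" and "x \<in> pair_space.span T + (D + D)"
    from this(2) obtain s y where x: "x = s + y" "s \<in> pair_space.span T" "y \<in> D + D"
      by (rule set_plus_elim)
    have "d + y \<in> T + (D + D)" using set_plus_intro[OF \<open>d \<in> D\<close> x(3)] D(9) by (rule subsetD[rotated])
    then obtain t y' where y: "d + y = t + y'" "t \<in> T" "y' \<in> D + D" by (rule set_plus_elim)
    have "d + x = (s + t) + y'" using x(1) y(1) by (metis add.assoc add.commute)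
    moreover have "s + t \<in> pair_space.span T"
      by (rule pair_space.span_add[OF x(2) pair_space.span_base[OF y(2)]])
    ultimately show "d + x \<in> pair_space.span T + (D + D)" using y(3) by (auto intro: set_plus_intro)
  qed
  moreover have fin_sum: "finite (pair_space.span T + (D + D))" using span_T D by (intro finite_set_plus)
  ultimately have fH: "finite H" and "card H \<le> card (pair_space.span T + (D + D))"
    by (auto intro: finite_subset card_mono)
  moreover have "card (pair_space.span T + (D + D)) \<le> card (pair_space.span T \<times> (D + D))"
    unfolding set_plus_image by (rule card_image_le) (use span_T D in \<open>auto intro: finite_set_plus\<close>)
  ultimately have "card H \<le> card (pair_space.span T) * card (D + D)" by (simp add: card_cartesian_product)
  also have "\<dots> \<le> CARD('p) ^ card T * card (D + D)" using span_T by simp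
  finally have "real (card H) \<le> real (CARD('p) ^ card T * card (D + D))" by (rule of_nat_mono)
  also have "\<dots> = ?p ^ card T * card (D + D)" by simp
  also have "\<dots> \<le> ?p powr (32 * K ^ 8) * (4 * K ^ 4 * card A)"
  proof (rule mult_mono)
    have p: "?p \<ge> 2" using two_le_card[where 'p = 'p] by linarith
    then have "?p ^ card T = ?p powr card T" by (simp add: powr_realpow)
    also have "\<dots> \<le> ?p powr (32 * K ^ 8)" using p D(8) by (intro powr_mono) auto
    finally show "?p ^ card T \<le> ?p powr (32 * K ^ 8)" .
  qed (use D(7) in auto)
  finally have card_H: "card H \<le> ?p powr (32 * K ^ 8) * (4 * K ^ 4 * card A)" .
  define A1 where "A1 = {x\<in>A. x - a \<in> D}"
  have A1: "finite A1" "A1 \<subseteq> A" "card A \<le> 2 * card A1" using fin D(6) by (auto simp: A1_def)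
  have "A1 \<noteq> {}" using A1 ne fin by (metis card_0_eq card.empty le_zero_eq mult_0_right)
  have "Vector_Spaces.linear scale_pair scale_fun fst"
    by unfold_locales (auto simp: scale_pair_def)
  then obtain g where g: "range g \<subseteq> H" "Vector_Spaces.linear scale_fun scale_pair g" "\<And>v. v \<in> fst `
      H \<Longrightarrow> fst (g v) = v"
    using pair_fun.linear_exists_right_inverse_on[of fst H] pair_space.subspace_span unfolding H_def
        by blast
  interpret g: Vector_Spaces.linear scale_fun scale_pair g by (rule g)
  \<comment> \<open>The vertical deviation of \<open>x - a\<close> from the section
    \<open>g\<close>. It lies in the vertical subgroup \<open>K0\<close> of \<open>H\<close>, and
    points with equal deviation lie on a common affine graph.\<close>
  define \<kappa> where "\<kappa> x = snd (x - a) - snd (g (fst (x - a)))" for x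
  define K0 where "K0 = {r. (0, r) \<in> H}"
  have "inj_on (Pair 0) K0" by (simp add: inj_on_def)
  moreover have "Pair 0 ` K0 \<subseteq> H" by (auto simp: K0_def)
  ultimately have fK0: "finite K0" using fH by (metis finite_imageD finite_subset)
  have diff_H: "x - a \<in> H" if "x \<in> A1" for x
    using that unfolding A1_def H_def by (auto intro: pair_space.span_base)
  have \<kappa>: "\<kappa> x \<in> K0" if "x \<in> A1" for x
  proof -
    have "(x - a) - g (fst (x - a)) \<in> H"
      unfolding H_def
    proof (rule pair_space.span_diff)
      show "x - a \<in> pair_space.span D" using diff_H[OF that] by (simp add: H_def)
      show "g (fst (x - a)) \<in> pair_space.span D" using g(1) by (auto simp: H_def)
    qed
    moreover have "fst (g (fst (x - a))) = fst (x - a)" using diff_H[OF that] g(3) by blast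
    ultimately have "(0, \<kappa> x) \<in> H" by (simp add: \<kappa>_def prod_eq_iff minus_prod_def)
    then show ?thesis by (simp add: K0_def)
  qed
  obtain b where b: "b \<in> K0" "card A1 \<le> card K0 * card {x\<in>A1. \<kappa> x = b}"
    using ex_fibre_ge[OF A1(1) fK0 \<open>A1 \<noteq> {}\<close>] \<kappa> by blast
  \<comment> \<open>Since \<open>A\<close> is a graph, the first coordinate of
    \<open>(x - a) + (0, r)\<close> determines \<open>x\<close>. Thus the pigeonhole loss
    \<open>card K0\<close> is at most \<open>card H / card A1\<close>.\<close>
  have "card (K0 \<times> A1) \<le> card H"
  proof (rule card_inj_on_le[where f = "\<lambda>(r, x). (x - a) + (0, r)"])
    show "inj_on (\<lambda>(r, x). (x - a) + (0, r)) (K0 \<times> A1)"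
    proof (rule inj_onI)
      fix q q' assume q: "q \<in> K0 \<times> A1" "q' \<in> K0 \<times> A1"
        and eq: "(case q of (r, x) \<Rightarrow> x - a + (0, r)) = (case q' of (r, x) \<Rightarrow> x - a + (0, r))"
      from eq have "fst (snd q) = fst (snd q')" by (auto simp: prod_eq_iff case_prod_unfold)
      moreover have "snd q \<in> A" "snd q' \<in> A" using q A1(2) by (auto simp: mem_Times_iff)
      ultimately have "snd q = snd q'" by (rule inj_onD[OF graph])
      then show "q = q'" using eq by (auto simp: prod_eq_iff case_prod_unfold)
    qed
    show "(\<lambda>(r, x). (x - a) + (0, r)) ` (K0 \<times> A1) \<subseteq> H"
      using diff_H unfolding K0_def H_def by (auto intro!: pair_space.span_add)
  qed (rule fH)
  then have "real (card K0 * card A1) \<le> card H" unfolding card_cartesian_product by (rule of_nat_mono)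
  then have K0_A1: "real (card K0) * card A1 \<le> card H" by simp
  \<comment> \<open>Truncation is linear and fixes the second coordinates of points of
    \<open>A\<close>, so it forces the map into \<open>coord_space n\<close> without losing any
    agreement.\<close>
  define trunc where "trunc v = (\<lambda>i. if i < n then v i else 0)" for v :: "nat \<Rightarrow> 'p mod_ring"
  have trunc: "trunc v \<in> coord_space n" for v by (simp add: trunc_def coord_space_def)
  have trunc_id: "trunc v = v" if "v \<in> coord_space n" for v
    using that by (auto simp: trunc_def coord_space_def fun_eq_iff)
  have trunc_add: "trunc (u + v) = trunc u + trunc v" for u v
    by (auto simp: trunc_def fun_eq_iff)
  define \<phi> where "\<phi> h = trunc (snd (g h))" for h
  have lin: "Vector_Spaces.linear scale_fun scale_fun \<phi>"
  proof unfold_locales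
    show "\<phi> (u + v) = \<phi> u + \<phi> v" for u v by (simp add: \<phi>_def g.add trunc_add)
    have "trunc (scale_fun r v) = scale_fun r (trunc v)" for r v
      by (auto simp: trunc_def scale_fun_def)
    then show "\<phi> (scale_fun r v) = scale_fun r (\<phi> v)" for r v
      by (simp add: \<phi>_def g.scale scale_pair_def)
  qed
  interpret \<phi>: Vector_Spaces.linear scale_fun scale_fun \<phi> by (rule lin)
  define T' where "T' h = \<phi> h + trunc (b + snd a - snd (g (fst a)))" for h
  have T': "T' \<in> affine_self_maps n"
  proof -
    have "T' = (\<lambda>h. \<phi> h + trunc (b + snd a - snd (g (fst a))))" by (simp add: T'_def fun_eq_iff)
    moreover have "range \<phi> \<subseteq> coord_space n" using trunc by (auto simp: \<phi>_def)
    ultimately show ?thesis unfolding affine_self_maps_def using lin trunc by blast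
  qed
  have "{x\<in>A1. \<kappa> x = b} \<subseteq> {z\<in>A. snd z = T' (fst z)}"
  proof
    fix x assume "x \<in> {x\<in>A1. \<kappa> x = b}"
    then have x: "x \<in> A" "\<kappa> x = b" using A1 by auto
    have eq: "snd x = snd (g (fst x)) + (b + snd a - snd (g (fst a)))"
      using x(2) by (auto simp: \<kappa>_def g.diff)
    have "trunc (snd x) = T' (fst x)" by (simp only: eq trunc_add T'_def \<phi>_def)
    moreover have "trunc (snd x) = snd x" using x A trunc_id by (auto simp: mem_Times_iff)
    ultimately show "x \<in> {z\<in>A. snd z = T' (fst z)}" using x by simp
  qed
  then have "card {x\<in>A1. \<kappa> x = b} \<le> card {z\<in>A. snd z = T' (fst z)}"
    using fin by (intro card_mono) auto
  then have "card K0 * card {x\<in>A1. \<kappa> x = b} \<le> card K0 * card {z\<in>A. snd z = T' (fst z)}"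
    by (rule mult_le_mono2)
  with b(2) have "card A1 \<le> card K0 * card {z\<in>A. snd z = T' (fst z)}" by (rule order_trans)
  then have "real (card A1) \<le> real (card K0 * card {z\<in>A. snd z = T' (fst z)})" by (rule of_nat_mono)
  then have "real (card A1) \<le> real (card K0) * card {z\<in>A. snd z = T' (fst z)}" by simp
  then have "real (card A1) * card A1 \<le> (real (card K0) * card {z\<in>A. snd z = T' (fst z)}) * card A1"
    by (rule mult_right_mono) simp
  also have "\<dots> = (real (card K0) * card A1) * card {z\<in>A. snd z = T' (fst z)}" by simp
  also have "\<dots> \<le> real (card H) * card {z\<in>A. snd z = T' (fst z)}"
    by (rule mult_right_mono[OF K0_A1]) simp
  finally have "real (card A1) * card A1 \<le> real (card H) * card {z\<in>A. snd z = T' (fst z)}" .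
  moreover have "real (card A) * card A \<le> 4 * (real (card A1) * card A1)"
  proof -
    have "real (card A) \<le> 2 * card A1" using A1(3) by linarith
    from mult_mono[OF this this] show ?thesis by simp
  qed
  moreover have "real (card H) * card {z\<in>A. snd z = T' (fst z)}
      \<le> (?p powr (32 * K ^ 8) * (4 * K ^ 4 * card A)) * card {z\<in>A. snd z = T' (fst z)}"
    using card_H by (intro mult_right_mono) auto
  ultimately have "real (card A) * card A
      \<le> (16 * K ^ 4 * ?p powr (32 * K ^ 8) * card {z\<in>A. snd z = T' (fst z)}) * card A"
    by (simp add: mult_ac)
  then have "card A \<le> 16 * K ^ 4 * ?p powr (32 * K ^ 8) * card {z\<in>A. snd z = T' (fst z)}"
    using fin ne by (simp add: card_gt_0_iff)
  with T' show ?thesis by blast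
qed

interpretation coord: dual_pairing "coord_space n" "\<lambda>u v. add_char (dotp n u v :: 'p::prime_card
    mod_ring)" for n
  by (rule dual_pairing_coord_space)

text \<open>From \<open>card C \<le> N / c\<^sup>2\<close> and
  \<open>card S \<ge> \<eta> * N\<close>, Balog-Szemeredi-Gowers leaves at most
  \<open>4096 * N / (c ^ 13 * \<eta> ^ 3)\<close> differences. Replacing \<open>N\<close> by
  \<open>4 * card A / (c * \<eta>)\<close> gives the doubling constant \<open>K\<close>. The 64 is
  this 4 times the 16 of the Freiman step.\<close>

lemma ex_affine_in_large_spectrum:
  fixes f :: "(nat \<Rightarrow> 'p::prime_card mod_ring) \<Rightarrow> (nat \<Rightarrow> 'p mod_ring) \<Rightarrow> complex" and \<delta> \<eta> :: real
  defines "c \<equiv> \<delta>\<^sup>2 / 2"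
  defines "K \<equiv> 2 ^ 14 / (c ^ 14 * \<eta> ^ 4)"
  assumes f: "\<And>x y. x \<in> coord_space n \<Longrightarrow> y \<in> coord_space n \<Longrightarrow> cmod (f x y) \<le> 1"
    and pos: "\<delta> > 0" "\<eta> > 0"
    and S: "S \<subseteq> coord.large_spectrum n f \<delta>" and graph: "inj_on fst S"
    and large: "\<eta> * card (coord_space n :: (nat \<Rightarrow> 'p mod_ring) set) \<le> card S"
  shows "\<exists>T\<in>affine_self_maps n. c * \<eta> / (64 * K ^ 4 * real CARD('p) powr (32 * K ^ 8)) * card
      (coord_space n :: (nat \<Rightarrow> 'p mod_ring) set)
    \<le> card {z\<in>S. snd z = T (fst z)}"
proof -
  define N where "N = real (card (coord_space n :: (nat \<Rightarrow> 'p mod_ring) set))"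
  have N: "N > 0" using coord.N_pos unfolding N_def by simp
  have c: "c > 0" using pos by (simp add: c_def)
  define C where "C = coord.large_spectrum n f c"
  have fin: "finite S" "finite C"
    using finite_subset[OF S coord.finite_large_spectrum] coord.finite_large_spectrum f
        by (auto simp: C_def)
  have S_large: "\<eta> * N \<le> card S" using large by (simp add: N_def)
  have ne: "S \<noteq> {}" using S_large mult_pos_pos[OF pos(2) N] by auto
  have "c * card S ^ 2 \<le> (\<Sum>b\<in>S. card {a\<in>S. a - b \<in> C})"
    using coord.large_spectrum_dense_differences[OF f S] pos by (simp add: c_def C_def)
  then obtain A where A: "A \<subseteq> S" "c * card S \<le> 4 * card A"
    "c ^ 5 * card S ^ 3 * card (A + uminus ` A) \<le> 4096 * card C ^ 4"
    by (rule balog_szemeredi_gowers[OF fin ne c])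
  have fA: "finite A" using A fin finite_subset by blast
  have A_large: "c * (\<eta> * N) \<le> 4 * card A"
    using mult_left_mono[OF S_large, of c] c A(2) by linarith
  then have "card A > 0" using mult_pos_pos[OF c mult_pos_pos[OF pos(2) N]] by linarith
  then have neA: "A \<noteq> {}" by auto
  have C_small: "c\<^sup>2 * card C \<le> N"
    using coord.card_large_spectrum_le[where \<delta> = c, OF f] c by (simp add: C_def N_def)
  let ?AA = "real (card (A + uminus ` A))"
  \<comment> \<open>The factor \<open>c ^ 8\<close> is set aside to form
    \<open>(c\<^sup>2 * card C) ^ 4\<close>.\<close>
  have "c ^ 13 * (\<eta> * N) ^ 3 * ?AA = c ^ 8 * (c ^ 5 * (\<eta> * N) ^ 3 * ?AA)"
      by (simp flip: power_add mult.assoc)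
  also have "\<dots> \<le> c ^ 8 * (c ^ 5 * real (card S) ^ 3 * ?AA)"
    using S_large pos N c by (intro mult_left_mono mult_right_mono power_mono) auto
  also have "\<dots> \<le> c ^ 8 * (4096 * real (card C) ^ 4)"
    using A(3) c by (intro mult_left_mono) auto
  also have "\<dots> = 4096 * (c\<^sup>2 * card C) ^ 4" by (simp add: power_mult_distrib flip: power_mult)
  also have "\<dots> \<le> 4096 * N ^ 4" using C_small c by (intro mult_left_mono power_mono) auto
  finally have "(c ^ 13 * \<eta> ^ 3 * ?AA) * N ^ 3 \<le> (4096 * N) * N ^ 3"
    using power_Suc[of N 3] by (simp add: power_mult_distrib mult_ac)
  then have "c ^ 13 * \<eta> ^ 3 * ?AA \<le> 4096 * N" using N by simp
  then have "(c * \<eta>) * (c ^ 13 * \<eta> ^ 3 * ?AA) \<le> (c * \<eta>) * (4096 * N)"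
    using c pos by (intro mult_left_mono) auto
  also have "\<dots> = 4096 * (c * (\<eta> * N))" by simp
  also have "\<dots> \<le> 4096 * (4 * real (card A))" using A_large by linarith
  finally have "c ^ 14 * \<eta> ^ 4 * ?AA \<le> 2 ^ 14 * card A"
    using power_Suc[of c 13] power_Suc[of \<eta> 3] by (simp add: mult_ac)
  then have doubling: "?AA \<le> K * card A"
    using c pos by (simp add: K_def field_simps)
  have "card A \<le> card (A + uminus ` A)" using fA neA by (intro card_le_card_set_plus) auto
  then have "1 * real (card A) \<le> K * card A" using doubling by linarith
  then have K: "K \<ge> 1" using \<open>card A > 0\<close> by (simp only: mult_le_cancel_right)
  have "inj_on fst A" "A \<subseteq> coord_space n \<times> coord_space n"
    using A(1) S graph by (auto simp: coord.large_spectrum_def[OF f] intro: inj_on_subset)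
  from ex_affine_of_small_doubling[OF fA neA this K doubling] obtain T :: "(nat \<Rightarrow> 'p mod_ring) \<Rightarrow> nat
      \<Rightarrow> 'p mod_ring"
    where T: "T \<in> affine_self_maps n"
      "card A \<le> 16 * K ^ 4 * real CARD('p) powr (32 * K ^ 8) * card {z\<in>A. snd z = T (fst z)}"
    by blast
  have "real (card {z\<in>A. snd z = T (fst z)}) \<le> card {z\<in>S. snd z = T (fst z)}"
    using A(1) fin by (intro of_nat_mono card_mono) auto
  then have "card A \<le> 16 * K ^ 4 * real CARD('p) powr (32 * K ^ 8) * card {z\<in>S. snd z = T (fst z)}"
    using K by (intro order_trans[OF T(2)] mult_left_mono) auto
  with A_large have "c * \<eta> * N \<le> 64 * K ^ 4 * real CARD('p) powr (32 * K ^ 8) * card {z\<in>S. snd z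
      = T (fst z)}"
    by linarith
  moreover have "real CARD('p) powr (32 * K ^ 8) > 0" using two_le_card[where 'p = 'p] by simp
  ultimately have "c * \<eta> / (64 * K ^ 4 * real CARD('p) powr (32 * K ^ 8)) * N \<le> card {z\<in>S. snd z
      = T (fst z)}"
    using K by (simp add: field_simps)
  with T(1) show ?thesis unfolding N_def by blast
qed

section \<open>Comparison with the doubly exponential bound\<close>

text \<open>The left-hand side is the number of forms needed, up to the factor
  \<open>\<zeta>\<^sup>2\<close>. Everything is expressed in \<open>P = p / \<zeta> \<ge> 2\<close>,
  and numerical constants are absorbed by \<open>2 ^ k \<le> P ^ k\<close>. Then
  \<open>1 / c\<close>, \<open>1 / \<eta>\<close> and \<open>K\<close> are at most
  \<open>P ^ 7\<close>, \<open>P ^ 5\<close> and \<open>P ^ 132\<close>, and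
  \<open>32 * K ^ 8\<close> is at most \<open>P ^ 1061\<close>.\<close>

lemma iterations_le_doubly_exponential:
  fixes \<zeta> p m :: real
  assumes \<zeta>: "0 < \<zeta>" "\<zeta> < 1" and p: "p \<ge> 2" and m: "m \<ge> 0"
  defines "c \<equiv> (\<zeta> / 3)\<^sup>2 / 2" and "\<eta> \<equiv> \<zeta>\<^sup>2 / 8"
  defines "K \<equiv> 2 ^ 14 / (c ^ 14 * \<eta> ^ 4)"
  assumes iter: "m * (c * \<eta> / (64 * K ^ 4 * p powr (32 * K ^ 8))) * (\<zeta> / 3)\<^sup>2 \<le> 1"
  defines "M \<equiv> exp (2 ^ 69 * (ln (inverse \<zeta>) + ln p) ^ 6)"
  shows "42 * (1 + m) ^ 5 \<le> 4 * M ^ 3 * 2 powr M"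
proof -
  define P where "P = p / \<zeta>"
  have \<zeta>P: "\<zeta> * P = p" using \<zeta> by (simp add: P_def)
  have "p * 1 \<le> p / \<zeta>" using \<zeta> p by (simp add: field_simps)
  then have pP: "p \<le> P" by (simp add: P_def)
  then have P2: "P \<ge> 2" using p by linarith
  then have P0: "P > 0" and P1: "P \<ge> 1" by linarith+
  have pow: "2 ^ k \<le> P ^ k" for k using P2 by (intro power_mono) auto
  have "(\<zeta> * P)\<^sup>2 \<ge> 2\<^sup>2" unfolding \<zeta>P using p by (intro power_mono) auto
  then have \<zeta>P2: "\<zeta>\<^sup>2 * P\<^sup>2 \<ge> 4" by (simp add: power_mult_distrib)
  have c: "c > 0" and \<eta>: "\<eta> > 0" using \<zeta> by (auto simp: c_def \<eta>_def)
  have "4 * 2 ^ 5 \<le> (\<zeta>\<^sup>2 * P\<^sup>2) * P ^ 5" using \<zeta>P2 pow[of 5] by (intro mult_mono) auto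
  also have "\<dots> = \<zeta>\<^sup>2 * P ^ 7" by (simp flip: power_add mult.assoc)
  also have "\<dots> = 18 * (c * P ^ 7)" by (simp add: c_def power_divide)
  finally have cP: "1 \<le> c * P ^ 7" by simp
  have "4 * 2 ^ 3 \<le> (\<zeta>\<^sup>2 * P\<^sup>2) * P ^ 3" using \<zeta>P2 pow[of 3] by (intro mult_mono) auto
  also have "\<dots> = \<zeta>\<^sup>2 * P ^ 5" by (simp flip: power_add mult.assoc)
  finally have \<eta>P: "1 \<le> \<eta> * P ^ 5" by (simp add: \<eta>_def)
  have K0: "K > 0" using c \<eta> by (simp add: K_def)
  have "1 * 1 \<le> (c * P ^ 7) ^ 14 * (\<eta> * P ^ 5) ^ 4"
    using cP \<eta>P by (intro mult_mono one_le_power) auto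
  also have "\<dots> = (c ^ 14 * \<eta> ^ 4) * P ^ 118"
    by (simp add: power_mult_distrib flip: power_mult power_add)
  finally have "1 / (c ^ 14 * \<eta> ^ 4) \<le> P ^ 118" using c \<eta> by (simp add: field_simps)
  then have "2 ^ 14 * (1 / (c ^ 14 * \<eta> ^ 4)) \<le> P ^ 14 * P ^ 118"
    using pow[of 14] c \<eta> P0 by (intro mult_mono) auto
  then have K: "K \<le> P ^ 132" by (simp add: K_def flip: power_add)
  have "32 * K ^ 8 \<le> P ^ 5 * (P ^ 132) ^ 8"
    using pow[of 5] K K0 P0 by (intro mult_mono power_mono) auto
  then have K8: "32 * K ^ 8 \<le> P ^ 1061" by (simp flip: power_mult power_add)
  have "p powr (32 * K ^ 8) \<le> P powr (32 * K ^ 8)" using p pP K0 by (intro powr_mono2) auto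
  also have "\<dots> \<le> P powr (P ^ 1061)" using K8 P1 by (intro powr_mono) auto
  finally have pK: "p powr (32 * K ^ 8) \<le> P powr (P ^ 1061)" .
  have pK0: "p powr (32 * K ^ 8) > 0" using p by simp
  define D where "D = 64 * K ^ 4 * p powr (32 * K ^ 8)"
  have D0: "D > 0" using K0 pK0 by (simp add: D_def)
  have "D \<le> (P ^ 6 * (P ^ 132) ^ 4) * P powr (P ^ 1061)"
    unfolding D_def using pow[of 6] K K0 P0 pK by (intro mult_mono power_mono) auto
  then have D: "D \<le> P ^ 534 * P powr (P ^ 1061)" by (simp flip: power_mult power_add)
  have "m * (c * \<eta> / D) * (\<zeta>\<^sup>2 / 9) \<le> 1" using iter by (simp add: D_def power_divide)
  then have mD: "m * (c * \<eta> * \<zeta>\<^sup>2) \<le> 9 * D" using D0 by (simp add: field_simps)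
  have "1 * 1 * 4 \<le> (c * P ^ 7) * (\<eta> * P ^ 5) * (\<zeta>\<^sup>2 * P\<^sup>2)"
    using cP \<eta>P \<zeta>P2 c \<eta> P0 by (intro mult_mono) auto
  also have "\<dots> = (c * \<eta> * \<zeta>\<^sup>2) * (P ^ 7 * P ^ 5 * P\<^sup>2)" by simp
  also have "\<dots> = (c * \<eta> * \<zeta>\<^sup>2) * P ^ 14" by (simp flip: power_add)
  finally have lower: "1 \<le> (c * \<eta> * \<zeta>\<^sup>2) * P ^ 14" by simp
  have "m * 1 \<le> m * ((c * \<eta> * \<zeta>\<^sup>2) * P ^ 14)" using m lower by (intro mult_left_mono) auto
  also have "\<dots> = (m * (c * \<eta> * \<zeta>\<^sup>2)) * P ^ 14" by simp
  also have "\<dots> \<le> (9 * D) * P ^ 14" using mD P0 by (intro mult_right_mono) auto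
  also have "\<dots> \<le> (P ^ 4 * (P ^ 534 * P powr (P ^ 1061))) * P ^ 14"
    using pow[of 4] D D0 P0 by (intro mult_mono) auto
  also have "\<dots> = P ^ 552 * P powr (P ^ 1061)" by (simp flip: power_add add: mult_ac)
  finally have m_le: "m \<le> P ^ 552 * P powr (P ^ 1061)" by simp
  define X where "X = P ^ 552 * P powr (P ^ 1061)"
  have "1 \<le> P powr (P ^ 1061)" using P1 by (intro ge_one_powr_ge_zero) auto
  then have X1: "X \<ge> 1" unfolding X_def using P1 mult_mono[of 1 "P ^ 552" 1 "P powr (P ^ 1061)"]
      by (simp add: one_le_power)
  have "42 * (1 + m) ^ 5 \<le> P ^ 6 * (P * X) ^ 5"
  proof (rule mult_mono)
    show "42 \<le> P ^ 6" using pow[of 6] by simp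
    have "1 + m \<le> 2 * X" using m_le X1 unfolding X_def by linarith
    also have "\<dots> \<le> P * X" using P2 X1 by (intro mult_right_mono) auto
    finally show "(1 + m) ^ 5 \<le> (P * X) ^ 5" using m by (intro power_mono) auto
  qed (use m P0 in auto)
  also have "\<dots> = P ^ 2771 * (P powr (P ^ 1061)) ^ 5"
    by (simp add: X_def power_mult_distrib flip: power_mult power_add mult.assoc)
  also have "\<dots> = P powr (2771 + 5 * P ^ 1061)"
  proof -
    have "P ^ 2771 = P powr 2771" using P0 powr_realpow[of P 2771] by simp
    moreover have "(P powr y) ^ 5 = P powr (5 * y)" for y
      using powr_realpow[of "P powr y" 5] P0 by (simp add: powr_powr mult.commute)
    ultimately show ?thesis by (simp only: powr_add)
  qed
  also have "\<dots> \<le> P powr (P ^ 1067)"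
  proof (rule powr_mono)
    have "2771 \<le> P ^ 12" using pow[of 12] by simp
    also have "\<dots> \<le> P ^ 1061" using P1 by (intro power_increasing) auto
    finally have "2771 + 5 * P ^ 1061 \<le> 2 ^ 6 * P ^ 1061" using P0 zero_le_power[of P 1061] by simp
    also have "\<dots> \<le> P ^ 6 * P ^ 1061" using pow[of 6] P0 by (intro mult_right_mono) auto
    finally show "2771 + 5 * P ^ 1061 \<le> P ^ 1067" by (simp flip: power_add)
  qed (rule P1)
  also have "\<dots> \<le> (2 powr P) powr (P ^ 1067)"
  proof (rule powr_mono2)
    let ?k = "nat \<lfloor>P\<rfloor>"
    have "P \<le> real (Suc ?k)" using P0 by linarith
    also have "\<dots> \<le> real (2 ^ ?k)" by (intro of_nat_mono Suc_leI less_exp)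
    also have "\<dots> = 2 powr ?k" by (simp add: powr_realpow)
    also have "\<dots> \<le> 2 powr P" using P0 by (intro powr_mono) auto
    finally show "P \<le> 2 powr P" .
  qed (use P0 in auto)
  also have "\<dots> = 2 powr (P ^ 1068)" by (simp add: powr_powr flip: power_Suc)
  also have "\<dots> \<le> 2 powr M"
  proof (rule powr_mono)
    \<comment> \<open>From \<open>P \<ge> 2 \<ge> exp (1 / 2)\<close> one gets
      \<open>L \<ge> 1 / 2\<close>, so \<open>L ^ 6\<close> is at least \<open>L / 32\<close>; the
      remaining \<open>2 ^ 64\<close> far exceeds 1068.\<close>
    define L where "L = ln P"
    have L: "L = ln (inverse \<zeta>) + ln p" using \<zeta> p by (simp add: L_def P_def ln_div ln_inverse)
    have "exp (1 / 2) \<le> P" using exp_half_le2 P2 by linarith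
    then have "L \<ge> 1 / 2" unfolding L_def ln_ge_iff[OF P0] .
    then have "(1 / 2) ^ 5 \<le> L ^ 5" by (intro power_mono) auto
    then have "2 ^ 69 * (1 / 2) ^ 5 * L \<le> 2 ^ 69 * L ^ 5 * L" using \<open>L \<ge> 1 / 2\<close>
        by (intro mult_right_mono mult_left_mono) auto
    also have "\<dots> = 2 ^ 69 * L ^ 6" by (simp add: eval_nat_numeral)
    finally have "2 ^ 69 * (1 / 2) ^ 5 * L \<le> 2 ^ 69 * L ^ 6" .
    moreover have "1068 * L \<le> 2 ^ 69 * (1 / 2) ^ 5 * L" using \<open>L \<ge> 1 / 2\<close> by (simp add: power_divide)
    ultimately have "1068 * L \<le> 2 ^ 69 * L ^ 6" by (rule order_trans[rotated])
    then have "exp (1068 * L) \<le> M" by (simp add: M_def L)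
    moreover have "exp (1068 * L) = P ^ 1068"
      using P0 exp_of_nat_mult[of 1068 L] by (simp add: L_def)
    ultimately show "P ^ 1068 \<le> M" by simp
  qed simp
  also have "\<dots> \<le> 4 * M ^ 3 * 2 powr M"
  proof -
    have "M \<ge> 1" by (simp add: M_def)
    then have "M ^ 3 \<ge> 1" by (rule one_le_power)
    then have "1 * 2 powr M \<le> (4 * M ^ 3) * 2 powr M" by (intro mult_right_mono) auto
    then show ?thesis by simp
  qed
  finally show ?thesis .
qed

section \<open>Bi-affine maps and averaging projections\<close>

definition coords :: "nat \<Rightarrow> 'a::zero vec \<Rightarrow> nat \<Rightarrow> 'a" where
  "coords n x = (\<lambda>i. if i < n then x $ i else 0)"

lemma coords_in_space: "coords n x \<in> coord_space n"
  by (simp add: coords_def coord_space_def)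

lemma vec_coords: "x \<in> carrier_vec n \<Longrightarrow> vec n (coords n x) = x"
  by (auto simp: coords_def)

lemma coords_vec: "v \<in> coord_space n \<Longrightarrow> coords n (vec n v) = v"
  by (auto simp: coords_def coord_space_def fun_eq_iff)

lemma coords_minus:
  "x \<in> carrier_vec n \<Longrightarrow> y \<in> carrier_vec n \<Longrightarrow> coords n (x - y :: 'a::ab_group_add vec)
      = coords n x - coords n y"
  by (auto simp: coords_def fun_eq_iff)

lemma bij_coords: "bij_betw (coords n) (carrier_vec n) (coord_space n)"
  by (rule bij_betwI[where g = "vec n"]) (auto simp: coords_in_space vec_coords coords_vec)

lemma sum_carrier_vec: "(\<Sum>x\<in>carrier_vec n. g (coords n x)) = (\<Sum>v\<in>coord_space n. g v)"
  by (rule sum.reindex_bij_betw[OF bij_coords])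

lemma card_carrier_coord: "card (carrier_vec n :: 'a::zero vec set)
    = card (coord_space n :: (nat \<Rightarrow> 'a) set)"
  by (rule bij_betw_same_card[OF bij_coords])

text \<open>For fixed \<open>x\<close> the sums over \<open>y\<close> and \<open>y'\<close>
  separate: one is the autocorrelation of \<open>f x\<close> at \<open>h\<close>, the other the
  conjugate of the same quantity at \<open>x - w\<close>.\<close>

lemma mixed_convolution_conv_autocorr:
  fixes f :: "'p::prime_card mod_ring vec \<Rightarrow> 'p mod_ring vec \<Rightarrow> complex"
  assumes w: "w \<in> carrier_vec n" and h: "h \<in> carrier_vec n"
  shows "mixed_convolution n f w h =
    coord.autocorr n (\<lambda>u. coord.autocorr n (\<lambda>v. f (vec n u) (vec n v)) (coords n h)) (coords n w)"
proof -
  let ?V = "carrier_vec n :: 'p mod_ring vec set" and ?G = "coord_space n :: (nat \<Rightarrow> 'p mod_ring) set"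
  let ?f = "\<lambda>u v. f (vec n u) (vec n v)" and ?N = "of_nat (card ?G) :: complex"
  let ?w = "coords n w" and ?h = "coords n h"
  let ?g = "\<lambda>u. \<Sum>v\<in>?G. ?f u v * cnj (?f u (v - ?h))"
  have f_eq: "f x y = ?f (coords n x) (coords n y)" if "x \<in> ?V" "y \<in> ?V" for x y
    using that by (simp add: vec_coords)
  have "(\<Sum>(x, y, y')\<in>?V \<times> ?V \<times> ?V. f x y * cnj (f x (y - h)) * cnj (f (x - w) y') * f (x - w) (y' - h))
      = (\<Sum>x\<in>?V. \<Sum>y\<in>?V. \<Sum>y'\<in>?V. f x y * cnj (f x (y - h)) * cnj (f (x - w) y') * f (x - w) (y' - h))"
    by (simp add: sum.cartesian_product)
  also have "\<dots> = (\<Sum>x\<in>?V. (\<Sum>y\<in>?V. f x y * cnj (f x (y - h))) * cnj (\<Sum>y'\<in>?V. f (x - w) y' * cnj (f (x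
      - w) (y' - h))))"
    by (simp add: sum_product mult_ac)
  also have "\<dots> = (\<Sum>x\<in>?V. ?g (coords n x) * cnj (?g (coords n x - ?w)))"
  proof (rule sum.cong[OF refl])
    fix x assume x: "x \<in> ?V"
    have "(\<Sum>y\<in>?V. f z y * cnj (f z (y - h))) = ?g (coords n z)" if "z \<in> ?V" for z
      unfolding sum_carrier_vec[symmetric]
      using that h by (intro sum.cong) (auto simp: vec_coords simp flip: coords_minus)
    from this[OF x] this[of "x - w"] x w
    show "(\<Sum>y\<in>?V. f x y * cnj (f x (y - h))) * cnj (\<Sum>y'\<in>?V. f (x - w) y' * cnj (f (x - w) (y' - h)))
      = ?g (coords n x) * cnj (?g (coords n x - ?w))"
      by (simp add: coords_minus)
  qed
  also have "\<dots> = (\<Sum>u\<in>?G. ?g u * cnj (?g (u - ?w)))"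
    by (rule sum_carrier_vec)
  finally have num: "(\<Sum>(x, y, y')\<in>?V \<times> ?V \<times> ?V. f x y * cnj (f x (y - h)) * cnj (f (x - w) y') * f
      (x - w) (y' - h))
      = (\<Sum>u\<in>?G. ?g u * cnj (?g (u - ?w)))" .
  have "(\<Sum>u\<in>?G. a u / ?N * cnj (b u / ?N)) = (\<Sum>u\<in>?G. a u * cnj (b u)) / (?N * ?N)" for a b :: "_ \<Rightarrow> complex"
    by (simp add: sum_divide_distrib)
  from this[of ?g "\<lambda>u. ?g (u - ?w)"]
  have "(\<Sum>u\<in>?G. ?g u / ?N * cnj (?g (u - ?w) / ?N)) = (\<Sum>u\<in>?G. ?g u * cnj (?g (u - ?w))) / (?N * ?N)" .
  then show ?thesis
    unfolding mixed_convolution_def expect_def coord.autocorr_def num card_cartesian_product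
        card_carrier_coord
    by (simp only: of_nat_mult divide_divide_eq_left mult.assoc[of ?N])
qed

section \<open>Affine and bi-affine forms\<close>

definition affine_fun :: "nat \<Rightarrow> ((nat \<Rightarrow> 'a::field) \<Rightarrow> 'a) \<Rightarrow> bool" where
  "affine_fun n b \<longleftrightarrow> (\<exists>a c. \<forall>h\<in>coord_space n. b h = dotp n a h + c)"

lemma affine_fun_const: "affine_fun n (\<lambda>h. c)"
  unfolding affine_fun_def by (rule exI[of _ "\<lambda>_. 0"]) (auto simp: dotp_def)

lemma affine_fun_dotp: "affine_fun n (\<lambda>h. dotp n u h)"
  unfolding affine_fun_def by (intro exI[of _ u] exI[of _ 0]) simp

lemma sum_fun_apply: "(\<Sum>x\<in>A. g x) i = (\<Sum>x\<in>A. g x i)" for g :: "'b \<Rightarrow> nat \<Rightarrow> 'a::comm_monoid_add"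
  by (induction A rule: infinite_finite_induct) auto

text \<open>The coefficient vector is the adjoint of the linear part applied to \<open>u\<close>,
  read off on the unit vectors.\<close>

lemma affine_fun_dotp_affine:
  assumes "T \<in> affine_self_maps n"
  shows "affine_fun n (\<lambda>h. dotp n u (T h))"
proof -
  from assms obtain \<phi> t where \<phi>: "Vector_Spaces.linear scale_fun scale_fun \<phi>" and T: "T = (\<lambda>h. \<phi> h + t)"
    by (auto simp: affine_self_maps_def)
  interpret \<phi>: Vector_Spaces.linear scale_fun scale_fun \<phi> by (rule \<phi>)
  define unit :: "nat \<Rightarrow> nat \<Rightarrow> 'a" where "unit i = (\<lambda>j. if j = i then 1 else 0)" for i
  have "dotp n u (T h) = dotp n (\<lambda>i. dotp n u (\<phi> (unit i))) h + dotp n u t" if h: "h \<in> coord_space n" for h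
  proof -
    have "h = (\<Sum>i<n. scale_fun (h i) (unit i))"
    proof
      fix j
      have "(\<Sum>i<n. scale_fun (h i) (unit i)) j = (\<Sum>i<n. if j = i then h i else 0)"
        unfolding sum_fun_apply by (intro sum.cong) (auto simp: scale_fun_def unit_def)
      also have "\<dots> = h j" using h by (auto simp: coord_space_def)
      finally show "h j = (\<Sum>i<n. scale_fun (h i) (unit i)) j" by simp
    qed
    then have "\<phi> h = \<phi> (\<Sum>i<n. scale_fun (h i) (unit i))" by simp
    also have "\<dots> = (\<Sum>i<n. scale_fun (h i) (\<phi> (unit i)))" by (simp add: \<phi>.sum \<phi>.scale)
    finally have "dotp n u (\<phi> h) = (\<Sum>j<n. \<Sum>i<n. u j * (h i * \<phi> (unit i) j))"
      by (simp add: dotp_def sum_fun_apply scale_fun_def sum_distrib_left)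
    also have "\<dots> = dotp n (\<lambda>i. dotp n u (\<phi> (unit i))) h"
      by (subst sum.swap) (simp add: dotp_def sum_distrib_left mult_ac)
    finally show ?thesis by (simp add: T dotp_commute[of n u] dotp_add)
  qed
  then show ?thesis unfolding affine_fun_def by blast
qed

lemma affine_map_vec:
  assumes "\<And>j. j < k \<Longrightarrow> affine_fun n (b j)"
  shows "affine_map n k (\<lambda>x. vec k (\<lambda>j. b j (coords n x)))"
proof -
  from assms have "\<forall>j. \<exists>a c. j < k \<longrightarrow> (\<forall>h\<in>coord_space n. b j h = dotp n a h + c)"
    by (auto simp: affine_fun_def)
  then obtain a c where ac: "\<And>j h. j < k \<Longrightarrow> h \<in> coord_space n \<Longrightarrow> b j h = dotp n (a j) h + c j"
    by metis
  show ?thesis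
    unfolding affine_map_def
  proof (intro bexI ballI)
    fix x :: "'a vec" assume x: "x \<in> carrier_vec n"
    show "vec k (\<lambda>j. b j (coords n x)) = mat k n (\<lambda>(j, i). a j i) *\<^sub>v x + vec k c"
    proof (rule eq_vecI)
      fix j assume "j < dim_vec (mat k n (\<lambda>(j, i). a j i) *\<^sub>v x + vec k c)"
      then have j: "j < k" by simp
      have "dotp n (a j) (coords n x) = (\<Sum>i = 0..<n. a j i * x $ i)"
        by (simp add: dotp_def coords_def atLeast0LessThan)
      then show "vec k (\<lambda>j. b j (coords n x)) $ j = (mat k n (\<lambda>(j, i). a j i) *\<^sub>v x + vec k c) $ j"
        using j x by (simp add: ac coords_in_space scalar_prod_def)
    qed simp
  qed auto
qed

lemma biaffine_map_vec:
  assumes "\<And>j h. j < k \<Longrightarrow> h \<in> coord_space n \<Longrightarrow> affine_fun n (\<lambda>w. b j w h)"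
    and "\<And>j w. j < k \<Longrightarrow> w \<in> coord_space n \<Longrightarrow> affine_fun n (\<lambda>h. b j w h)"
  shows "biaffine_map n k (\<lambda>x y. vec k (\<lambda>j. b j (coords n x) (coords n y)))"
  unfolding biaffine_map_def
proof (intro conjI ballI)
  fix y
  show "affine_map n k (\<lambda>x. vec k (\<lambda>j. b j (coords n x) (coords n y)))"
    by (rule affine_map_vec[where b = "\<lambda>j w. b j w (coords n y)"]) (rule assms(1)[OF _ coords_in_space])
next
  fix x
  show "affine_map n k (\<lambda>y. vec k (\<lambda>j. b j (coords n x) (coords n y)))"
    by (rule affine_map_vec[where b = "\<lambda>j h. b j (coords n x) h"]) (rule assms(2)[OF _ coords_in_space])
qed

section \<open>The averaging projection as a nearest approximation\<close>

text \<open>Expanding around the mean, the cross term vanishes because deviations from the mean sum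
  to 0.\<close>

lemma sum_dist_mean_le:
  fixes F :: "'b \<Rightarrow> complex"
  assumes "finite L" "L \<noteq> {}"
  shows "(\<Sum>z\<in>L. (cmod (F z - expect L F))\<^sup>2) \<le> (\<Sum>z\<in>L. (cmod (F z - c))\<^sup>2)"
proof -
  let ?m = "expect L F"
  have "(\<Sum>z\<in>L. F z - ?m) = 0"
    using assms by (simp add: sum_subtractf expect_def)
  then have zero: "(\<Sum>z\<in>L. Re (cnj (?m - c) * (F z - ?m))) = 0"
    by (simp only: Re_sum[symmetric] sum_distrib_left[symmetric]) simp
  have "(cmod (F z - c))\<^sup>2 = (cmod (F z - ?m))\<^sup>2 + 2 * Re (cnj (?m - c) * (F z - ?m))
      + (cmod (?m - c))\<^sup>2" for z
    unfolding cmod_power2 by (simp add: power2_eq_square algebra_simps)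
  then have "(\<Sum>z\<in>L. (cmod (F z - c))\<^sup>2)
      = (\<Sum>z\<in>L. (cmod (F z - ?m))\<^sup>2) + 2 * (\<Sum>z\<in>L. Re (cnj (?m - c) * (F z - ?m)))
          + (\<Sum>z\<in>L. (cmod (?m - c))\<^sup>2)"
    by (simp only: sum.distrib sum_distrib_left)
  then show ?thesis using zero by (simp add: sum_nonneg)
qed

lemma finite_carrier_mod_ring: "finite (carrier_vec n :: 'p::prime_card mod_ring vec set)"
  using bij_betw_finite[OF bij_coords] finite_coord_space by blast

text \<open>A function \<open>\<Gamma>\<close> of \<open>\<beta>\<close> is constant on each level
  set, where the mean does at least as well. Exhibiting one good \<open>\<Gamma>\<close> therefore
  suffices, and the projection itself is never computed.\<close>

lemma norm_averaging_projection_le: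
  fixes F \<Gamma> :: "'p::prime_card mod_ring vec \<Rightarrow> 'p mod_ring vec \<Rightarrow> complex" and \<beta> :: "'p mod_ring vec \<Rightarrow>
      'p mod_ring vec \<Rightarrow> 'p mod_ring vec"
  assumes \<Gamma>: "\<And>x y x' y'. x \<in> carrier_vec n \<Longrightarrow> y \<in> carrier_vec n \<Longrightarrow> x' \<in> carrier_vec n \<Longrightarrow>
    y' \<in> carrier_vec n \<Longrightarrow> \<beta> x y = \<beta> x' y' \<Longrightarrow> \<Gamma> x y = \<Gamma> x' y'"
  shows "norm_L2 n (\<lambda>x y. F x y - averaging_projection n \<beta> F x y) \<le> norm_L2 n (\<lambda>x y. F x y - \<Gamma> x y)"
proof -
  define V where "V = (carrier_vec n \<times> carrier_vec n :: ('p mod_ring vec \<times> 'p mod_ring vec) set)"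
  define level where "level b = {z\<in>V. \<beta> (fst z) (snd z) = b}" for b
  have fV: "finite V" by (simp add: V_def finite_carrier_mod_ring)
  have P: "averaging_projection n \<beta> F x y = expect (level (\<beta> x y)) (\<lambda>z. F (fst z) (snd z))" for x y
  proof -
    have "{(x', y'). (x', y') \<in> carrier_vec n \<times> carrier_vec n \<and> \<beta> x' y' = \<beta> x y} = level (\<beta> x y)"
      by (auto simp: level_def V_def)
    then show ?thesis by (simp add: averaging_projection_def case_prod_unfold)
  qed
  have split: "sum g V = (\<Sum>b\<in>(\<lambda>z. \<beta> (fst z) (snd z)) ` V. sum g (level b))" for g :: "_ \<Rightarrow> real"
    unfolding level_def by (rule sum.image_gen[OF fV])
  have "(\<Sum>z\<in>V. (cmod (F (fst z) (snd z) - averaging_projection n \<beta> F (fst z) (snd z)))\<^sup>2)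
      \<le> (\<Sum>z\<in>V. (cmod (F (fst z) (snd z) - \<Gamma> (fst z) (snd z)))\<^sup>2)"
    unfolding split
  proof (rule sum_mono)
    fix b assume "b \<in> (\<lambda>z. \<beta> (fst z) (snd z)) ` V"
    then obtain z0 where z0: "z0 \<in> V" "\<beta> (fst z0) (snd z0) = b" by auto
    then have ne: "level b \<noteq> {}" unfolding level_def by blast
    have fin: "finite (level b)" using fV by (simp add: level_def)
    have "(\<Sum>z\<in>level b. (cmod (F (fst z) (snd z) - averaging_projection n \<beta> F (fst z) (snd z)))\<^sup>2)
        = (\<Sum>z\<in>level b. (cmod (F (fst z) (snd z) - expect (level b) (\<lambda>z. F (fst z) (snd z))))\<^sup>2)"
      by (rule sum.cong) (auto simp: P level_def)
    also have "\<dots> \<le> (\<Sum>z\<in>level b. (cmod (F (fst z) (snd z) - \<Gamma> (fst z0) (snd z0)))\<^sup>2)"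
      by (rule sum_dist_mean_le[OF fin ne])
    also have "\<dots> = (\<Sum>z\<in>level b. (cmod (F (fst z) (snd z) - \<Gamma> (fst z) (snd z)))\<^sup>2)"
    proof (rule sum.cong[OF refl])
      fix z assume "z \<in> level b"
      then have "\<Gamma> (fst z0) (snd z0) = \<Gamma> (fst z) (snd z)"
        using z0 by (intro \<Gamma>) (auto simp: level_def V_def)
      then show "(cmod (F (fst z) (snd z) - \<Gamma> (fst z0) (snd z0)))\<^sup>2
          = (cmod (F (fst z) (snd z) - \<Gamma> (fst z) (snd z)))\<^sup>2"
        by simp
    qed
    finally show "(\<Sum>z\<in>level b. (cmod (F (fst z) (snd z) - averaging_projection n \<beta> F (fst z) (snd z)))\<^sup>2)
      \<le> (\<Sum>z\<in>level b. (cmod (F (fst z) (snd z) - \<Gamma> (fst z) (snd z)))\<^sup>2)" .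
  qed
  then show ?thesis
    unfolding norm_L2_def expect_def V_def[symmetric] case_prod_unfold
    by (intro real_sqrt_le_mono divide_right_mono) auto
qed

lemma affine_self_mapsD:
  assumes "T \<in> affine_self_maps n"
  obtains \<phi> t where "T = (\<lambda>h. \<phi> h + t)" "\<And>x y. \<phi> (x - y) = \<phi> x - \<phi> y"
    "\<And>x. \<phi> x \<in> coord_space n" "t \<in> coord_space n"
proof -
  from assms obtain \<phi> t where \<phi>: "Vector_Spaces.linear scale_fun scale_fun \<phi>" "range \<phi> \<subseteq> coord_space n"
    and T: "T = (\<lambda>h. \<phi> h + t)" "t \<in> coord_space n"
    by (auto simp: affine_self_maps_def)
  interpret \<phi>: Vector_Spaces.linear scale_fun scale_fun \<phi> by (rule \<phi>)
  show ?thesis using that[OF T(1) \<phi>.diff _ T(2)] \<phi>(2) by blast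
qed

text \<open>The target has exactly \<open>k\<close> coordinates, so the forms are listed and padded
  with zero forms. The order is immaterial, as only the equality of all coordinates is used.\<close>

lemma ex_biaffine_map_of_components:
  fixes Cs :: "((nat \<Rightarrow> 'a::field) \<Rightarrow> (nat \<Rightarrow> 'a) \<Rightarrow> 'a) set"
  assumes "finite Cs" "card Cs \<le> k"
    and "\<And>b h. b \<in> Cs \<Longrightarrow> h \<in> coord_space n \<Longrightarrow> affine_fun n (\<lambda>w. b w h)"
    and "\<And>b w. b \<in> Cs \<Longrightarrow> w \<in> coord_space n \<Longrightarrow> affine_fun n (\<lambda>h. b w h)"
  shows "\<exists>\<beta>. biaffine_map n k \<beta> \<and> (\<forall>x y x' y'. \<beta> x y = \<beta> x' y' \<longrightarrow>
    (\<forall>b\<in>Cs. b (coords n x) (coords n y) = b (coords n x') (coords n y')))"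
proof -
  obtain cs where cs: "set cs = Cs" "length cs = card Cs"
    using finite_distinct_list[OF assms(1)] distinct_card by metis
  define b where "b j = (if j < length cs then cs ! j else (\<lambda>w h. 0))" for j
  let ?\<beta> = "\<lambda>x y. vec k (\<lambda>j. b j (coords n x) (coords n y))"
  show ?thesis
  proof (intro exI[of _ ?\<beta>] conjI allI impI ballI)
    show "biaffine_map n k ?\<beta>"
      by (rule biaffine_map_vec) (auto simp: b_def affine_fun_const assms simp flip: cs(1))
    fix x y x' y' c assume eq: "?\<beta> x y = ?\<beta> x' y'" and "c \<in> Cs"
    then obtain j where j: "j < length cs" "c = cs ! j" using cs(1) by (metis in_set_conv_nth)
    then have "j < k" using cs(2) assms(2) by simp
    have "?\<beta> x y $ j = ?\<beta> x' y' $ j" by (simp only: eq)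
    then show "c (coords n x) (coords n y) = c (coords n x') (coords n y')"
      using j \<open>j < k\<close> by (simp add: b_def)
  qed
qed

lemma norm_L2_coords:
  fixes D :: "'p::prime_card mod_ring vec \<Rightarrow> 'p mod_ring vec \<Rightarrow> complex"
  assumes "\<And>w h. w \<in> carrier_vec n \<Longrightarrow> h \<in> carrier_vec n \<Longrightarrow> D w h = E (coords n w) (coords n h)"
  shows "norm_L2 n D = sqrt ((\<Sum>h\<in>coord_space n. \<Sum>w\<in>coord_space n. (cmod (E w h))\<^sup>2)
    / real (card (coord_space n :: (nat \<Rightarrow> 'p mod_ring) set)) ^ 2)"
proof -
  let ?V = "carrier_vec n :: 'p mod_ring vec set"
  have "(\<Sum>(w, h)\<in>?V \<times> ?V. (cmod (D w h))\<^sup>2) = (\<Sum>w\<in>?V. \<Sum>h\<in>?V. (cmod (D w h))\<^sup>2)"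
    by (simp add: sum.cartesian_product)
  also have "\<dots> = (\<Sum>w\<in>?V. \<Sum>h\<in>?V. (cmod (E (coords n w) (coords n h)))\<^sup>2)"
    by (intro sum.cong refl) (simp add: assms)
  also have "\<dots> = (\<Sum>w\<in>?V. \<Sum>h\<in>coord_space n. (cmod (E (coords n w) h))\<^sup>2)"
    by (intro sum.cong refl) (rule sum_carrier_vec)
  also have "\<dots> = (\<Sum>w\<in>coord_space n. \<Sum>h\<in>coord_space n. (cmod (E w h))\<^sup>2)"
    by (rule sum_carrier_vec[of "\<lambda>u. \<Sum>h\<in>coord_space n. (cmod (E u h))\<^sup>2"])
  also have "\<dots> = (\<Sum>h\<in>coord_space n. \<Sum>w\<in>coord_space n. (cmod (E w h))\<^sup>2)"
    by (rule sum.swap)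
  finally show ?thesis
    by (simp add: norm_L2_def expect_def card_cartesian_product card_carrier_coord power2_eq_square)
qed

section \<open>Choice of parameters and conclusion\<close>

text \<open>The squared error \<open>\<zeta>\<^sup>2\<close> is split as one half for missed
  frequencies, a quarter for truncation and a quarter for undetected coincidences.\<close>

lemma ex_biaffine_projection_close:
  fixes f :: "'p::prime_card mod_ring vec \<Rightarrow> 'p mod_ring vec \<Rightarrow> complex" and \<zeta> :: real
  assumes \<zeta>: "0 < \<zeta>" "\<zeta> < 1"
    and f: "\<And>x y. x \<in> carrier_vec n \<Longrightarrow> y \<in> carrier_vec n \<Longrightarrow> cmod (f x y) \<le> 1"
  defines "M \<equiv> exp (2 ^ 69 * (ln (inverse \<zeta>) + ln (real CARD('p))) ^ 6)"
  assumes k: "4 * M ^ 3 * 2 powr M / \<zeta>\<^sup>2 \<le> real k"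
  shows "\<exists>\<beta>. biaffine_map n k \<beta> \<and>
    norm_L2 n (\<lambda>x y. mixed_convolution n f x y - averaging_projection n \<beta> (mixed_convolution n f) x y) \<le> \<zeta>"
proof -
  let ?G = "coord_space n :: (nat \<Rightarrow> 'p mod_ring) set"
  define f' where "f' u v = f (vec n u) (vec n v)" for u v
  have f': "cmod (f' u v) \<le> 1" for u v unfolding f'_def by (rule f) auto
  \<comment> \<open>With these values \<open>2 * (\<delta>\<^sup>2 + \<eta>)\<close> equals
    \<open>(2 / 9 + 1 / 4) * \<zeta>\<^sup>2\<close>, just below one half of
    \<open>\<zeta>\<^sup>2\<close>.\<close>
  define \<delta> \<eta> c K where "\<delta> = \<zeta> / 3" and "\<eta> = \<zeta>\<^sup>2 / 8" and "c = \<delta>\<^sup>2 / 2" and "K = 2 ^ 14 / (c ^ 14 * \<eta> ^ 4)"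
  define \<alpha> where "\<alpha> = c * \<eta> / (64 * K ^ 4 * real CARD('p) powr (32 * K ^ 8))"
  have \<delta>: "\<delta> > 0" and \<eta>: "\<eta> > 0" and c: "c > 0" using \<zeta> by (auto simp: \<delta>_def \<eta>_def c_def)
  have "K > 0" using c \<eta> by (simp add: K_def)
  moreover have p: "real CARD('p) \<ge> 2" using two_le_card[where 'p = 'p] by linarith
  ultimately have \<alpha>: "\<alpha> > 0" using c \<eta> by (simp add: \<alpha>_def)
  obtain m :: nat and T :: "(nat \<Rightarrow> (nat \<Rightarrow> 'p mod_ring) \<Rightarrow> nat \<Rightarrow> 'p mod_ring)" where T: "\<And>i. i < m
      \<Longrightarrow> T i \<in> affine_self_maps n" "m * \<alpha> * \<delta>\<^sup>2 \<le> 1"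
    and uncovered: "card {h\<in>?G. \<exists>r\<in>?G. \<delta> \<le> cmod (coord.coeff2 n f' h r) \<and> (\<forall>i<m. r \<noteq> T i h)} \<le> \<eta> * card ?G"
  proof (rule coord.ex_cover_large_spectrum[of n f' \<alpha> \<delta> \<eta> "affine_self_maps n"])
    fix S assume S: "S \<subseteq> coord.large_spectrum n f' \<delta>" "inj_on fst S" "\<eta> * card ?G \<le> card S"
    show "\<exists>T\<in>affine_self_maps n. \<alpha> * card ?G \<le> card {z\<in>S. snd z = T (fst z)}"
      unfolding \<alpha>_def K_def c_def by (rule ex_affine_in_large_spectrum[OF f' \<delta> \<eta> S])
  qed (use f' \<alpha> \<delta> in auto)
  have "\<exists>\<phi> t. T i = (\<lambda>h. \<phi> h + t) \<and> (\<forall>x y. \<phi> (x - y) = \<phi> x - \<phi> y) \<and> (\<forall>x. \<phi> x \<in> ?G) \<and> t \<in> ?G"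
      if "i < m" for i
    using affine_self_mapsD[OF T(1)[OF that]] by metis
  then obtain \<phi> t where \<phi>t: "\<And>i. i < m \<Longrightarrow> T i = (\<lambda>h. \<phi> i h + t i) \<and>
      (\<forall>x y. \<phi> i (x - y) = \<phi> i x - \<phi> i y) \<and> (\<forall>x. \<phi> i x \<in> ?G) \<and> t i \<in> ?G"
    by metis
  define x where "x = 1 + real m"
  have x: "x \<ge> 1" "real m \<le> x" by (auto simp: x_def)
  define \<epsilon> where "\<epsilon> = \<zeta>\<^sup>2 / (32 * x\<^sup>2)"
  have \<epsilon>: "\<epsilon> > 0" using \<zeta> x by (simp add: \<epsilon>_def)
  \<comment> \<open>A logarithmic \<open>r\<close> would already make \<open>2 ^ r\<close> large
    enough; this one needs only \<open>r \<le> 2 ^ r\<close>, and the bound on \<open>k\<close>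
    affords it.\<close>
  define r where "r = nat \<lceil>8 * x ^ 4 / \<zeta>\<^sup>2\<rceil>"
  have r0: "8 * x ^ 4 / \<zeta>\<^sup>2 \<ge> 0" by (simp add: x_def)
  have r: "8 * x ^ 4 / \<zeta>\<^sup>2 \<le> r" "r \<le> 8 * x ^ 4 / \<zeta>\<^sup>2 + 1"
    unfolding r_def using r0 by linarith+
  obtain U \<Lambda> \<Gamma> where U: "U \<subseteq> ?G" "card U \<le> r" and \<Lambda>: "\<And>i. i < m \<Longrightarrow> \<Lambda> i \<subseteq> ?G" "\<And>i. i < m \<Longrightarrow> card (\<Lambda> i) * \<epsilon> \<le> 1"
    and \<Gamma>_cong: "\<forall>w h w' h'. (\<forall>i<m. add_char (dotp n (\<phi> i h + t i) w) = add_char (dotp n (\<phi> i h'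
        + t i) w')) \<and>
      (\<forall>i<m. \<forall>u\<in>U. add_char (dotp n u (\<phi> i h + t i)) = add_char (dotp n u (\<phi> i h' + t i))) \<and>
      (\<forall>i<m. \<forall>s\<in>\<Lambda> i. add_char (dotp n s h) = add_char (dotp n s h')) \<longrightarrow> \<Gamma> w h = \<Gamma> w' h'"
    and close: "(\<Sum>h\<in>?G. \<Sum>w\<in>?G. (cmod (coord.autocorr n (\<lambda>x. coord.autocorr n (f' x) h) w - \<Gamma> w h))\<^sup>2)
      \<le> real (card ?G) ^ 2 * (2 * (\<delta>\<^sup>2 + \<eta>) + 8 * real m ^ 2 * \<epsilon> + 2 * (1 + real m)\<^sup>2 * real m ^ 2 / 2 ^ r)"
  proof (rule coord.ex_structured_approx[of n f' m \<phi> t \<delta> \<eta> \<epsilon> r])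
    have "{h\<in>?G. \<exists>r\<in>?G. \<delta> \<le> cmod (coord.coeff2 n f' h r) \<and> (\<forall>i<m. r \<noteq> \<phi> i h + t i)}
        = {h\<in>?G. \<exists>r\<in>?G. \<delta> \<le> cmod (coord.coeff2 n f' h r) \<and> (\<forall>i<m. r \<noteq> T i h)}"
      using \<phi>t by simp
    then show "card {h\<in>?G. \<exists>r\<in>?G. \<delta> \<le> cmod (coord.coeff2 n f' h r) \<and> (\<forall>i<m. r \<noteq> \<phi> i h + t i)} \<le> \<eta> * card ?G"
      using uncovered by simp
  qed (use f' \<phi>t \<epsilon> \<delta> in auto)
  have fin_\<Lambda>: "finite (\<Lambda> i)" if "i < m" for i
    using \<Lambda>(1)[OF that] finite_coord_space finite_subset by blast
  have fin_U: "finite U" using U(1) finite_coord_space finite_subset by blast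
  \<comment> \<open>One family of forms for each kind of value on which \<open>\<Gamma>\<close>
    depends: phases, coincidence tests and truncated characters.\<close>
  define C1 where "C1 = (\<lambda>i w h. dotp n (T i h) w) ` {..<m}"
  define C2 where "C2 = (\<lambda>(i, u) (w :: nat \<Rightarrow> 'p mod_ring) h. dotp n u (T i h)) ` ({..<m} \<times> U)"
  define C3 where "C3 = (\<Union>i<m. (\<lambda>s (w :: nat \<Rightarrow> 'p mod_ring) h. dotp n s h) ` \<Lambda> i)"
  define Cs where "Cs = C1 \<union> C2 \<union> C3"
  have fin_Cs: "finite Cs" using fin_\<Lambda> fin_U by (auto simp: Cs_def C1_def C2_def C3_def)
  have T_eq: "T i h = \<phi> i h + t i" if "i < m" for i h using \<phi>t[OF that] by simp
  have mem1: "(\<lambda>w h. dotp n (T i h) w) \<in> Cs" if "i < m" for i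
    using that by (auto simp: Cs_def C1_def)
  have mem2: "(\<lambda>w h. dotp n u (T i h)) \<in> Cs" if "i < m" "u \<in> U" for i u
    using that by (force simp: Cs_def C2_def)
  have mem3: "(\<lambda>w h. dotp n s h) \<in> Cs" if "i < m" "s \<in> \<Lambda> i" for i s
    using that by (auto simp: Cs_def C3_def)
  have "card Cs \<le> k"
  proof -
    have c1: "card C1 \<le> m" unfolding C1_def using card_image_le[of "{..<m}"] by simp
    have "card C2 \<le> card ({..<m} \<times> U)" unfolding C2_def by (rule card_image_le) (simp add: fin_U)
    also have "\<dots> \<le> m * r" using U(2) by (simp add: card_cartesian_product)
    finally have c2: "card C2 \<le> m * r" .
    have "card C3 \<le> (\<Sum>i<m. card ((\<lambda>s (w :: nat \<Rightarrow> 'p mod_ring) h. dotp n s h) ` \<Lambda> i))"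
      unfolding C3_def by (rule card_UN_le) simp
    then have "real (card C3) \<le> real (\<Sum>i<m. card ((\<lambda>s (w :: nat \<Rightarrow> 'p mod_ring) h. dotp n s h) ` \<Lambda> i))"
      by (rule of_nat_mono)
    also have "\<dots> = (\<Sum>i<m. real (card ((\<lambda>s (w :: nat \<Rightarrow> 'p mod_ring) h. dotp n s h) ` \<Lambda> i)))" by simp
    also have "\<dots> \<le> (\<Sum>i<m. 1 / \<epsilon>)"
    proof (rule sum_mono)
      fix i assume "i \<in> {..<m}"
      then have "real (card (\<Lambda> i)) \<le> 1 / \<epsilon>" using \<Lambda>(2)[of i] \<epsilon> by (simp add: field_simps)
      moreover have "card ((\<lambda>s (w :: nat \<Rightarrow> 'p mod_ring) h. dotp n s h) ` \<Lambda> i) \<le> card (\<Lambda> i)"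
        using \<open>i \<in> {..<m}\<close> fin_\<Lambda> by (intro card_image_le) auto
      ultimately show "real (card ((\<lambda>s (w :: nat \<Rightarrow> 'p mod_ring) h. dotp n s h) ` \<Lambda> i)) \<le> 1 / \<epsilon>" by linarith
    qed
    finally have c3: "real (card C3) \<le> m * (1 / \<epsilon>)" by simp
    define z where "z = 1 / \<zeta>\<^sup>2"
    have z: "z \<ge> 1" using \<zeta> by (simp add: z_def power_le_one)
    have "card Cs \<le> card C1 + card C2 + card C3"
      unfolding Cs_def by (meson add_le_mono card_Un_le le_trans order_refl)
    then have "real (card Cs) \<le> real (card C1) + real (card C2) + real (card C3)" by linarith
    also have "\<dots> \<le> m + real m * r + m * (1 / \<epsilon>)"
    proof -
      have "real (card C2) \<le> real (m * r)" using c2 by (rule of_nat_mono)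
      then show ?thesis using c1 c3 by simp
    qed
    also have "\<dots> \<le> x + x * (8 * x ^ 4 * z + 1) + x * (32 * x\<^sup>2 * z)"
    proof (intro add_mono mult_mono)
      show "1 / \<epsilon> \<le> 32 * x\<^sup>2 * z" by (simp add: \<epsilon>_def z_def)
      show "real r \<le> 8 * x ^ 4 * z + 1" using r(2) by (simp add: z_def)
    qed (use x \<epsilon> in auto)
    also have "\<dots> = 2 * x + 8 * (x ^ 5 * z) + 32 * (x ^ 3 * z)"
      by (simp add: algebra_simps eval_nat_numeral)
    \<comment> \<open>The 42 is 2 + 8 + 32: the linear terms, the tests and the characters.\<close>
    also have "\<dots> \<le> 42 * (x ^ 5 * z)"
    proof -
      have "x ^ 1 \<le> x ^ 5" using x by (intro power_increasing) auto
      then have "x * 1 \<le> x ^ 5 * z" using x z by (intro mult_mono) auto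
      moreover have "x ^ 3 * z \<le> x ^ 5 * z" using x z by (intro mult_right_mono power_increasing) auto
      ultimately show ?thesis by linarith
    qed
    also have "\<dots> = 42 * (1 + real m) ^ 5 / \<zeta>\<^sup>2" by (simp add: x_def z_def)
    also have "\<dots> \<le> 4 * M ^ 3 * 2 powr M / \<zeta>\<^sup>2"
    proof (rule divide_right_mono)
      show "42 * (1 + real m) ^ 5 \<le> 4 * M ^ 3 * 2 powr M"
        unfolding M_def
        by (rule iterations_le_doubly_exponential[OF \<zeta> p])
          (use T(2) in \<open>simp_all add: \<alpha>_def K_def c_def \<eta>_def \<delta>_def\<close>)
    qed simp
    finally show ?thesis using k by linarith
  qed
  have "\<exists>\<beta>. biaffine_map n k \<beta> \<and> (\<forall>x y x' y'. \<beta> x y = \<beta> x' y' \<longrightarrow>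
    (\<forall>b\<in>Cs. b (coords n x) (coords n y) = b (coords n x') (coords n y')))"
  proof (rule ex_biaffine_map_of_components[OF fin_Cs \<open>card Cs \<le> k\<close>])
    show "affine_fun n (\<lambda>w. b w h)" if "b \<in> Cs" for b h
      using that by (auto simp: Cs_def C1_def C2_def C3_def affine_fun_const affine_fun_dotp)
    show "affine_fun n (\<lambda>h. b w h)" if "b \<in> Cs" for b w
    proof -
      have "affine_fun n (\<lambda>h. dotp n (T i h) w)" if "i < m" for i
        unfolding dotp_commute[of n _ w] by (rule affine_fun_dotp_affine[OF T(1)[OF that]])
      then show ?thesis
        using that T(1) by (auto simp: Cs_def C1_def C2_def C3_def affine_fun_dotp intro:
            affine_fun_dotp_affine)
    qed
  qed
  then obtain \<beta> where \<beta>: "biaffine_map n k \<beta>"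
    and \<beta>_eq: "\<And>x y x' y' b. \<beta> x y = \<beta> x' y' \<Longrightarrow> b \<in> Cs \<Longrightarrow> b (coords n x) (coords n y)
        = b (coords n x') (coords n y')"
    by blast
  have "norm_L2 n (\<lambda>x y. mixed_convolution n f x y - averaging_projection n \<beta> (mixed_convolution n f) x y)
      \<le> norm_L2 n (\<lambda>x y. mixed_convolution n f x y - \<Gamma> (coords n x) (coords n y))"
  proof (rule norm_averaging_projection_le)
    fix x y x' y' assume eq: "\<beta> x y = \<beta> x' y'"
    note eqs = \<beta>_eq[OF eq]
    show "\<Gamma> (coords n x) (coords n y) = \<Gamma> (coords n x') (coords n y')"
    proof (rule \<Gamma>_cong[rule_format], intro conjI allI impI ballI)
      show "add_char (dotp n (\<phi> i (coords n y) + t i) (coords n x))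
          = add_char (dotp n (\<phi> i (coords n y') + t i) (coords n x'))" if "i < m" for i
        using eqs[OF mem1[OF that]] T_eq[OF that] by simp
      show "add_char (dotp n u (\<phi> i (coords n y) + t i))
          = add_char (dotp n u (\<phi> i (coords n y') + t i))" if "i < m" "u \<in> U" for i u
        using eqs[OF mem2[OF that]] T_eq[OF that(1)] by simp
      show "add_char (dotp n s (coords n y)) = add_char (dotp n s (coords n y'))"
          if "i < m" "s \<in> \<Lambda> i" for i s
        using eqs[OF mem3[OF that]] by simp
    qed
  qed
  also have "\<dots> = sqrt ((\<Sum>h\<in>?G. \<Sum>w\<in>?G. (cmod (coord.autocorr n (\<lambda>x. coord.autocorr n (f' x) h) w - \<Gamma> w h))\<^sup>2)
      / real (card ?G) ^ 2)"
    by (rule norm_L2_coords) (simp add: mixed_convolution_conv_autocorr f'_def[abs_def])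
  also have "\<dots> \<le> sqrt (\<zeta>\<^sup>2)"
  proof (rule real_sqrt_le_mono)
    have N: "real (card ?G) > 0" using coord.N_pos by simp
    have e1: "2 * (\<delta>\<^sup>2 + \<eta>) \<le> \<zeta>\<^sup>2 / 2" by (simp add: \<delta>_def \<eta>_def power_divide)
    have "(real m)\<^sup>2 \<le> x\<^sup>2" using x by (intro power_mono) auto
    then have e2: "8 * real m ^ 2 * \<epsilon> \<le> \<zeta>\<^sup>2 / 4"
      using x \<zeta> mult_left_mono[of "(real m)\<^sup>2" "x\<^sup>2" "\<zeta>\<^sup>2"] by (simp add: \<epsilon>_def field_simps)
    have "real r \<le> 2 ^ r" using of_nat_mono[OF less_imp_le[OF less_exp[of r]], where 'a = real] by simp
    then have "8 * x ^ 4 / \<zeta>\<^sup>2 \<le> 2 ^ r" using r(1) by linarith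
    then have "2 * x ^ 4 \<le> \<zeta>\<^sup>2 / 4 * 2 ^ r" using \<zeta> by (simp add: field_simps)
    moreover have "2 * (1 + real m)\<^sup>2 * real m ^ 2 \<le> 2 * x ^ 4"
    proof -
      have "x\<^sup>2 * real m ^ 2 \<le> x\<^sup>2 * x\<^sup>2" using x by (intro mult_left_mono power_mono) auto
      then show ?thesis by (simp add: x_def flip: power_add)
    qed
    ultimately have "2 * (1 + real m)\<^sup>2 * real m ^ 2 \<le> \<zeta>\<^sup>2 / 4 * 2 ^ r" by linarith
    then have e3: "2 * (1 + real m)\<^sup>2 * real m ^ 2 / 2 ^ r \<le> \<zeta>\<^sup>2 / 4"
      by (simp add: divide_le_eq)
    have "2 * (\<delta>\<^sup>2 + \<eta>) + 8 * real m ^ 2 * \<epsilon> + 2 * (1 + real m)\<^sup>2 * real m ^ 2 / 2 ^ r \<le> \<zeta>\<^sup>2"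
      using e1 e2 e3 by linarith
    then have "real (card ?G) ^ 2 * (2 * (\<delta>\<^sup>2 + \<eta>) + 8 * real m ^ 2 * \<epsilon> + 2 * (1
        + real m)\<^sup>2 * real m ^ 2 / 2 ^ r)
      \<le> real (card ?G) ^ 2 * \<zeta>\<^sup>2" by (rule mult_left_mono) simp
    with close have "(\<Sum>h\<in>?G. \<Sum>w\<in>?G. (cmod (coord.autocorr n (\<lambda>x. coord.autocorr n (f' x) h) w - \<Gamma> w h))\<^sup>2)
      \<le> real (card ?G) ^ 2 * \<zeta>\<^sup>2" by (rule order_trans)
    then show "(\<Sum>h\<in>?G. \<Sum>w\<in>?G. (cmod (coord.autocorr n (\<lambda>x. coord.autocorr n (f' x) h) w - \<Gamma> w h))\<^sup>2)
      / real (card ?G) ^ 2 \<le> \<zeta>\<^sup>2"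
      using N by (simp add: divide_le_eq mult.commute)
  qed
  also have "\<dots> = \<zeta>" using \<zeta> by simp
  finally show ?thesis using \<beta> by blast
qed

lemma norm_mixed_convolution_projection_le:
  fixes f :: "'p::prime_card mod_ring vec \<Rightarrow> 'p mod_ring vec \<Rightarrow> complex"
  assumes f: "\<And>x y. x \<in> carrier_vec n \<Longrightarrow> y \<in> carrier_vec n \<Longrightarrow> cmod (f x y) \<le> 1"
  shows "norm_L2 n (\<lambda>x y. mixed_convolution n f x y - averaging_projection n \<beta> (mixed_convolution n
      f) x y) \<le> 1"
proof -
  let ?G = "coord_space n :: (nat \<Rightarrow> 'p mod_ring) set"
  let ?F = "\<lambda>w h. coord.autocorr n (\<lambda>u. coord.autocorr n (\<lambda>v. f (vec n u) (vec n v)) h) w"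
  have F: "cmod (?F w h) \<le> 1" if "w \<in> ?G" "h \<in> ?G" for w h
    using that f by (intro coord.norm_autocorr_le) auto
  have "norm_L2 n (\<lambda>x y. mixed_convolution n f x y - averaging_projection n \<beta> (mixed_convolution n f) x y)
      \<le> norm_L2 n (\<lambda>x y. mixed_convolution n f x y - 0)"
    by (rule norm_averaging_projection_le) simp
  also have "\<dots> = sqrt ((\<Sum>h\<in>?G. \<Sum>w\<in>?G. (cmod (?F w h))\<^sup>2) / real (card ?G) ^ 2)"
    by (rule norm_L2_coords) (simp add: mixed_convolution_conv_autocorr)
  also have "\<dots> \<le> sqrt 1"
  proof (rule real_sqrt_le_mono)
    have "(\<Sum>h\<in>?G. \<Sum>w\<in>?G. (cmod (?F w h))\<^sup>2) \<le> (\<Sum>h\<in>?G. \<Sum>w\<in>?G. 1)"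
      using F by (intro sum_mono) (simp add: power_le_one)
    also have "\<dots> = real (card ?G) ^ 2" by (simp add: power2_eq_square)
    finally show "(\<Sum>h\<in>?G. \<Sum>w\<in>?G. (cmod (?F w h))\<^sup>2) / real (card ?G) ^ 2 \<le> 1"
      using coord.N_pos[of n] by (simp add: divide_le_eq)
  qed
  finally show ?thesis by simp
qed

theorem theorem4p15:
  fixes \<zeta> :: real
  assumes "\<zeta> > 0"
  shows "\<exists>k::nat. k > 0 \<and>
    (let m = exp (2 ^ 69 * (ln (inverse \<zeta>) + ln (real CARD('p::prime_card))) ^ 6)
     in int k = \<lceil>4 * m ^ 3 * 2 powr m / \<zeta>\<^sup>2\<rceil>) \<and>
    (\<forall>n. \<forall>f :: 'p mod_ring vec \<Rightarrow> 'p mod_ring vec \<Rightarrow> complex.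
       (\<forall>x \<in> carrier_vec n. \<forall>y \<in> carrier_vec n. cmod (f x y) \<le> 1) \<longrightarrow>
       (\<exists>\<beta> :: 'p mod_ring vec \<Rightarrow> 'p mod_ring vec \<Rightarrow> 'p mod_ring vec.
          biaffine_map n k \<beta> \<and>
          (let F = mixed_convolution n f
           in norm_L2 n (\<lambda>x y. F x y - averaging_projection n \<beta> F x y) \<le> \<zeta>)))"
proof -
  define m where "m = exp (2 ^ 69 * (ln (inverse \<zeta>) + ln (real CARD('p))) ^ 6)"
  define k where "k = nat \<lceil>4 * m ^ 3 * 2 powr m / \<zeta>\<^sup>2\<rceil>"
  have pos: "4 * m ^ 3 * 2 powr m / \<zeta>\<^sup>2 > 0" using assms by (simp add: m_def)
  have k: "k > 0" "int k = \<lceil>4 * m ^ 3 * 2 powr m / \<zeta>\<^sup>2\<rceil>" "4 * m ^ 3 * 2 powr m / \<zeta>\<^sup>2 \<le> real k"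
    unfolding k_def using pos by (simp_all add: real_nat_ceiling_ge)
  have "\<exists>\<beta>. biaffine_map n k \<beta> \<and>
      norm_L2 n (\<lambda>x y. mixed_convolution n f x y - averaging_projection n \<beta> (mixed_convolution n f)
          x y) \<le> \<zeta>"
    if f: "\<forall>x \<in> carrier_vec n. \<forall>y \<in> carrier_vec n. cmod (f x y) \<le> 1"
    for n and f :: "'p mod_ring vec \<Rightarrow> 'p mod_ring vec \<Rightarrow> complex"
  proof (cases "\<zeta> < 1")
    case True
    show ?thesis
      by (rule ex_biaffine_projection_close[OF assms True _ k(3)[unfolded m_def]]) (use f in auto)
  next
    case False
    let ?\<beta> = "\<lambda>x y. vec k (\<lambda>j. 0 :: 'p mod_ring)"
    have "biaffine_map n k ?\<beta>"
      by (rule biaffine_map_vec) (rule affine_fun_const)+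
    moreover have "norm_L2 n (\<lambda>x y. mixed_convolution n f x y - averaging_projection n ?\<beta>
        (mixed_convolution n f) x y) \<le> \<zeta>"
      using norm_mixed_convolution_projection_le[of n f ?\<beta>] f False by auto
    ultimately show ?thesis by blast
  qed
  with k(1,2) show ?thesis unfolding Let_def m_def[symmetric] by blast
qed

end
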